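(* Let $\Theta_1,\Theta_2\in H^\infty(\mathcal{L}(\mathcal{H}))$ be pure inner functions and let $J_1,J_2$ be conjugations on $\mathcal{H}$ such that $\Theta_1$ is $J_1$-symmetric and $\Theta_2$ is $J_2$-symmetric. For every $\Phi\in L^2(\mathcal{L}(\mathcal{H}))$ the following equalities of (densely defined) operators hold, where each symbol on the right is a function of $z\in\mathbb{T}$: (a) $\mathbf{C}_{\Theta_2}A_\Phi^{\Theta_1,\Theta_2}\mathbf{C}_{\Theta_1}=A_{\Psi}^{\Theta_1,\Theta_2}$ with $\Psi(z)=J_2\Theta_2(z)^*\Phi(z)\Theta_1(z)J_1$; (b) $\mathbf{C}_{\Theta_2}B_\Phi^{\Theta_1,\Theta_2}\mathbf{C}_{\Theta_1}=B_{\Psi}^{\Theta_1,\Theta_2}$ with $\Psi(z)=J_2\widetilde{\Theta}_2(z)\Phi(z)\Theta_1(z)J_1$; (c) $\mathbf{J}_2^*A_\Phi^{\Theta_1,\Theta_2}\mathbf{J}_1^*=A_{\Psi}^{\widetilde{\Theta}_1,\widetilde{\Theta}_2}$ with $\Psi(z)=J_2\Phi(\bar z)J_1$; (d) $\mathbf{J}_2^*B_\Phi^{\Theta_1,\Theta_2}\mathbf{J}_1^*=B_{\Psi}^{\widetilde{\Theta}_1,\widetilde{\Theta}_2}$ with $\Psi(z)=J_2\Phi(\bar z)J_1$; (e) $\mathbf{C}_{\Theta_2}A_\Phi^{\Theta_1,\Theta_2}\mathbf{J}_1^*=B_{\Psi}^{\widetilde{\Theta}_1,\Theta_2}$ with $\Psi(z)=J_2\Theta_2(\bar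 z)^*\Phi(\bar z)J_1$; (f) $\mathbf{J}_2^*B_\Phi^{\Theta_1,\Theta_2}\mathbf{C}_{\Theta_1}=A_{\Psi}^{\Theta_1,\widetilde{\Theta}_2}$ with $\Psi(z)=J_2\Phi(z)\Theta_1(z)J_1$.
   Context: $\mathcal{H}$ is a finite-dimensional complex Hilbert space and $\mathcal{L}(\mathcal{H})$ is the algebra of linear operators on it, also regarded as a Hilbert space with the Hilbert-Schmidt norm. $\mathbb{T}$ is the unit circle with normalized Lebesgue measure. $L^2(\mathcal{H})$, $L^2(\mathcal{L}(\mathcal{H}))$ are the usual spaces of square-integrable functions on $\mathbb{T}$; $H^2(\mathcal{H})$ is the subspace of $L^2(\mathcal{H})$ of functions whose negatively indexed Fourier coefficients vanish (identified with analytic functions on the unit disk $\mathbb{D}$); $P_+$ is the orthogonal projection of $L^2(\mathcal{H})$ onto $H^2(\mathcal{H})$. $H^\infty(\mathcal{H})$ and $H^\infty(\mathcal{L}(\mathcal{H}))$ are the bounded analytic functions. A function $\Theta\in H^\infty(\mathcal{L}(\mathcal{H}))$ is inner if $\Theta(z)$ is unitary for a.e. $z\in\mathbb{T}$, and pure if moreover $\|\Theta(0)\|<1$. Put $\widetilde{\Theta}(z)=\Theta(\bar z)^*$, which is again (pure) inner. The model space is $K_\Theta=H^2(\mathcal{H})\ominus\Theta H^2(\mathcal{H})$; $P_\Theta$ is the orthogonal projection of $L^2(\mathcal{H})$ onto $K_\Theta$; $K_\Theta^\infty=K_\Theta\cap H^\infty(\mathcal{H})$, which is dense in $K_\Theta$.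 For $\Phi\in L^2(\mathcal{L}(\mathcal{H}))$ and $f\in K_{\Theta_1}^\infty$, put $A_\Phi^{\Theta_1,\Theta_2}f=P_{\Theta_2}(\Phi f)$ and $B_\Phi^{\Theta_1,\Theta_2}f=P_{\Theta_2}\mathbf{J}(I-P_+)(\Phi f)$, where $\mathbf{J}$ is the flip operator $(\mathbf{J}f)(z)=\bar z f(\bar z)$ on $L^2(\mathcal{H})$; these are densely defined operators from $K_{\Theta_1}$ to $K_{\Theta_2}$ (matrix valued asymmetric truncated Toeplitz, respectively Hankel, operators). A conjugation on $\mathcal{H}$ is an antilinear map $J$ with $J^2=I$ and $\langle Jx,Jy\rangle=\langle y,x\rangle$ for all $x,y$. $\Theta$ is $J$-symmetric if $J\Theta(z)J=\Theta(z)^*$ for a.e. $z\in\mathbb{T}$. For $i=1,2$, $\mathbf{J}_i^*$ is the conjugation on $L^2(\mathcal{H})$ given by $(\mathbf{J}_i^*f)(z)=J_i(f(\bar z))$; since $\Theta_i$ is $J_i$-symmetric, it maps $K_{\Theta_i}$ onto $K_{\widetilde{\Theta}_i}$ and $K_{\widetilde{\Theta}_i}$ onto $K_{\Theta_i}$. Also $(\mathbf{C}_{\Theta_i}f)(z)=\Theta_i(z)\bar z J_i(f(z))$, which is a conjugation on $L^2(\mathcal{H})$ mapping $K_{\Theta_i}$ onto $K_{\Theta_i}$. These antilinear maps preserve boundedness of functions, and the equalities of operators are understood on the bounded functions in the relevant model space. *)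

theory Defs
  imports "HOL-Analysis.Analysis"
begin

text \<open>
  Finite-dimensional complex Hilbert spaces. The inner product is linear in the first argument.
  The superclass supplies the topology and the finite dimension (over the reals); positivity of
  \<open>cinner\<close> follows from that of \<open>inner\<close>, its real part. The set \<open>Basis\<close> of the superclass is some
  real orthonormal basis and need not be related to the complex structure.
\<close>

class fd_chilbert = euclidean_space +
  fixes scaleC :: "complex \<Rightarrow> 'a \<Rightarrow> 'a"  (infixr \<open>*\<^sub>C\<close> 75)
    and cinner :: "'a \<Rightarrow> 'a \<Rightarrow> complex"
  assumes scaleC_add_right: "a *\<^sub>C (x + y) = a *\<^sub>C x + a *\<^sub>C y"
    and scaleC_add_left: "(a + b) *\<^sub>C x = a *\<^sub>C x + b *\<^sub>C x"
    and scaleC_scaleC: "a *\<^sub>C (b *\<^sub>C x) = (a * b) *\<^sub>C x"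
    and scaleR_scaleC: "r *\<^sub>R x = complex_of_real r *\<^sub>C x"
    and cinner_commute: "cinner x y = cnj (cinner y x)"
    and cinner_add_left: "cinner (x + y) z = cinner x z + cinner y z"
    and cinner_scaleC_left: "cinner (a *\<^sub>C x) y = a * cinner x y"
    and inner_Re_cinner: "inner x y = Re (cinner x y)"

text \<open>The two instances below together make \<open>complex ^ 'n\<close> with its usual inner product an instance.\<close>

instantiation complex :: fd_chilbert
begin
definition "scaleC_complex (a::complex) (x::complex) = a * x"
definition "cinner_complex (x::complex) (y::complex) = x * cnj y"
instance
  by standard (auto simp: scaleC_complex_def cinner_complex_def algebra_simps scaleR_conv_of_real
      inner_complex_def)
end

instantiation vec :: (fd_chilbert, finite) fd_chilbert
begin
definition "scaleC_vec (a::complex) (x::'a ^ 'b) = (\<chi> i. a *\<^sub>C x $ i)"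
definition "cinner_vec (x::'a ^ 'b) y = (\<Sum>i\<in>UNIV. cinner (x $ i) (y $ i))"
instance
proof
  fix x y :: "'a ^ 'b"
  show "cinner x y = cnj (cinner y x)"
    unfolding cinner_vec_def cnj_sum by (rule sum.cong[OF refl]) (rule cinner_commute)
qed (auto simp: scaleC_vec_def cinner_vec_def vec_eq_iff scaleC_add_right scaleC_add_left
      scaleC_scaleC scaleR_scaleC cinner_add_left sum.distrib cinner_scaleC_left sum_distrib_left
      inner_vec_def inner_Re_cinner)
end


subsection \<open>Operators on the Hilbert space\<close>

definition clinear :: "('h::fd_chilbert \<Rightarrow> 'h) \<Rightarrow> bool" where
  "clinear A \<longleftrightarrow> (\<forall>x y. A (x + y) = A x + A y) \<and> (\<forall>c x. A (c *\<^sub>C x) = c *\<^sub>C A x)"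

definition cadjoint :: "('h::fd_chilbert \<Rightarrow> 'h) \<Rightarrow> 'h \<Rightarrow> 'h" where
  "cadjoint A = (THE B. \<forall>x y. cinner (A x) y = cinner x (B y))"

definition unitary_op :: "('h::fd_chilbert \<Rightarrow> 'h) \<Rightarrow> bool" where
  "unitary_op A \<longleftrightarrow> clinear A \<and> cadjoint A \<circ> A = id \<and> A \<circ> cadjoint A = id"

text \<open>
  If \<open>E\<close> is a complex orthonormal basis, then \<open>E \<union> \<i>E\<close> is a real one, and the sum below does not
  depend on the choice of the real orthonormal basis. So the sum counts the usual one over \<open>E\<close> twice.
\<close>

definition hs_norm :: "('h::fd_chilbert \<Rightarrow> 'h) \<Rightarrow> real" where
  "hs_norm A = sqrt ((\<Sum>b\<in>Basis. (norm (A b))\<^sup>2) / 2)"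

definition conjugation :: "('h::fd_chilbert \<Rightarrow> 'h) \<Rightarrow> bool" where
  "conjugation J \<longleftrightarrow>
     (\<forall>x y. J (x + y) = J x + J y) \<and> (\<forall>c x. J (c *\<^sub>C x) = cnj c *\<^sub>C J x) \<and>
     J \<circ> J = id \<and> (\<forall>x y. cinner (J x) (J y) = cinner y x)"


subsection \<open>Function spaces on the unit circle\<close>

text \<open>
  A function on the circle is a function on \<open>complex\<close> whose values off the circle are irrelevant.
  Elements of the spaces below are functions, not classes; every notion is invariant under
  almost everywhere equality, so that Borel measurability loses nothing against Lebesgue
  measurability. Equality in these spaces is equality almost everywhere.
\<close>

definition circle_measure :: "complex measure" where
  "circle_measure =
     distr (uniform_measure lborel {0..<2 * pi}) (restrict_space borel (sphere 0 1)) cis"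

definition L2 :: "(complex \<Rightarrow> 'h::fd_chilbert) set" where
  "L2 = {f. f \<in> borel_measurable circle_measure \<and>
            integrable circle_measure (\<lambda>z. (norm (f z))\<^sup>2)}"

definition L2_inner :: "(complex \<Rightarrow> 'h::fd_chilbert) \<Rightarrow> (complex \<Rightarrow> 'h) \<Rightarrow> complex" where
  "L2_inner f g = (LINT z|circle_measure. cinner (f z) (g z))"

definition fourier_coeff :: "(complex \<Rightarrow> 'h::fd_chilbert) \<Rightarrow> int \<Rightarrow> 'h" where
  "fourier_coeff f n = (LINT z|circle_measure. (z powi (- n)) *\<^sub>C f z)"

definition H2 :: "(complex \<Rightarrow> 'h::fd_chilbert) set" where
  "H2 = {f \<in> L2. \<forall>n<0. fourier_coeff f n = 0}"

text \<open>The analytic function on the open unit disc with which a function in \<open>H2\<close> is identified.\<close>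

definition disc_ext :: "(complex \<Rightarrow> 'h::fd_chilbert) \<Rightarrow> complex \<Rightarrow> 'h" where
  "disc_ext f w = (\<Sum>n. w ^ n *\<^sub>C fourier_coeff f (int n))"

definition Hinf :: "(complex \<Rightarrow> 'h::fd_chilbert) set" where
  "Hinf = {f \<in> H2. bounded (disc_ext f ` ball 0 1)}"

text \<open>
  For operator valued functions, measurability, Fourier coefficients and the analytic extension
  are taken pointwise on vectors; as the space is finite-dimensional, this is the same as taking
  them in the space of operators.
\<close>

definition L2_op :: "(complex \<Rightarrow> 'h::fd_chilbert \<Rightarrow> 'h) set" where
  "L2_op = {\<Phi>. (\<forall>z\<in>sphere 0 1. clinear (\<Phi> z)) \<and>
                (\<forall>x. (\<lambda>z. \<Phi> z x) \<in> borel_measurable circle_measure) \<and>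
                integrable circle_measure (\<lambda>z. (hs_norm (\<Phi> z))\<^sup>2)}"

definition fourier_coeff_op :: "(complex \<Rightarrow> 'h::fd_chilbert \<Rightarrow> 'h) \<Rightarrow> int \<Rightarrow> 'h \<Rightarrow> 'h" where
  "fourier_coeff_op \<Phi> n = (\<lambda>x. fourier_coeff (\<lambda>z. \<Phi> z x) n)"

definition disc_ext_op :: "(complex \<Rightarrow> 'h::fd_chilbert \<Rightarrow> 'h) \<Rightarrow> complex \<Rightarrow> 'h \<Rightarrow> 'h" where
  "disc_ext_op \<Phi> w = (\<lambda>x. \<Sum>n. w ^ n *\<^sub>C fourier_coeff_op \<Phi> (int n) x)"

definition Hinf_op :: "(complex \<Rightarrow> 'h::fd_chilbert \<Rightarrow> 'h) set" where
  "Hinf_op = {\<Phi> \<in> L2_op. (\<forall>n<0. fourier_coeff_op \<Phi> n = (\<lambda>x. 0)) \<and>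
                          (\<exists>M. \<forall>w\<in>ball 0 1. onorm (disc_ext_op \<Phi> w) \<le> M)}"


subsection \<open>Inner functions and model spaces\<close>

definition inner_fun :: "(complex \<Rightarrow> 'h::fd_chilbert \<Rightarrow> 'h) \<Rightarrow> bool" where
  "inner_fun \<Theta> \<longleftrightarrow> \<Theta> \<in> Hinf_op \<and> (AE z in circle_measure. unitary_op (\<Theta> z))"

definition pure_inner :: "(complex \<Rightarrow> 'h::fd_chilbert \<Rightarrow> 'h) \<Rightarrow> bool" where
  "pure_inner \<Theta> \<longleftrightarrow> inner_fun \<Theta> \<and> onorm (disc_ext_op \<Theta> 0) < 1"

definition tilde :: "(complex \<Rightarrow> 'h::fd_chilbert \<Rightarrow> 'h) \<Rightarrow> complex \<Rightarrow> 'h \<Rightarrow> 'h" where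
  "tilde \<Theta> z = cadjoint (\<Theta> (cnj z))"

definition J_symmetric :: "('h::fd_chilbert \<Rightarrow> 'h) \<Rightarrow> (complex \<Rightarrow> 'h \<Rightarrow> 'h) \<Rightarrow> bool" where
  "J_symmetric J \<Theta> \<longleftrightarrow> (AE z in circle_measure. J \<circ> \<Theta> z \<circ> J = cadjoint (\<Theta> z))"

definition model_space :: "(complex \<Rightarrow> 'h::fd_chilbert \<Rightarrow> 'h) \<Rightarrow> (complex \<Rightarrow> 'h) set" where
  "model_space \<Theta> = {f \<in> H2. \<forall>h\<in>H2. L2_inner f (\<lambda>z. \<Theta> z (h z)) = 0}"

definition model_space_inf :: "(complex \<Rightarrow> 'h::fd_chilbert \<Rightarrow> 'h) \<Rightarrow> (complex \<Rightarrow> 'h) set" where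
  "model_space_inf \<Theta> = model_space \<Theta> \<inter> Hinf"

text \<open>
  The orthogonal projection onto a closed subspace \<open>S\<close> of \<open>L2\<close>. The projection of \<open>f\<close> is determined
  only up to equality almost everywhere, whence the choice of a representative.
\<close>

definition orth_proj :: "(complex \<Rightarrow> 'h::fd_chilbert) set \<Rightarrow> (complex \<Rightarrow> 'h) \<Rightarrow> complex \<Rightarrow> 'h" where
  "orth_proj S f = (SOME g. g \<in> S \<and> (\<forall>h\<in>S. L2_inner (\<lambda>z. f z - g z) h = 0))"

abbreviation P_plus :: "(complex \<Rightarrow> 'h::fd_chilbert) \<Rightarrow> complex \<Rightarrow> 'h" where
  "P_plus \<equiv> orth_proj H2"

abbreviation P_model ::
  "(complex \<Rightarrow> 'h::fd_chilbert \<Rightarrow> 'h) \<Rightarrow> (complex \<Rightarrow> 'h) \<Rightarrow> complex \<Rightarrow> 'h" where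
  "P_model \<Theta> \<equiv> orth_proj (model_space \<Theta>)"

definition flip :: "(complex \<Rightarrow> 'h::fd_chilbert) \<Rightarrow> complex \<Rightarrow> 'h" where
  "flip f = (\<lambda>z. cnj z *\<^sub>C f (cnj z))"


subsection \<open>Truncated Toeplitz and Hankel operators, and conjugations\<close>

text \<open>
  The operators have domain \<open>model_space_inf \<Theta>1\<close> and are \<open>undefined\<close> elsewhere, so an equation
  about a composition involving them also requires that their arguments lie in that domain.
\<close>

definition toeplitz_op ::
  "(complex \<Rightarrow> 'h::fd_chilbert \<Rightarrow> 'h) \<Rightarrow> (complex \<Rightarrow> 'h \<Rightarrow> 'h) \<Rightarrow> (complex \<Rightarrow> 'h \<Rightarrow> 'h)
     \<Rightarrow> (complex \<Rightarrow> 'h) \<Rightarrow> complex \<Rightarrow> 'h" where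
  "toeplitz_op \<Theta>1 \<Theta>2 \<Phi> = (\<lambda>f\<in>model_space_inf \<Theta>1. P_model \<Theta>2 (\<lambda>z. \<Phi> z (f z)))"

definition hankel_op ::
  "(complex \<Rightarrow> 'h::fd_chilbert \<Rightarrow> 'h) \<Rightarrow> (complex \<Rightarrow> 'h \<Rightarrow> 'h) \<Rightarrow> (complex \<Rightarrow> 'h \<Rightarrow> 'h)
     \<Rightarrow> (complex \<Rightarrow> 'h) \<Rightarrow> complex \<Rightarrow> 'h" where
  "hankel_op \<Theta>1 \<Theta>2 \<Phi> = (\<lambda>f\<in>model_space_inf \<Theta>1.
     P_model \<Theta>2 (flip (\<lambda>z. \<Phi> z (f z) - P_plus (\<lambda>u. \<Phi> u (f u)) z)))"

definition J_star :: "('h::fd_chilbert \<Rightarrow> 'h) \<Rightarrow> (complex \<Rightarrow> 'h) \<Rightarrow> complex \<Rightarrow> 'h" where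
  "J_star J f = (\<lambda>z. J (f (cnj z)))"

definition C_conj ::
  "(complex \<Rightarrow> 'h::fd_chilbert \<Rightarrow> 'h) \<Rightarrow> ('h \<Rightarrow> 'h) \<Rightarrow> (complex \<Rightarrow> 'h) \<Rightarrow> complex \<Rightarrow> 'h" where
  "C_conj \<Theta> J f = (\<lambda>z. \<Theta> z (cnj z *\<^sub>C J (f z)))"

definition op_eq_on ::
  "(complex \<Rightarrow> 'h::fd_chilbert) set \<Rightarrow> ((complex \<Rightarrow> 'h) \<Rightarrow> complex \<Rightarrow> 'h)
     \<Rightarrow> ((complex \<Rightarrow> 'h) \<Rightarrow> complex \<Rightarrow> 'h) \<Rightarrow> bool" where
  "op_eq_on D S T \<longleftrightarrow> (\<forall>f\<in>D. AE z in circle_measure. S f z = T f z)"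

end

theory Submission
  imports Defs
begin

text \<open>
  The maps \<open>C_conj \<Theta> J\<close> and \<open>J_star J\<close> are antiunitary on \<open>L2\<close>. If \<open>\<Theta>\<close> is \<open>J\<close>-symmetric, both are
  involutions; the first preserves the model space of \<open>\<Theta>\<close>, and the second exchanges it with that
  of \<open>tilde \<Theta>\<close> (\<open>C_conj_model_space\<close>, \<open>J_star_model_space_tilde\<close>). An antiunitary map from one
  closed subspace onto another intertwines the orthogonal projections
  (\<open>P_model_antiunitary\<close>), so in every part of the theorem the outer conjugation can be moved
  inside the projection. Both sides are then projections of functions that agree at almost every
  point of the circle: to see this, one moves the scalar \<open>cnj z\<close> through the operators and
  uses \<open>J \<circ> \<Theta> z \<circ> J = cadjoint (\<Theta> z)\<close>, at \<open>z\<close> or at \<open>cnj z\<close>.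

  For Hankel operators the same argument applies because the factor \<open>I - P\<^sub>+\<close> is invisible to the
  outer projection: the flip sends the Hardy space to its orthogonal complement
  (\<open>P_model_flip_minus_P_plus\<close>). The Hankel operator thus projects the flip of \<open>\<Phi> f\<close>, and composing
  one conjugation of each kind absorbs or produces this flip, which is why the last two parts
  relate Toeplitz to Hankel operators.

  Three analytic facts support this. First, the projections exist and are determined almost
  everywhere: \<open>L2\<close> is complete, and the Hardy and model spaces are annihilators of sets of
  functions (\<open>orthogonal_projection_exists\<close>, \<open>orth_proj_unique\<close>). Second, a function all of whose
  Fourier coefficients vanish is zero almost everywhere (\<open>fourier_coeff_unique\<close>), whence functions
  with disjoint spectra are orthogonal (\<open>H2_orthogonal\<close>). Third, the conjugations must map the
  domains of the operators to each other, that is, preserve boundedness. Boundedness is defined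
  through the analytic extension to the disc, whereas the conjugations act on boundary values, so
  the two notions of boundedness have to be compared (\<open>Hinf_iff\<close>): one direction is the Poisson
  formula, and the other, like uniqueness, rests on a duality estimate tested on trigonometric
  polynomials (\<open>AE_bounded_by_duality\<close>).
\<close>

section \<open>Operators on a finite-dimensional complex Hilbert space\<close>

lemma scaleC_one [simp]: "1 *\<^sub>C (x::'h::fd_chilbert) = x"
  using scaleR_scaleC[of 1 x] by simp

lemma scaleC_zero_left [simp]: "0 *\<^sub>C (x::'h::fd_chilbert) = 0"
  using scaleR_scaleC[of 0 x] by simp

lemma scaleC_conv_scaleR: "c *\<^sub>C (x::'h::fd_chilbert) = Re c *\<^sub>R x + Im c *\<^sub>R (\<i> *\<^sub>C x)"
proof -
  have "c = complex_of_real (Re c) + complex_of_real (Im c) * \<i>"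
    by (simp add: complex_eq_iff)
  then show ?thesis
    by (metis scaleC_add_left scaleC_scaleC scaleR_scaleC)
qed

lemma cinner_scaleC_right: "cinner (x::'h::fd_chilbert) (a *\<^sub>C y) = cnj a * cinner x y"
  by (metis cinner_commute cinner_scaleC_left complex_cnj_mult)

lemma cinner_add_right: "cinner (x::'h::fd_chilbert) (y + z) = cinner x y + cinner x z"
  by (metis cinner_commute cinner_add_left complex_cnj_add)

lemma cinner_conv_inner:
  "cinner (x::'h::fd_chilbert) y = Complex (inner x y) (- inner (\<i> *\<^sub>C x) y)"
  by (simp add: complex_eq_iff inner_Re_cinner cinner_scaleC_left)

lemma cinner_self: "cinner (x::'h::fd_chilbert) x = complex_of_real ((norm x)\<^sup>2)"
proof -
  have "Im (cinner x x) = 0"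
    using cinner_commute[of x x] by (simp add: complex_eq_iff)
  then show ?thesis
    by (simp add: complex_eq_iff power2_norm_eq_inner inner_Re_cinner)
qed

lemma norm_scaleC [simp]: "norm (c *\<^sub>C (x::'h::fd_chilbert)) = cmod c * norm x"
proof -
  have "complex_of_real ((norm (c *\<^sub>C x))\<^sup>2) = complex_of_real ((cmod c * norm x)\<^sup>2)"
    unfolding cinner_self[symmetric] cinner_scaleC_left cinner_scaleC_right
    by (simp add: cinner_self power_mult_distrib complex_norm_square mult.commute del: of_real_power)
  then have "(norm (c *\<^sub>C x))\<^sup>2 = (cmod c * norm x)\<^sup>2"
    by (simp only: of_real_eq_iff)
  then show ?thesis by (simp add: power2_eq_iff_nonneg)
qed

lemma scaleC_zero_right [simp]: "c *\<^sub>C (0::'h::fd_chilbert) = 0"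
  using norm_scaleC[of c "0::'h"] by (simp del: norm_scaleC)

lemma bounded_linear_scaleC: "bounded_linear (\<lambda>x::'h::fd_chilbert. c *\<^sub>C x)"
  by (rule bounded_linear_intro[where K="cmod c"])
     (simp_all add: scaleC_add_right scaleR_scaleC scaleC_scaleC mult.commute)

lemma bounded_linear_scaleC_left: "bounded_linear (\<lambda>c. c *\<^sub>C (x::'h::fd_chilbert))"
  by (rule bounded_linear_intro[where K="norm x"])
     (simp_all add: scaleC_add_left scaleR_scaleC[where 'a='h] scaleC_scaleC scaleR_conv_of_real scaleR_scaleC)

lemma scaleC_diff_right: "c *\<^sub>C (x - y) = c *\<^sub>C x - c *\<^sub>C (y::'h::fd_chilbert)"
  using linear_diff[OF bounded_linear.linear[OF bounded_linear_scaleC]] by blast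

lemma cmod_cinner_le: "cmod (cinner x y) \<le> norm x * norm (y::'h::fd_chilbert)"
proof (cases "cinner x y = 0")
  case False
  \<comment> \<open>Rotate \<open>x\<close> by a phase that makes the inner product real.\<close>
  define u where "u = cnj (sgn (cinner x y))"
  have "cmod u = 1" using False by (simp add: u_def norm_sgn)
  have "cinner (u *\<^sub>C x) y = complex_of_real (cmod (cinner x y))"
    using False
    by (simp add: cinner_scaleC_left u_def sgn_div_norm scaleR_conv_of_real field_simps
        flip: complex_norm_square power2_eq_square)
  then have "inner (u *\<^sub>C x) y = cmod (cinner x y)"
    by (simp add: inner_Re_cinner)
  moreover have "inner (u *\<^sub>C x) y \<le> norm (u *\<^sub>C x) * norm y"
    by (rule norm_cauchy_schwarz)
  ultimately show ?thesis using \<open>cmod u = 1\<close> by simp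
qed simp

lemma bounded_linear_cinner_left: "bounded_linear (\<lambda>x. cinner x (y::'h::fd_chilbert))"
  by (rule bounded_linear_intro[where K="norm y"])
     (simp_all add: cinner_add_left scaleR_scaleC[where 'a='h] cinner_scaleC_left
        scaleR_conv_of_real cmod_cinner_le)

lemma cinner_diff_left: "cinner (x - y) z = cinner x z - cinner y (z::'h::fd_chilbert)"
  using linear_diff[OF bounded_linear.linear[OF bounded_linear_cinner_left]] by blast

lemma cinner_zero_left [simp]: "cinner 0 (y::'h::fd_chilbert) = 0"
  using linear_0[OF bounded_linear.linear[OF bounded_linear_cinner_left]] by blast

lemma measurable_scaleC [measurable (raw)]:
  fixes f :: "'a \<Rightarrow> 'h::fd_chilbert"
  assumes [measurable]: "c \<in> borel_measurable M" "f \<in> borel_measurable M"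
  shows "(\<lambda>x. c x *\<^sub>C f x) \<in> borel_measurable M"
proof -
  have [measurable]: "(\<lambda>x::'h. \<i> *\<^sub>C x) \<in> borel_measurable borel"
    by (intro borel_measurable_continuous_onI linear_continuous_on bounded_linear_scaleC)
  show ?thesis by (subst scaleC_conv_scaleR) measurable
qed

lemma measurable_cinner [measurable (raw)]:
  fixes f :: "'a \<Rightarrow> 'h::fd_chilbert"
  assumes [measurable]: "g \<in> borel_measurable M" "f \<in> borel_measurable M"
  shows "(\<lambda>x. cinner (f x) (g x)) \<in> borel_measurable M"
  unfolding borel_measurable_complex_iff by (simp add: cinner_conv_inner)

lemma clinear_linear: "clinear A \<Longrightarrow> linear A"
  by (rule linearI) (auto simp: clinear_def scaleR_scaleC)

lemma clinear_scaleC: "clinear A \<Longrightarrow> A (c *\<^sub>C x) = c *\<^sub>C A x"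
  by (auto simp: clinear_def)

text \<open>The complex adjoint is also the adjoint for the real inner product, because \<open>A\<close> commutes with
  multiplication by the imaginary unit. So the real theory supplies its existence.\<close>

lemma cadjoint_eq_adjoint:
  fixes A :: "'h::fd_chilbert \<Rightarrow> 'h"
  assumes A: "clinear A"
  shows "cadjoint A = adjoint A"
  unfolding cadjoint_def
proof (rule the_equality)
  have eq: "inner (A x) y = inner x (adjoint A y)" for x y
    using adjoint_works[OF clinear_linear[OF A], of x y] by simp
  show "\<forall>x y. cinner (A x) y = cinner x (adjoint A y)"
    using eq by (simp add: cinner_conv_inner clinear_scaleC[OF A, symmetric])
next
  fix B assume "\<forall>x y. cinner (A x) y = cinner x (B y)"
  then have "\<forall>x y. inner (A x) y = inner x (B y)"
    by (simp add: inner_Re_cinner)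
  then show "B = adjoint A" by (metis adjoint_unique)
qed

lemma cinner_cadjoint:
  fixes A :: "'h::fd_chilbert \<Rightarrow> 'h"
  assumes A: "clinear A"
  shows "cinner (A x) y = cinner x (cadjoint A y)"
proof -
  have eq: "inner (A x) y = inner x (adjoint A y)" for x y
    using adjoint_works[OF clinear_linear[OF A], of x y] by simp
  show ?thesis
    using eq by (simp add: cinner_conv_inner clinear_scaleC[OF A, symmetric] cadjoint_eq_adjoint[OF A])
qed

lemma cinner_eqI:
  assumes "\<And>z. cinner z x = cinner z (y::'h::fd_chilbert)"
  shows "x = y"
proof -
  have "inner z x = inner z y" for z using assms[of z] by (simp add: inner_Re_cinner)
  then show ?thesis by (metis inner_commute vector_eq_rdot)
qed

lemma clinear_cadjoint:
  fixes A :: "'h::fd_chilbert \<Rightarrow> 'h"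
  assumes A: "clinear A"
  shows "clinear (cadjoint A)"
  unfolding clinear_def
proof (intro conjI allI)
  fix x y and c
  show "cadjoint A (x + y) = cadjoint A x + cadjoint A y"
    by (rule cinner_eqI) (simp only: cinner_cadjoint[OF A, symmetric] cinner_add_right)
  show "cadjoint A (c *\<^sub>C x) = c *\<^sub>C cadjoint A x"
    by (rule cinner_eqI) (simp only: cinner_cadjoint[OF A, symmetric] cinner_scaleC_right)
qed

lemma unitary_op_clinear: "unitary_op A \<Longrightarrow> clinear A"
  by (simp add: unitary_op_def)

lemma unitary_op_cinner:
  assumes "unitary_op A"
  shows "cinner (A x) (A y) = cinner x y"
  using assms by (simp add: cinner_cadjoint unitary_op_def fun_eq_iff)

lemma unitary_op_norm: "unitary_op A \<Longrightarrow> norm (A x) = norm x"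
  using unitary_op_cinner[of A x x]
  by (simp add: cinner_self) (metis norm_ge_zero power2_eq_iff_nonneg of_real_eq_iff of_real_power)

lemma unitary_op_cadjoint:
  assumes A: "unitary_op A"
  shows "unitary_op (cadjoint A)"
proof -
  have lin: "clinear A" "clinear (cadjoint A)"
    using A by (auto simp: unitary_op_def clinear_cadjoint)
  have "cadjoint (cadjoint A) = A"
    by (rule ext, rule cinner_eqI)
       (metis cinner_cadjoint[OF lin(1)] cinner_cadjoint[OF lin(2)] cinner_commute)
  then show ?thesis using A lin by (auto simp: unitary_op_def)
qed

lemma conjugation_add: "conjugation J \<Longrightarrow> J (x + y) = J x + J y"
  and conjugation_scaleC: "conjugation J \<Longrightarrow> J (c *\<^sub>C x) = cnj c *\<^sub>C J x"
  and conjugation_invol: "conjugation J \<Longrightarrow> J (J x) = x"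
  and conjugation_cinner_both: "conjugation J \<Longrightarrow> cinner (J x) (J y) = cinner y x"
  by (auto simp: conjugation_def fun_eq_iff)

lemma conjugation_norm: "conjugation J \<Longrightarrow> norm (J x) = norm x"
  using conjugation_cinner_both[of J x x]
  by (simp add: cinner_self) (metis norm_ge_zero power2_eq_iff_nonneg of_real_eq_iff of_real_power)

lemma conjugation_bounded_linear: "conjugation J \<Longrightarrow> bounded_linear J"
  by (rule bounded_linear_intro[where K=1])
     (simp_all add: conjugation_add scaleR_scaleC conjugation_scaleC conjugation_norm)

lemma conjugation_measurable:
  "conjugation J \<Longrightarrow> f \<in> borel_measurable M \<Longrightarrow> (\<lambda>z. J (f z)) \<in> borel_measurable M"
  by (rule borel_measurable_continuous_on[OF linear_continuous_on[OF conjugation_bounded_linear]])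

section \<open>Arc length on the unit circle\<close>

lemma space_circle [simp]: "space circle_measure = sphere 0 1"
  by (simp add: circle_measure_def space_restrict_space)

lemma sets_circle: "sets circle_measure = sets (restrict_space borel (sphere 0 1))"
  by (simp add: circle_measure_def)

lemma measurable_circle_continuous:
  assumes "continuous_on (sphere 0 1) f"
  shows "f \<in> borel_measurable circle_measure"
  unfolding measurable_cong_sets[OF sets_circle refl]
  using assms by (rule borel_measurable_continuous_on_restrict)

lemma measurable_circle_id [measurable]: "(\<lambda>z. z) \<in> borel_measurable circle_measure"
  by (rule measurable_circle_continuous) (intro continuous_intros)

lemma measurable_cis_circle:
  "cis \<in> measurable lborel (restrict_space borel (sphere 0 1))"
  by (rule measurable_restrict_space2)
     (auto intro!: borel_measurable_continuous_onI continuous_intros)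

lemma measurable_cis_uniform:
  "cis \<in> measurable (uniform_measure lborel {0..<2 * pi}) (restrict_space borel (sphere 0 1))"
  using measurable_cis_circle by (simp add: measurable_def)

lemma emeasure_circle_space [simp]: "emeasure circle_measure (sphere 0 1) = 1"
proof -
  have "emeasure (uniform_measure lborel {0..<2 * pi}) (space lborel) = 1"
    using emeasure_uniform_measure_1[of lborel "{0..<2 * pi}"] by (simp add: ennreal_eq_0_iff divide_ennreal)
  moreover have "cis -` sphere 0 1 = UNIV" by auto
  ultimately show ?thesis
    unfolding circle_measure_def
    by (subst emeasure_distr[OF measurable_cis_uniform])
       (auto simp: sets_restrict_space)
qed

interpretation circle: finite_measure circle_measure
  by standard simp

lemma measure_circle_space [simp]: "measure circle_measure (sphere 0 1) = 1"
  by (simp add: measure_def)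

lemma integrable_circle_bounded:
  fixes f :: "complex \<Rightarrow> 'b::{banach, second_countable_topology}"
  assumes "f \<in> borel_measurable circle_measure" "AE z in circle_measure. norm (f z) \<le> B"
  shows "integrable circle_measure f"
  using assms by (intro circle.integrable_const_bound)

lemma integrable_circle_continuous:
  fixes f :: "complex \<Rightarrow> 'b::{banach, second_countable_topology}"
  assumes "continuous_on (sphere 0 1) f"
  shows "integrable circle_measure f"
proof -
  have "bounded (f ` sphere 0 1)"
    using assms by (intro compact_imp_bounded compact_continuous_image) auto
  then obtain B where "\<forall>z\<in>sphere 0 1. norm (f z) \<le> B" by (auto simp: bounded_iff)
  then show ?thesis
    by (intro integrable_circle_bounded[where B=B] measurable_circle_continuous assms) auto
qed

lemma AE_circle_sphere: "AE z in circle_measure. z \<in> sphere 0 1"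
  using AE_space[of circle_measure] by simp

lemma measurable_cnj_circle: "cnj \<in> measurable circle_measure circle_measure"
proof -
  have "cnj \<in> measurable (restrict_space borel (sphere 0 1)) (restrict_space borel (sphere 0 1))"
    by (intro measurable_restrict_space3 borel_measurable_continuous_onI continuous_intros) auto
  then show ?thesis
    using measurable_cong_sets[OF sets_circle sets_circle] by blast
qed

text \<open>In the angle, conjugation is \<open>\<theta> \<mapsto> 2\<pi> - \<theta>\<close>, an isometry of the line that maps \<open>[0, 2\<pi>)\<close> to
  itself up to one point.\<close>

lemma distr_cnj_circle: "distr circle_measure circle_measure cnj = circle_measure"
proof (rule measure_eqI)
  fix A assume "A \<in> sets (distr circle_measure circle_measure cnj)"
  then have A: "A \<in> sets circle_measure" by simp
  have em: "emeasure circle_measure B =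
      emeasure lborel ({0..<2 * pi} \<inter> cis -` B) / ennreal (2 * pi)"
    if B: "B \<in> sets circle_measure" for B
  proof -
    have "cis -` B \<in> sets lborel"
      using measurable_sets[OF measurable_cis_circle, of B] B by (simp add: sets_circle)
    then show ?thesis
      unfolding circle_measure_def
      using B by (subst emeasure_distr[OF measurable_cis_uniform])
         (auto simp: sets_circle emeasure_uniform_measure)
  qed
  have cA: "cnj -` A \<inter> space circle_measure \<in> sets circle_measure"
    using measurable_sets[OF measurable_cnj_circle A] .
  have mA: "cis -` A \<in> sets borel"
    using measurable_sets[OF measurable_cis_circle, of A] A by (simp add: sets_circle)
  define E where "E = {0..<2 * pi} \<inter> cis -` A"
  define F where "F = {0..<2 * pi} \<inter> cis -` (cnj -` A \<inter> space circle_measure)"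
  have E: "E \<in> sets borel" using mA by (simp add: E_def)
  have F: "F \<in> sets borel"
    using measurable_sets[OF measurable_cis_circle, of "cnj -` A \<inter> space circle_measure"] cA
    by (auto simp: sets_circle F_def)
  define g where "g = (\<lambda>x::real. 2 * pi + - x)"
  have "distr lborel borel g = distr (distr lborel borel uminus) borel ((+) (2 * pi))"
    by (subst distr_distr) (auto simp: g_def comp_def)
  then have g: "distr lborel borel g = lborel"
    by (simp only: lborel_distr_uminus lborel_distr_plus)
  have "emeasure lborel E = emeasure (distr lborel borel g) E" by (simp only: g)
  also have "\<dots> = emeasure lborel (g -` E)"
    using E by (subst emeasure_distr) (auto simp: g_def)
  also have "\<dots> = emeasure lborel F"
  proof (rule emeasure_eq_AE)
    have cg: "cis (g x) = cnj (cis x)" for x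
      by (simp add: g_def cis_cnj complex_eq_iff)
    have "AE x in lborel. x \<noteq> (0::real)" "AE x in lborel. x \<noteq> 2 * pi"
      by (auto intro: AE_lborel_singleton)
    then show "AE x in lborel. x \<in> g -` E \<longleftrightarrow> x \<in> F"
    proof eventually_elim
      case (elim x)
      then show ?case
        by (simp add: E_def F_def cg) (auto simp: g_def)
    qed
    show "g -` E \<in> sets lborel"
      using E measurable_sets[of g borel borel E] by (auto simp: g_def)
  qed (use F in simp)
  finally show "emeasure (distr circle_measure circle_measure cnj) A = emeasure circle_measure A"
    unfolding em[OF A] E_def[symmetric] using em[OF cA] A
    by (subst emeasure_distr[OF measurable_cnj_circle]) (auto simp: F_def)
qed simp

lemma integral_circle_cnj:
  fixes f :: "complex \<Rightarrow> 'b::{banach, second_countable_topology}"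
  assumes "f \<in> borel_measurable circle_measure"
  shows "(LINT z|circle_measure. f (cnj z)) = (LINT z|circle_measure. f z)"
  using integral_distr[OF measurable_cnj_circle assms] by (simp add: distr_cnj_circle)

lemma measurable_circle_cnj:
  assumes "f \<in> borel_measurable circle_measure"
  shows "(\<lambda>z. f (cnj z)) \<in> borel_measurable circle_measure"
  using measurable_compose[OF measurable_cnj_circle assms] .

lemma integrable_circle_cnj:
  fixes f :: "complex \<Rightarrow> 'b::{banach, second_countable_topology}"
  assumes "integrable circle_measure f"
  shows "integrable circle_measure (\<lambda>z. f (cnj z))"
  using integrable_distr[OF measurable_cnj_circle, of f] assms by (simp add: distr_cnj_circle)

lemma AE_circle_cnj:
  assumes "AE z in circle_measure. P z"
  shows "AE z in circle_measure. P (cnj z)"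
  by (rule AE_distrD[OF measurable_cnj_circle]) (subst distr_cnj_circle, rule assms)

lemma continuous_on_circle_powi: "continuous_on (sphere 0 1) (\<lambda>z::complex. z powi n)"
  by (intro continuous_intros) auto

lemma cnj_circle_powi: "z \<in> sphere 0 1 \<Longrightarrow> cnj (z powi n) = z powi (- n)"
proof -
  assume "z \<in> sphere 0 1"
  then have "z * cnj z = 1"
    using complex_norm_square[of z] by simp
  then have "cnj z = inverse z"
    by (metis inverse_unique)
  then show ?thesis by (simp add: complex_cnj_power_int power_int_minus power_int_inverse)
qed

lemma norm_circle_powi [simp]: "cmod z = 1 \<Longrightarrow> cmod (z powi n) = 1"
  by (simp add: norm_power_int)

lemma circle_powi_add: "z \<in> sphere 0 1 \<Longrightarrow> z powi (m + n) = z powi m * z powi (n::int)" for z :: complex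
  by (rule power_int_add) auto

lemma integral_circle_powi:
  "(LINT z|circle_measure. z powi n) = (if n = 0 then 1 else 0)"
proof (cases "n = 0")
  case False
  have meas: "(\<lambda>z::complex. z powi n) \<in> borel_measurable (restrict_space borel (sphere 0 1))"
    using measurable_circle_continuous[OF continuous_on_circle_powi]
    by (simp add: measurable_cong_sets[OF sets_circle refl])
  have cont: "continuous_on {0..2*pi} (\<lambda>t. cis t powi n)"
    by (intro continuous_intros) auto
  let ?F = "\<lambda>t. cis (real_of_int n * t) / (\<i> * of_int n)"
  have cis_powi: "cis t powi n = cis (real_of_int n * t)" for t
    by (simp add: cis_power_int)
  have "(LINT z|circle_measure. z powi n)
      = (LINT t|uniform_measure lborel {0..<2 * pi}. cis t powi n)"
    unfolding circle_measure_def by (rule integral_distr[OF measurable_cis_uniform meas])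
  also have "\<dots> = (LINT t|lborel. (indicator {0..<2 * pi} t / (2 * pi)) *\<^sub>R (cis t powi n))"
  proof -
    have "uniform_measure lborel {0..<2 * pi}
        = density lborel (\<lambda>t. ennreal (indicator {0..<2 * pi} t / (2 * pi)))"
      unfolding uniform_measure_def
      using divide_ennreal[of 1 "2 * pi"]
      by (intro density_cong) (auto split: split_indicator)
    then show ?thesis
      by (simp, subst integral_density)
         (auto simp: cis_powi intro!: borel_measurable_continuous_onI continuous_intros)
  qed
  also have "\<dots> = (LINT t|lborel. (1 / (2 * pi)) *\<^sub>R (indicator {0..2 * pi} t *\<^sub>R (cis t powi n)))"
  proof (rule integral_cong_AE)
    have "AE t in lborel. t \<noteq> 2 * pi" by (rule AE_lborel_singleton)
    then show "AE t in lborel. (indicator {0..<2 * pi} t / (2 * pi)) *\<^sub>R (cis t powi n)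
        = (1 / (2 * pi)) *\<^sub>R (indicator {0..2 * pi} t *\<^sub>R (cis t powi n))"
      by eventually_elim (auto split: split_indicator)
    have [measurable]: "(\<lambda>t. cis t powi n) \<in> borel_measurable borel"
      by (auto simp: cis_powi intro!: borel_measurable_continuous_onI continuous_intros)
    show "(\<lambda>t. (indicator {0..<2 * pi} t / (2 * pi)) *\<^sub>R (cis t powi n)) \<in> borel_measurable lborel"
      "(\<lambda>t. (1 / (2 * pi)) *\<^sub>R (indicator {0..2 * pi} t *\<^sub>R (cis t powi n))) \<in> borel_measurable lborel"
      by measurable
  qed
  also have "\<dots> = (1 / (2 * pi)) *\<^sub>R (?F (2 * pi) - ?F 0)"
    unfolding integral_scaleR_right
  proof (subst integral_FTC_atLeastAtMost[where F = ?F, OF _ _ cont])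
    fix x
    show "(?F has_vector_derivative cis x powi n) (at x within {0..2*pi})"
      unfolding cis_powi using False
      by (auto intro!: derivative_eq_intros simp: has_vector_derivative_def scaleR_conv_of_real field_simps)
  qed auto
  also have "cis (real_of_int n * (2 * pi)) = 1"
    using cis_multiple_2pi[of "real_of_int n"] by (simp add: mult.commute)
  finally show ?thesis using False by simp
qed simp

section \<open>The Hilbert space of square integrable functions\<close>

lemma L2_measurable: "f \<in> L2 \<Longrightarrow> f \<in> borel_measurable circle_measure"
  by (simp add: L2_def)

lemma L2_integrable_sq: "f \<in> L2 \<Longrightarrow> integrable circle_measure (\<lambda>z. (norm (f z))\<^sup>2)"
  by (simp add: L2_def)

lemma L2_dominated:
  assumes "f \<in> borel_measurable circle_measure" "integrable circle_measure B"
    and "AE z in circle_measure. (norm (f z))\<^sup>2 \<le> B z"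
  shows "f \<in> L2"
proof -
  have [measurable]: "f \<in> borel_measurable circle_measure" by fact
  have "integrable circle_measure (\<lambda>z. (norm (f z))\<^sup>2)"
    using assms(3) by (intro Bochner_Integration.integrable_bound[OF assms(2)]) auto
  then show ?thesis by (simp add: L2_def)
qed

lemma L2_bounded:
  assumes "f \<in> borel_measurable circle_measure" "AE z in circle_measure. norm (f z) \<le> B"
  shows "f \<in> L2"
proof (rule L2_dominated)
  show "AE z in circle_measure. (norm (f z))\<^sup>2 \<le> B\<^sup>2"
    using assms(2) by eventually_elim (simp add: power_mono)
qed (use assms in auto)

lemma norm_add_sq_plus_norm_diff_sq:
  "(norm (x + y))\<^sup>2 + (norm (x - y))\<^sup>2 = 2 * (norm x)\<^sup>2 + 2 * (norm (y::'a::real_inner))\<^sup>2"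
  unfolding power2_norm_eq_inner
  by (simp add: inner_add_left inner_add_right inner_diff_left inner_diff_right inner_commute)

lemma L2_add:
  assumes "f \<in> L2" "g \<in> L2"
  shows "(\<lambda>z. f z + g z) \<in> L2"
proof (rule L2_dominated)
  have [measurable]: "f \<in> borel_measurable circle_measure" "g \<in> borel_measurable circle_measure"
    using assms by (auto intro: L2_measurable)
  show "(\<lambda>z. f z + g z) \<in> borel_measurable circle_measure" by measurable
  show "integrable circle_measure (\<lambda>z. 2 * (norm (f z))\<^sup>2 + 2 * (norm (g z))\<^sup>2)"
    using assms by (intro Bochner_Integration.integrable_add integrable_mult_right L2_integrable_sq)
  have "(norm (x + y))\<^sup>2 \<le> 2 * (norm x)\<^sup>2 + 2 * (norm y)\<^sup>2" for x y :: 'a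
    using norm_add_sq_plus_norm_diff_sq[of x y] zero_le_power2[of "norm (x - y)"] by linarith
  then show "AE z in circle_measure. (norm (f z + g z))\<^sup>2 \<le> 2 * (norm (f z))\<^sup>2 + 2 * (norm (g z))\<^sup>2"
    by simp
qed

lemma L2_scaleC:
  assumes "f \<in> L2"
  shows "(\<lambda>z. c *\<^sub>C f z) \<in> L2"
proof (rule L2_dominated)
  have [measurable]: "f \<in> borel_measurable circle_measure"
    using assms by (auto intro: L2_measurable)
  show "(\<lambda>z. c *\<^sub>C f z) \<in> borel_measurable circle_measure" by measurable
  show "integrable circle_measure (\<lambda>z. (cmod c)\<^sup>2 * (norm (f z))\<^sup>2)"
    using assms by (intro integrable_mult_right L2_integrable_sq)
qed (simp add: power_mult_distrib)

lemma minus_conv_scaleC: "- x = (-1) *\<^sub>C (x::'h::fd_chilbert)"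
  using scaleR_scaleC[of "-1" x] by simp

lemma L2_diff:
  assumes "f \<in> L2" "g \<in> L2"
  shows "(\<lambda>z. f z - g z) \<in> L2"
  using L2_add[OF assms(1) L2_scaleC[OF assms(2), of "-1"]] by (simp flip: minus_conv_scaleC)

lemma L2_zero [simp]: "(\<lambda>z. 0) \<in> L2"
  by (simp add: L2_def)

lemma integrable_norm_mult:
  assumes "f \<in> L2" "g \<in> L2"
  shows "integrable circle_measure (\<lambda>z. norm (f z) * norm (g z))"
proof (rule Bochner_Integration.integrable_bound)
  have [measurable]: "f \<in> borel_measurable circle_measure" "g \<in> borel_measurable circle_measure"
    using assms by (auto intro: L2_measurable)
  show "(\<lambda>z. norm (f z) * norm (g z)) \<in> borel_measurable circle_measure" by measurable
  show "integrable circle_measure (\<lambda>z. (norm (f z))\<^sup>2 + (norm (g z))\<^sup>2)"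
    using assms by (intro Bochner_Integration.integrable_add L2_integrable_sq)
  have "x * y \<le> x\<^sup>2 + y\<^sup>2" if "x \<ge> 0" "y \<ge> 0" for x y :: real
    using sum_squares_bound[of x y] that mult_nonneg_nonneg[OF that] by linarith
  then show "AE z in circle_measure. norm (norm (f z) * norm (g z)) \<le> norm ((norm (f z))\<^sup>2 + (norm (g z))\<^sup>2)"
    by simp
qed

lemma integrable_cinner:
  assumes "f \<in> L2" "g \<in> L2"
  shows "integrable circle_measure (\<lambda>z. cinner (f z) (g z))"
proof (rule Bochner_Integration.integrable_bound[OF integrable_norm_mult[OF assms]])
  have [measurable]: "f \<in> borel_measurable circle_measure" "g \<in> borel_measurable circle_measure"
    using assms by (auto intro: L2_measurable)
  show "(\<lambda>z. cinner (f z) (g z)) \<in> borel_measurable circle_measure" by measurable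
qed (simp add: cmod_cinner_le)

lemma L2_inner_commute: "L2_inner f g = cnj (L2_inner g f)"
  unfolding L2_inner_def integral_cnj[symmetric] by (subst cinner_commute) simp

lemma L2_inner_add_left:
  "f \<in> L2 \<Longrightarrow> g \<in> L2 \<Longrightarrow> h \<in> L2 \<Longrightarrow> L2_inner (\<lambda>z. f z + g z) h = L2_inner f h + L2_inner g h"
  unfolding L2_inner_def by (simp add: cinner_add_left integrable_cinner)

lemma L2_inner_diff_left:
  "f \<in> L2 \<Longrightarrow> g \<in> L2 \<Longrightarrow> h \<in> L2 \<Longrightarrow> L2_inner (\<lambda>z. f z - g z) h = L2_inner f h - L2_inner g h"
  unfolding L2_inner_def by (simp add: cinner_diff_left integrable_cinner)

lemma L2_inner_scaleC_left: "L2_inner (\<lambda>z. c *\<^sub>C f z) h = c * L2_inner f h"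
  unfolding L2_inner_def by (simp add: cinner_scaleC_left)

lemma L2_inner_scaleC_right: "L2_inner f (\<lambda>z. c *\<^sub>C h z) = cnj c * L2_inner f h"
  unfolding L2_inner_def by (simp add: cinner_scaleC_right)

lemma L2_inner_cong_AE:
  assumes "f \<in> borel_measurable circle_measure" "f' \<in> borel_measurable circle_measure"
    "h \<in> borel_measurable circle_measure" "h' \<in> borel_measurable circle_measure"
    "AE z in circle_measure. f z = f' z" "AE z in circle_measure. h z = h' z"
  shows "L2_inner f h = L2_inner f' h'"
  unfolding L2_inner_def
proof (rule integral_cong_AE)
  note [measurable] = assms(1-4)
  show "(\<lambda>z. cinner (f z) (h z)) \<in> borel_measurable circle_measure"
    "(\<lambda>z. cinner (f' z) (h' z)) \<in> borel_measurable circle_measure" by measurable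
  show "AE z in circle_measure. cinner (f z) (h z) = cinner (f' z) (h' z)"
    using assms(5,6) by eventually_elim simp
qed

definition L2_sqnorm :: "(complex \<Rightarrow> 'h::fd_chilbert) \<Rightarrow> real" where
  "L2_sqnorm f = (LINT z|circle_measure. (norm (f z))\<^sup>2)"

lemma L2_sqnorm_nonneg [simp]: "0 \<le> L2_sqnorm f"
  by (simp add: L2_sqnorm_def)

lemma L2_inner_self: "L2_inner f f = complex_of_real (L2_sqnorm f)"
  unfolding L2_inner_def L2_sqnorm_def cinner_self by (rule integral_complex_of_real)

lemma L2_sqnorm_eq_0:
  assumes "f \<in> L2" "L2_sqnorm f = 0"
  shows "AE z in circle_measure. f z = 0"
  using integral_nonneg_eq_0_iff_AE[OF L2_integrable_sq[OF assms(1)]] assms(2)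
  by (simp add: L2_sqnorm_def)

lemma L2_sqnorm_diff_scaleR:
  assumes "f \<in> L2" "h \<in> L2"
  shows "L2_sqnorm (\<lambda>z. f z - complex_of_real t *\<^sub>C h z)
    = L2_sqnorm f - 2 * t * Re (L2_inner f h) + t\<^sup>2 * L2_sqnorm h"
proof -
  have "Re (L2_inner f h) = (LINT z|circle_measure. Re (cinner (f z) (h z)))"
    unfolding L2_inner_def by (rule integral_Re[symmetric, OF integrable_cinner[OF assms]])
  moreover have "(norm (x - complex_of_real t *\<^sub>C y))\<^sup>2
      = (norm x)\<^sup>2 - 2 * t * Re (cinner x y) + t\<^sup>2 * (norm y)\<^sup>2" for x y :: 'a
    unfolding power2_norm_eq_inner scaleR_scaleC[symmetric] inner_Re_cinner[symmetric]
    by (simp add: inner_diff_left inner_diff_right inner_commute[of y x] power2_eq_square)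
       (simp add: algebra_simps)
  ultimately show ?thesis
    unfolding L2_sqnorm_def
    using assms by (simp add: L2_integrable_sq integrable_cinner)
qed

lemma nonneg_quadratic_discriminant:
  fixes a b c :: real
  assumes "\<And>t. 0 \<le> a - 2 * t * b + t\<^sup>2 * c"
  shows "b\<^sup>2 \<le> a * c"
proof (cases "c = 0")
  case True
  have "b = 0"
  proof (rule ccontr)
    assume "b \<noteq> 0"
    then show False using assms[of "(a + 1) / (2 * b)"] True by simp
  qed
  then show ?thesis using True by simp
next
  case False
  have "c > 0"
  proof (rule ccontr)
    assume "\<not> c > 0"
    with False have "c < 0" by simp
    define s where "s = (\<bar>a\<bar> + 1) / (- c) + 1"
    have "s \<ge> 1" using \<open>c < 0\<close> by (simp add: s_def divide_nonneg_neg)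
    have s: "- c * s > \<bar>a\<bar>" using \<open>c < 0\<close> by (simp add: s_def field_simps)
    have "0 \<le> 2 * a + 2 * s\<^sup>2 * c" using assms[of s] assms[of "-s"] by simp
    moreover have "s\<^sup>2 * c \<le> s * c"
      using \<open>c < 0\<close> \<open>s \<ge> 1\<close> by (simp add: power2_eq_square)
    ultimately show False using s by (auto simp: mult.commute)
  qed
  then show ?thesis
    using assms[of "b / c"] by (simp add: field_simps power2_eq_square)
qed

lemma L2_Cauchy_Schwarz_Re:
  assumes "f \<in> L2" "h \<in> L2"
  shows "(Re (L2_inner f h))\<^sup>2 \<le> L2_sqnorm f * L2_sqnorm h"
proof (rule nonneg_quadratic_discriminant)
  fix t show "0 \<le> L2_sqnorm f - 2 * t * Re (L2_inner f h) + t\<^sup>2 * L2_sqnorm h"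
    unfolding L2_sqnorm_diff_scaleR[OF assms, symmetric] by simp
qed

lemma L2_integrable_norm:
  assumes "f \<in> L2"
  shows "integrable circle_measure (\<lambda>z. norm (f z))"
proof (rule Bochner_Integration.integrable_bound)
  have [measurable]: "f \<in> borel_measurable circle_measure"
    using assms by (auto intro: L2_measurable)
  show "(\<lambda>z. norm (f z)) \<in> borel_measurable circle_measure" by measurable
  show "integrable circle_measure (\<lambda>z. 1 + (norm (f z))\<^sup>2)"
    using assms by (intro Bochner_Integration.integrable_add L2_integrable_sq) auto
  have "x \<le> 1 + x\<^sup>2" for x :: real
  proof (cases "x \<le> 0")
    case False
    then show ?thesis using sum_squares_bound[of x 1] by simp
  qed (simp add: add_increasing2)
  then show "AE z in circle_measure. norm (norm (f z)) \<le> norm (1 + (norm (f z))\<^sup>2)"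
    by simp
qed

lemma L2_integrable: "f \<in> L2 \<Longrightarrow> integrable circle_measure f"
  using L2_integrable_norm L2_measurable integrable_norm_iff by blast

lemma integral_norm_le_L2:
  assumes "f \<in> L2"
  shows "(LINT z|circle_measure. norm (f z))\<^sup>2 \<le> L2_sqnorm f"
proof -
  have "(LINT z|circle_measure. norm (f z))\<^sup>2 \<le> L2_sqnorm f * 1"
  proof (rule nonneg_quadratic_discriminant)
    fix t
    have "0 \<le> (LINT z|circle_measure. (norm (f z) - t)\<^sup>2)" by simp
    also have "\<dots> = (LINT z|circle_measure. (norm (f z))\<^sup>2 - 2 * t * norm (f z) + t\<^sup>2)"
      by (simp add: power2_eq_square algebra_simps)
    also have "\<dots> = L2_sqnorm f - 2 * t * (LINT z|circle_measure. norm (f z)) + t\<^sup>2 * 1"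
      unfolding L2_sqnorm_def
      using assms by (simp add: L2_integrable_sq L2_integrable_norm)
    finally show "0 \<le> L2_sqnorm f - 2 * t * (LINT z|circle_measure. norm (f z)) + t\<^sup>2 * 1" .
  qed
  then show ?thesis by simp
qed

text \<open>This is the Riesz--Fischer theorem for sequences with a geometric Cauchy condition. The
  increments are then summable in mean, so the sequence converges almost everywhere, and Fatou's
  lemma carries the Cauchy estimate to the limit.\<close>

lemma L2_complete:
  fixes g :: "nat \<Rightarrow> complex \<Rightarrow> 'h::fd_chilbert"
  assumes g: "\<And>n. g n \<in> L2"
    and cauchy: "\<And>m n. m \<le> n \<Longrightarrow> L2_sqnorm (\<lambda>z. g m z - g n z) \<le> 4 * (1/4) ^ m"
  obtains G where "G \<in> L2" "\<And>m. L2_sqnorm (\<lambda>z. g m z - G z) \<le> 4 * (1/4) ^ m"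
proof -
  have [measurable]: "g n \<in> borel_measurable circle_measure" for n
    using g by (rule L2_measurable)
  define d where "d n z = g (Suc n) z - g n z" for n z
  have [measurable]: "d n \<in> borel_measurable circle_measure" for n
    unfolding d_def by measurable
  have L2d: "d n \<in> L2" for n
    unfolding d_def by (intro L2_diff g)
  have d: "(LINT z|circle_measure. norm (d n z)) \<le> 2 * (1/2) ^ n" for n
  proof (rule power2_le_imp_le)
    have "(LINT z|circle_measure. norm (d n z))\<^sup>2 \<le> L2_sqnorm (d n)"
      by (rule integral_norm_le_L2[OF L2d])
    also have "\<dots> = L2_sqnorm (\<lambda>z. g n z - g (Suc n) z)"
      by (simp add: L2_sqnorm_def d_def norm_minus_commute)
    also have "\<dots> \<le> 4 * (1/4) ^ n" by (rule cauchy) simp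
    also have "\<dots> = (2 * (1/2) ^ n)\<^sup>2"
      by (simp add: power_mult_distrib power_mult[symmetric] mult.commute[of n]) (simp add: power_mult power2_eq_square)
    finally show "(LINT z|circle_measure. norm (d n z))\<^sup>2 \<le> (2 * (1/2) ^ n)\<^sup>2" .
  qed simp
  have "(\<integral>\<^sup>+z. (\<Sum>n. ennreal (norm (d n z))) \<partial>circle_measure)
      = (\<Sum>n. \<integral>\<^sup>+z. ennreal (norm (d n z)) \<partial>circle_measure)"
    by (rule nn_integral_suminf) measurable
  also have "\<dots> = (\<Sum>n. ennreal (LINT z|circle_measure. norm (d n z)))"
    by (intro suminf_cong nn_integral_eq_integral L2_integrable_norm L2d) simp
  also have "\<dots> \<le> (\<Sum>n. ennreal (2 * (1/2) ^ n))"
    by (intro suminf_le ennreal_leI d) auto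
  also have "\<dots> < \<infinity>"
    using summable_mult[OF summable_geometric[of "1/2::real"], of 2]
    by (simp add: suminf_ennreal2 less_top[symmetric])
  finally have "AE z in circle_measure. (\<Sum>n. ennreal (norm (d n z))) \<noteq> \<infinity>"
    by (intro nn_integral_PInf_AE) auto
  then have conv: "AE z in circle_measure. (\<lambda>n. g n z) \<longlonglongrightarrow> lim (\<lambda>n. g n z)"
  proof eventually_elim
    case (elim z)
    then have "summable (\<lambda>n. norm (d n z))"
      by (intro summable_suminf_not_top) auto
    then have "summable (\<lambda>n. d n z)" by (rule summable_norm_cancel)
    then have "convergent (\<lambda>n. \<Sum>i<n. d i z)" by (simp add: summable_iff_convergent)
    moreover have "(\<Sum>i<n. d i z) = g n z - g 0 z" for n
      unfolding d_def by (rule sum_lessThan_telescope)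
    ultimately have "convergent (\<lambda>n. g n z - g 0 z)" by simp
    then have "convergent (\<lambda>n. (g n z - g 0 z) + g 0 z)"
      by (intro convergent_add convergent_const)
    then show ?case by (simp add: convergent_LIMSEQ_iff)
  qed
  define G where "G z = lim (\<lambda>n. g n z)" for z
  have [measurable]: "G \<in> borel_measurable circle_measure"
    unfolding G_def by measurable
  have bound: "(\<integral>\<^sup>+z. ennreal ((norm (g m z - G z))\<^sup>2) \<partial>circle_measure) \<le> ennreal (4 * (1/4) ^ m)" for m
  proof -
    have "(\<integral>\<^sup>+z. ennreal ((norm (g m z - G z))\<^sup>2) \<partial>circle_measure)
        = (\<integral>\<^sup>+z. liminf (\<lambda>n. ennreal ((norm (g m z - g n z))\<^sup>2)) \<partial>circle_measure)"
    proof (rule nn_integral_cong_AE)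
      show "AE z in circle_measure. ennreal ((norm (g m z - G z))\<^sup>2)
          = liminf (\<lambda>n. ennreal ((norm (g m z - g n z))\<^sup>2))"
        using conv
      proof eventually_elim
        case (elim z)
        have "(\<lambda>n. ennreal ((norm (g m z - g n z))\<^sup>2)) \<longlonglongrightarrow> ennreal ((norm (g m z - G z))\<^sup>2)"
          unfolding G_def by (intro tendsto_intros elim)
        then show ?case by (rule lim_imp_Liminf[OF sequentially_bot, symmetric])
      qed
    qed
    also have "\<dots> \<le> liminf (\<lambda>n. \<integral>\<^sup>+z. ennreal ((norm (g m z - g n z))\<^sup>2) \<partial>circle_measure)"
      by (rule nn_integral_liminf) measurable
    also have "\<dots> \<le> ennreal (4 * (1/4) ^ m)"
    proof -
      have "(\<integral>\<^sup>+z. ennreal ((norm (g m z - g n z))\<^sup>2) \<partial>circle_measure) \<le> ennreal (4 * (1/4) ^ m)"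
        if "m \<le> n" for n
        using cauchy[OF that] L2_integrable_sq[OF L2_diff[OF g g], of m n]
        by (subst nn_integral_eq_integral) (auto simp: L2_sqnorm_def intro!: ennreal_leI)
      then have "limsup (\<lambda>n. \<integral>\<^sup>+z. ennreal ((norm (g m z - g n z))\<^sup>2) \<partial>circle_measure) \<le> ennreal (4 * (1/4) ^ m)"
        by (intro Limsup_bounded) (auto simp: eventually_sequentially)
      then show ?thesis
        using Liminf_le_Limsup[OF sequentially_bot] order_trans by blast
    qed
    finally show ?thesis .
  qed
  have diffL2: "(\<lambda>z. g m z - G z) \<in> L2" for m
  proof -
    have "(\<integral>\<^sup>+z. ennreal ((norm (g m z - G z))\<^sup>2) \<partial>circle_measure) < \<infinity>"
      using bound[of m] by (rule order.strict_trans1) simp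
    then show ?thesis
      unfolding L2_def by (auto intro!: integrableI_bounded)
  qed
  show ?thesis
  proof (rule that)
    show "G \<in> L2"
      using L2_diff[OF g diffL2, of 0 0] by simp
    fix m
    have "ennreal (L2_sqnorm (\<lambda>z. g m z - G z)) \<le> ennreal (4 * (1/4) ^ m)"
      using bound[of m] L2_integrable_sq[OF diffL2, of m]
      by (subst (asm) nn_integral_eq_integral) (auto simp: L2_sqnorm_def)
    then show "L2_sqnorm (\<lambda>z. g m z - G z) \<le> 4 * (1/4) ^ m"
      by (simp add: ennreal_le_iff)
  qed
qed

section \<open>Orthogonal projections\<close>

text \<open>Annihilators are closed subspaces by construction; the Hardy space and all model spaces are of
  this form, so one projection theorem serves them all.\<close>

definition L2_perp :: "(complex \<Rightarrow> 'h::fd_chilbert) set \<Rightarrow> (complex \<Rightarrow> 'h) set" where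
  "L2_perp A = {f \<in> L2. \<forall>h\<in>A. L2_inner f h = 0}"

lemma L2_perp_subset_L2: "L2_perp A \<subseteq> L2"
  by (auto simp: L2_perp_def)

lemma L2_perp_add:
  "A \<subseteq> L2 \<Longrightarrow> f \<in> L2_perp A \<Longrightarrow> g \<in> L2_perp A \<Longrightarrow> (\<lambda>z. f z + g z) \<in> L2_perp A"
  by (auto simp: L2_perp_def L2_add L2_inner_add_left subsetD)

lemma L2_perp_diff:
  "A \<subseteq> L2 \<Longrightarrow> f \<in> L2_perp A \<Longrightarrow> g \<in> L2_perp A \<Longrightarrow> (\<lambda>z. f z - g z) \<in> L2_perp A"
  by (auto simp: L2_perp_def L2_diff L2_inner_diff_left subsetD)

lemma L2_perp_scaleC: "f \<in> L2_perp A \<Longrightarrow> (\<lambda>z. c *\<^sub>C f z) \<in> L2_perp A"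
  by (auto simp: L2_perp_def L2_scaleC L2_inner_scaleC_left)

lemma L2_perp_zero [simp]: "(\<lambda>z. 0) \<in> L2_perp A"
  by (auto simp: L2_perp_def L2_inner_def)

lemma tendsto_Re_L2_inner:
  assumes g: "\<And>n. g n \<in> L2" and G: "G \<in> L2" and h: "h \<in> L2"
    and lim: "(\<lambda>n. L2_sqnorm (\<lambda>z. g n z - G z)) \<longlonglongrightarrow> 0"
  shows "(\<lambda>n. Re (L2_inner (g n) h)) \<longlonglongrightarrow> Re (L2_inner G h)"
proof -
  have "(\<lambda>n. L2_sqnorm (\<lambda>z. g n z - G z) * L2_sqnorm h) \<longlonglongrightarrow> 0 * L2_sqnorm h"
    by (intro tendsto_intros lim)
  then have to_0: "(\<lambda>n. L2_sqnorm (\<lambda>z. g n z - G z) * L2_sqnorm h) \<longlonglongrightarrow> 0" by simp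
  have "norm ((Re (L2_inner (\<lambda>z. g n z - G z) h))\<^sup>2)
      \<le> L2_sqnorm (\<lambda>z. g n z - G z) * L2_sqnorm h" for n
    using L2_Cauchy_Schwarz_Re[OF L2_diff[OF g G] h] by simp
  then have "(\<lambda>n. (Re (L2_inner (\<lambda>z. g n z - G z) h))\<^sup>2) \<longlonglongrightarrow> 0"
    by (rule Lim_null_comparison[OF always_eventually[OF allI] to_0])
  then have "(\<lambda>n. sqrt ((Re (L2_inner (\<lambda>z. g n z - G z) h))\<^sup>2)) \<longlonglongrightarrow> sqrt 0"
    by (rule tendsto_real_sqrt)
  then have "(\<lambda>n. Re (L2_inner (\<lambda>z. g n z - G z) h)) \<longlonglongrightarrow> 0"
    by (simp add: tendsto_rabs_zero_iff)
  then have "(\<lambda>n. Re (L2_inner (g n) h) - Re (L2_inner G h)) \<longlonglongrightarrow> 0"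
    by (simp add: L2_inner_diff_left[OF g G h])
  then show ?thesis by (simp add: LIM_zero_iff)
qed

lemma L2_inner_eq_0_from_Re:
  assumes "\<And>c. Re (L2_inner f (\<lambda>z. c *\<^sub>C h z)) = 0"
  shows "L2_inner f h = 0"
  using assms[of 1] assms[of \<i>]
  by (simp add: L2_inner_scaleC_right complex_eq_iff)

text \<open>A minimizing sequence for the distance from \<open>f\<close> is Cauchy by the parallelogram law; its limit
  stays in the annihilator since the inner product is continuous, and orthogonality comes from
  varying the elements of the sequence themselves, so that the limit need not be known to attain
  the distance.\<close>

lemma orthogonal_projection_exists:
  fixes f :: "complex \<Rightarrow> 'h::fd_chilbert"
  assumes A: "A \<subseteq> L2" and f: "f \<in> L2"
  shows "\<exists>G. G \<in> L2_perp A \<and> (\<forall>h\<in>L2_perp A. L2_inner (\<lambda>z. f z - G z) h = 0)"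
proof -
  define D where "D = (\<lambda>g. L2_sqnorm (\<lambda>z. f z - g z)) ` L2_perp A"
  define d where "d = Inf D"
  have D: "D \<noteq> {}" "bdd_below D"
    unfolding D_def using L2_perp_zero[of A] by (blast, auto intro!: bdd_belowI[of _ 0])
  have dle: "d \<le> L2_sqnorm (\<lambda>z. f z - g z)" if "g \<in> L2_perp A" for g
    unfolding d_def using that D by (auto simp: D_def intro!: cInf_lower)
  have "\<exists>g\<in>L2_perp A. L2_sqnorm (\<lambda>z. f z - g z) < d + (1/4) ^ n" for n
    using cInf_lessD[OF D(1), of "d + (1/4) ^ n"] by (auto simp: d_def D_def)
  then obtain g where g: "\<And>n. g n \<in> L2_perp A"
    and gd: "\<And>n. L2_sqnorm (\<lambda>z. f z - g n z) < d + (1/4) ^ n" by metis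
  have gL2: "g n \<in> L2" for n using g L2_perp_subset_L2 by blast
  have "L2_sqnorm (\<lambda>z. g m z - g n z) \<le> 4 * (1/4) ^ m" if "m \<le> n" for m n
  proof -
    let ?mid = "\<lambda>z. (1/2) *\<^sub>C (g m z + g n z)"
    have mid: "?mid \<in> L2_perp A"
      by (intro L2_perp_scaleC L2_perp_add A g)
    have half: "(1/2::complex) *\<^sub>C x = (1/2::real) *\<^sub>R x" for x :: 'h
      using scaleR_scaleC[of "1/2" x] by simp
    have "(norm (b - c))\<^sup>2 + 4 * (norm (a - (1/2) *\<^sub>C (b + c)))\<^sup>2
        = 2 * (norm (a - b))\<^sup>2 + 2 * (norm (a - c))\<^sup>2" for a b c :: 'h
    proof -
      have "a - (1/2) *\<^sub>C (b + c) = (1/2::real) *\<^sub>R ((a - b) + (a - c))"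
        unfolding half by (simp add: algebra_simps flip: scaleR_add_left)
      then have "4 * (norm (a - (1/2) *\<^sub>C (b + c)))\<^sup>2 = (norm ((a - b) + (a - c)))\<^sup>2"
        by (simp add: power_divide)
      moreover have "norm (b - c) = norm ((a - b) - (a - c))"
        by (simp add: norm_minus_commute)
      ultimately show ?thesis
        using norm_add_sq_plus_norm_diff_sq[of "a - b" "a - c"] by simp
    qed
    then have "(LINT z|circle_measure. (norm (g m z - g n z))\<^sup>2 + 4 * (norm (f z - ?mid z))\<^sup>2)
       = (LINT z|circle_measure. 2 * (norm (f z - g m z))\<^sup>2 + 2 * (norm (f z - g n z))\<^sup>2)"
      by simp
    moreover have "?mid \<in> L2" using mid L2_perp_subset_L2 by blast
    ultimately have "L2_sqnorm (\<lambda>z. g m z - g n z) + 4 * L2_sqnorm (\<lambda>z. f z - ?mid z)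
       = 2 * L2_sqnorm (\<lambda>z. f z - g m z) + 2 * L2_sqnorm (\<lambda>z. f z - g n z)"
      unfolding L2_sqnorm_def
      by (simp add: L2_integrable_sq L2_diff f gL2)
    then have "L2_sqnorm (\<lambda>z. g m z - g n z) \<le> 2 * (1/4) ^ m + 2 * (1/4) ^ n"
      using dle[OF mid] gd[of m] gd[of n] by linarith
    moreover have "(1/4::real) ^ n \<le> (1/4) ^ m"
      using that by (intro power_decreasing) auto
    ultimately show ?thesis by linarith
  qed
  then obtain G where G: "G \<in> L2" and Gb: "\<And>m. L2_sqnorm (\<lambda>z. g m z - G z) \<le> 4 * (1/4) ^ m"
    using L2_complete[of g] gL2 by metis
  have pow: "(\<lambda>m. (1/4::real) ^ m) \<longlonglongrightarrow> 0" by (rule LIMSEQ_realpow_zero) auto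
  have lim: "(\<lambda>n. L2_sqnorm (\<lambda>z. g n z - G z)) \<longlonglongrightarrow> 0"
    by (rule Lim_null_comparison[OF always_eventually[OF allI] tendsto_mult_right_zero[OF pow, of 4]])
       (simp add: Gb)
  have GA: "G \<in> L2_perp A"
  proof -
    have "L2_inner G h = 0" if "h \<in> A" for h
    proof (rule L2_inner_eq_0_from_Re)
      fix c
      have h: "(\<lambda>z. c *\<^sub>C h z) \<in> L2" using that A by (auto intro: L2_scaleC)
      have "Re (L2_inner (g n) (\<lambda>z. c *\<^sub>C h z)) = 0" for n
        using g[of n] that by (simp add: L2_perp_def L2_inner_scaleC_right)
      then show "Re (L2_inner G (\<lambda>z. c *\<^sub>C h z)) = 0"
        using LIMSEQ_unique[OF tendsto_Re_L2_inner[OF gL2 G h lim], of 0] by simp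
    qed
    then show ?thesis using G by (simp add: L2_perp_def)
  qed
  have "Re (L2_inner (\<lambda>z. f z - G z) h) = 0" if h: "h \<in> L2_perp A" for h
  proof -
    let ?R = "Re (L2_inner (\<lambda>z. f z - G z) h)"
    have hL2: "h \<in> L2" using h L2_perp_subset_L2 by blast
    have "0 \<le> 0 - 2 * t * ?R + t\<^sup>2 * L2_sqnorm h" for t
    proof (rule LIMSEQ_le_const)
      have "(\<lambda>n. Re (L2_inner f h) - Re (L2_inner (g n) h)) \<longlonglongrightarrow> Re (L2_inner f h) - Re (L2_inner G h)"
        by (intro tendsto_intros tendsto_Re_L2_inner gL2 G hL2 lim)
      then have "(\<lambda>n. Re (L2_inner (\<lambda>z. f z - g n z) h)) \<longlonglongrightarrow> ?R"
        by (simp add: L2_inner_diff_left f gL2 G hL2)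
      then show "(\<lambda>n. (1/4) ^ n - 2 * t * Re (L2_inner (\<lambda>z. f z - g n z) h) + t\<^sup>2 * L2_sqnorm h)
          \<longlonglongrightarrow> 0 - 2 * t * ?R + t\<^sup>2 * L2_sqnorm h"
        by (intro tendsto_add tendsto_diff tendsto_mult tendsto_const pow)
      have "0 \<le> (1/4) ^ n - 2 * t * Re (L2_inner (\<lambda>z. f z - g n z) h) + t\<^sup>2 * L2_sqnorm h" for n
      proof -
        have "(\<lambda>z. g n z + complex_of_real t *\<^sub>C h z) \<in> L2_perp A"
          by (intro L2_perp_add L2_perp_scaleC A g h)
        from dle[OF this] have "d \<le> L2_sqnorm (\<lambda>z. (f z - g n z) - complex_of_real t *\<^sub>C h z)"
          by (simp add: algebra_simps)
        also have "\<dots> = L2_sqnorm (\<lambda>z. f z - g n z)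
            - 2 * t * Re (L2_inner (\<lambda>z. f z - g n z) h) + t\<^sup>2 * L2_sqnorm h"
          by (intro L2_sqnorm_diff_scaleR L2_diff f gL2 hL2)
        finally show ?thesis using gd[of n] by linarith
      qed
      then show "\<exists>N. \<forall>n\<ge>N. 0 \<le> (1/4) ^ n - 2 * t * Re (L2_inner (\<lambda>z. f z - g n z) h) + t\<^sup>2 * L2_sqnorm h"
        by blast
    qed
    then have "?R\<^sup>2 \<le> 0 * L2_sqnorm h" by (rule nonneg_quadratic_discriminant)
    then show ?thesis by simp
  qed
  note Re_0 = this
  have "L2_inner (\<lambda>z. f z - G z) h = 0" if "h \<in> L2_perp A" for h
    by (rule L2_inner_eq_0_from_Re, rule Re_0, rule L2_perp_scaleC, rule that)
  then show ?thesis using GA by blast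
qed

lemma orth_proj_perp:
  assumes "A \<subseteq> L2" "f \<in> L2"
  shows orth_proj_in: "orth_proj (L2_perp A) f \<in> L2_perp A"
    and orth_proj_orthogonal: "h \<in> L2_perp A \<Longrightarrow> L2_inner (\<lambda>z. f z - orth_proj (L2_perp A) f z) h = 0"
  using someI_ex[OF orthogonal_projection_exists[OF assms]] by (auto simp: orth_proj_def)

lemma orth_proj_unique:
  assumes A: "A \<subseteq> L2" and f: "f \<in> L2" and g: "g \<in> L2_perp A"
    and orth: "\<And>h. h \<in> L2_perp A \<Longrightarrow> L2_inner (\<lambda>z. f z - g z) h = 0"
  shows "AE z in circle_measure. orth_proj (L2_perp A) f z = g z"
proof -
  let ?p = "orth_proj (L2_perp A) f"
  have p: "?p \<in> L2_perp A" using A f by (rule orth_proj_in)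
  have L2: "?p \<in> L2" "g \<in> L2" using p g L2_perp_subset_L2 by blast+
  have h: "(\<lambda>z. ?p z - g z) \<in> L2_perp A" by (intro L2_perp_diff A p g)
  have "L2_inner (\<lambda>z. ?p z - g z) (\<lambda>z. ?p z - g z)
      = L2_inner (\<lambda>z. (f z - g z) - (f z - ?p z)) (\<lambda>z. ?p z - g z)"
    by simp
  also have "\<dots> = 0"
    using orth[OF h] orth_proj_orthogonal[OF A f h]
    by (subst L2_inner_diff_left) (auto intro!: L2_diff f L2)
  finally have "L2_sqnorm (\<lambda>z. ?p z - g z) = 0" by (simp add: L2_inner_self)
  then have "AE z in circle_measure. ?p z - g z = 0"
    by (intro L2_sqnorm_eq_0 L2_diff L2)
  then show ?thesis by simp
qed

lemma orth_proj_cong_AE: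
  assumes S: "S \<subseteq> L2"
    and "f \<in> borel_measurable circle_measure" "f' \<in> borel_measurable circle_measure"
    and "AE z in circle_measure. f z = f' z"
  shows "orth_proj S f = orth_proj S f'"
proof -
  have "L2_inner (\<lambda>z. f z - g z) h = L2_inner (\<lambda>z. f' z - g z) h" if "g \<in> S" "h \<in> S" for g h
  proof -
    have [measurable]: "g \<in> borel_measurable circle_measure" "h \<in> borel_measurable circle_measure"
      using that S by (auto intro!: L2_measurable)
    note [measurable] = assms(2,3)
    show ?thesis
    proof (rule L2_inner_cong_AE)
      show "(\<lambda>z. f z - g z) \<in> borel_measurable circle_measure"
        "(\<lambda>z. f' z - g z) \<in> borel_measurable circle_measure" by measurable
    qed (use assms(4) in auto)
  qed
  then show ?thesis unfolding orth_proj_def by (intro arg_cong[where f=Eps] ext) auto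
qed

section \<open>Trigonometric polynomials determine functions on the circle\<close>

text \<open>The last rule identifies functions that agree on the circle. It makes the class closed under
  products and lets it contain the coordinates, although \<open>z powi m * z powi n\<close> and
  \<open>z powi (m + n)\<close> may differ at zero.\<close>

inductive trig_poly :: "(complex \<Rightarrow> complex) \<Rightarrow> bool" where
  monomial: "trig_poly (\<lambda>z. c * z powi n)"
| add: "trig_poly p \<Longrightarrow> trig_poly q \<Longrightarrow> trig_poly (\<lambda>z. p z + q z)"
| cong: "trig_poly p \<Longrightarrow> (\<And>z. z \<in> sphere 0 1 \<Longrightarrow> p z = q z) \<Longrightarrow> trig_poly q"

lemma trig_poly_monomial_mult: "trig_poly q \<Longrightarrow> trig_poly (\<lambda>z. (c * z powi n) * q z)"
proof (induction rule: trig_poly.induct)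
  case (monomial d m)
  show ?case
    by (rule trig_poly.cong[OF trig_poly.monomial[of "c * d" "n + m"]])
       (simp add: circle_powi_add del: mem_sphere mem_sphere_0)
next
  case (add p q)
  show ?case
    by (rule trig_poly.cong[OF trig_poly.add[OF add.IH]]) (simp add: algebra_simps)
next
  case (cong p q)
  show ?case
    by (rule trig_poly.cong[OF cong.IH]) (simp add: cong.hyps)
qed

lemma trig_poly_mult: "trig_poly p \<Longrightarrow> trig_poly q \<Longrightarrow> trig_poly (\<lambda>z. p z * q z)"
proof (induction rule: trig_poly.induct)
  case (monomial c n)
  then show ?case by (rule trig_poly_monomial_mult)
next
  case (add p p')
  show ?case
    by (rule trig_poly.cong[OF trig_poly.add[OF add.IH(1)[OF add.prems] add.IH(2)[OF add.prems]]])
       (simp add: algebra_simps)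
next
  case (cong p p')
  show ?case
    by (rule trig_poly.cong[OF cong.IH[OF cong.prems]]) (simp add: cong.hyps)
qed

text \<open>On the circle the coordinates are \<open>(z + z\<inverse>)/2\<close> and \<open>(z - z\<inverse>)/(2\<i>)\<close>.\<close>

lemma trig_poly_real_polynomial:
  "real_polynomial_function p \<Longrightarrow> trig_poly (\<lambda>z. complex_of_real (p z))"
proof (induction rule: real_polynomial_function.induct)
  case (linear f)
  interpret bounded_linear f by fact
  define a b where "a = (complex_of_real (f 1) - \<i> * complex_of_real (f \<i>)) / 2"
    and "b = (complex_of_real (f 1) + \<i> * complex_of_real (f \<i>)) / 2"
  have "trig_poly (\<lambda>z. a * z powi 1 + b * z powi (- 1))"
    by (intro trig_poly.intros)
  then show ?case
  proof (rule trig_poly.cong)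
    fix z :: complex assume z: "z \<in> sphere 0 1"
    have "z = Re z *\<^sub>R 1 + Im z *\<^sub>R \<i>" by (simp add: complex_eq_iff)
    then have "f z = Re z * f 1 + Im z * f \<i>"
      by (metis add scaleR real_scaleR_def)
    moreover have "z powi (- 1) = cnj z"
      using cnj_circle_powi[OF z, of 1] by simp
    ultimately show "a * z powi 1 + b * z powi (- 1) = complex_of_real (f z)"
      unfolding power_int_1_right by (simp only: a_def b_def) (simp add: complex_eq_iff field_simps)
  qed
next
  case (const c)
  show ?case
    by (rule trig_poly.cong[OF trig_poly.monomial[of "complex_of_real c" 0]]) simp
next
  case (add f g)
  then show ?case using trig_poly.add by fastforce
next
  case (mult f g)
  then show ?case using trig_poly_mult by fastforce
qed

lemma trig_poly_continuous: "trig_poly p \<Longrightarrow> continuous_on (sphere 0 1) p"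
proof (induction rule: trig_poly.induct)
  case (cong p q)
  then show ?case using continuous_on_cong by metis
qed (auto intro!: continuous_intros)

lemma real_polynomial_continuous: "real_polynomial_function p \<Longrightarrow> continuous_on S (p :: complex \<Rightarrow> real)"
  by (induction rule: real_polynomial_function.induct)
     (auto intro: continuous_intros linear_continuous_on)

lemma circle_mult_integrable:
  fixes u g :: "complex \<Rightarrow> real"
  assumes u: "integrable circle_measure u" and g: "continuous_on (sphere 0 1) g"
  shows "integrable circle_measure (\<lambda>z. g z * u z)"
proof -
  have "bounded (g ` sphere 0 1)"
    using g by (intro compact_imp_bounded compact_continuous_image) auto
  then obtain B where B: "\<forall>z\<in>sphere 0 1. norm (g z) \<le> B" by (auto simp: bounded_iff)
  have [measurable]: "g \<in> borel_measurable circle_measure" "u \<in> borel_measurable circle_measure"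
    using g u measurable_circle_continuous by auto
  show ?thesis
  proof (rule Bochner_Integration.integrable_bound)
    show "integrable circle_measure (\<lambda>z. B * norm (u z))" using u by simp
    show "AE z in circle_measure. norm (g z * u z) \<le> norm (B * norm (u z))"
      using B by (intro AE_I2) (force simp: abs_mult intro!: mult_right_mono)
  qed measurable
qed

text \<open>By Stone--Weierstrass an estimate tested on polynomials extends to all continuous functions.\<close>

lemma duality_bound_continuous:
  fixes u g :: "complex \<Rightarrow> real"
  assumes u: "integrable circle_measure u" and M: "0 \<le> M"
    and le: "\<And>p. real_polynomial_function p \<Longrightarrow>
      \<bar>LINT z|circle_measure. p z * u z\<bar> \<le> M * (LINT z|circle_measure. \<bar>p z\<bar>)"
    and g: "continuous_on (sphere 0 1) g"
  shows "\<bar>LINT z|circle_measure. g z * u z\<bar> \<le> M * (LINT z|circle_measure. \<bar>g z\<bar>)"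
proof -
  define K where "K = (LINT z|circle_measure. \<bar>u z\<bar>) + M"
  have "K \<ge> 0" using M by (simp add: K_def)
  have step: "\<bar>LINT z|circle_measure. g z * u z\<bar> \<le> M * (LINT z|circle_measure. \<bar>g z\<bar>) + e * K"
    if "e > 0" for e
  proof -
    obtain p where p: "real_polynomial_function p" and pg: "\<And>z. z \<in> sphere 0 1 \<Longrightarrow> \<bar>g z - p z\<bar> < e"
      using Stone_Weierstrass_real_polynomial_function[OF compact_sphere g \<open>e > 0\<close>] by metis
    have pc: "continuous_on (sphere 0 1) p" using p by (rule real_polynomial_continuous)
    note int = circle_mult_integrable[OF u g] circle_mult_integrable[OF u pc]
    have abs_int: "integrable circle_measure (\<lambda>z. \<bar>g z\<bar>)" "integrable circle_measure (\<lambda>z. \<bar>p z\<bar>)"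
      using g pc by (auto intro!: integrable_circle_continuous continuous_intros)
    have "\<bar>(LINT z|circle_measure. g z * u z) - (LINT z|circle_measure. p z * u z)\<bar>
        = \<bar>LINT z|circle_measure. g z * u z - p z * u z\<bar>"
      using int by simp
    also have "\<dots> \<le> (LINT z|circle_measure. \<bar>g z * u z - p z * u z\<bar>)"
      by (rule integral_abs_bound)
    also have "\<dots> \<le> (LINT z|circle_measure. e * \<bar>u z\<bar>)"
    proof (rule integral_mono)
      fix z assume "z \<in> space circle_measure"
      then show "\<bar>g z * u z - p z * u z\<bar> \<le> e * \<bar>u z\<bar>"
        using pg[of z] by (auto simp flip: left_diff_distrib simp: abs_mult intro!: mult_right_mono)
    qed (use int u in auto)
    also have "\<dots> = e * (LINT z|circle_measure. \<bar>u z\<bar>)" by simp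
    finally have 1: "\<bar>(LINT z|circle_measure. g z * u z) - (LINT z|circle_measure. p z * u z)\<bar>
      \<le> e * (LINT z|circle_measure. \<bar>u z\<bar>)" .
    have "(LINT z|circle_measure. \<bar>p z\<bar>) \<le> (LINT z|circle_measure. \<bar>g z\<bar> + e)"
    proof (rule integral_mono)
      fix z assume "z \<in> space circle_measure"
      then show "\<bar>p z\<bar> \<le> \<bar>g z\<bar> + e" using pg[of z] by auto
    qed (use abs_int in auto)
    also have "\<dots> = (LINT z|circle_measure. \<bar>g z\<bar>) + e" using abs_int by simp
    finally have "M * (LINT z|circle_measure. \<bar>p z\<bar>) \<le> M * ((LINT z|circle_measure. \<bar>g z\<bar>) + e)"
      by (rule mult_left_mono[OF _ M])
    then show ?thesis using 1 le[OF p] by (simp add: K_def algebra_simps)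
  qed
  show ?thesis
  proof (rule field_le_epsilon)
    fix e :: real assume "e > 0"
    then have "e / (K + 1) > 0" using \<open>K \<ge> 0\<close> by simp
    moreover have "e / (K + 1) * K \<le> e"
      using \<open>K \<ge> 0\<close> \<open>e > 0\<close> by (simp add: field_simps)
    ultimately show "\<bar>LINT z|circle_measure. g z * u z\<bar> \<le> M * (LINT z|circle_measure. \<bar>g z\<bar>) + e"
      using step by fastforce
  qed
qed

text \<open>The indicator of an open set is the limit of an increasing sequence of continuous functions, so
  the integrals of \<open>v\<close> over open sets are nonnegative: the measure with density \<open>v\<^sup>+\<close>
  dominates that with density \<open>v\<^sup>-\<close> on open sets, hence by outer regularity on the Borel set where \<open>v\<close> is negative.\<close>

lemma AE_nonneg_if_continuous_tests_nonneg:
  fixes v :: "complex \<Rightarrow> real"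
  assumes v: "integrable circle_measure v"
    and test: "\<And>g. continuous_on (sphere 0 1) g \<Longrightarrow> (\<And>z. 0 \<le> g z) \<Longrightarrow>
      0 \<le> (LINT z|circle_measure. g z * v z)"
  shows "AE z in circle_measure. 0 \<le> v z"
proof -
  have [measurable]: "v \<in> borel_measurable circle_measure" using v by simp
  define m where "m w A = emeasure (distr (density circle_measure (\<lambda>z. ennreal (w z))) borel (\<lambda>z. z)) A"
    for w :: "complex \<Rightarrow> real" and A
  have m: "m w A = (\<integral>\<^sup>+z. ennreal (w z) * indicator A z \<partial>circle_measure)"
    if [measurable]: "w \<in> borel_measurable circle_measure" and A[measurable]: "A \<in> sets borel" for w A
  proof -
    have [measurable]: "(\<lambda>z. z) -` A \<inter> space circle_measure \<in> sets circle_measure"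
      by (rule measurable_sets[OF measurable_circle_id A])
    have "m w A = (\<integral>\<^sup>+z. ennreal (w z) * indicator (A \<inter> sphere 0 1) z \<partial>circle_measure)"
      unfolding m_def using measurable_sets[OF measurable_circle_id A]
      by (subst emeasure_distr) (auto simp: emeasure_density)
    also have "\<dots> = (\<integral>\<^sup>+z. ennreal (w z) * indicator A z \<partial>circle_measure)"
      by (intro nn_integral_cong) (auto split: split_indicator)
    finally show ?thesis .
  qed
  have open_le: "m (\<lambda>z. - v z) U \<le> m v U" if U: "open U" for U
  proof -
    \<comment> \<open>The origin, which is off the circle, keeps \<open>C\<close> nonempty, as \<open>infdist\<close> vanishes for the empty set.\<close>
    define C where "C = insert 0 (- U)"
    have C: "closed C" "C \<noteq> {}" using U by (auto simp: C_def intro!: closed_insert)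
    define g where "g k z = min 1 (real k * infdist z C)" for k z
    have [measurable]: "U \<in> sets borel" using U by simp
    have gc: "continuous_on (sphere 0 1) (g k)" for k
      unfolding g_def by (intro continuous_intros)
    have g0: "0 \<le> g k z" and g1: "g k z \<le> 1" for k z
      by (auto simp: g_def infdist_nonneg)
    have [measurable]: "g k \<in> borel_measurable circle_measure" for k
      by (rule measurable_circle_continuous[OF gc])
    have [measurable]: "(indicator U :: complex \<Rightarrow> real) \<in> borel_measurable circle_measure"
      using measurable_compose[OF measurable_circle_id borel_measurable_indicator[of U borel]] by simp
    have glim: "(\<lambda>k. g k z) \<longlonglongrightarrow> indicator U z" if "z \<in> sphere 0 1" for z
    proof (cases "z \<in> U")
      case True
      then have "z \<notin> C" using that by (auto simp: C_def)
      then have pos: "infdist z C > 0" using C by (intro infdist_pos_not_in_closed)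
      obtain N where N: "1 / infdist z C < real N" using reals_Archimedean2 by blast
      have "g k z = 1" if "k \<ge> N" for k
      proof -
        have "1 < real N * infdist z C" using N pos by (simp add: field_simps)
        also have "\<dots> \<le> real k * infdist z C" using that pos by (intro mult_right_mono) auto
        finally show ?thesis by (simp add: g_def)
      qed
      then show ?thesis using True
        by (intro tendsto_eventually) (auto simp: eventually_sequentially)
    next
      case False
      then have "z \<in> C" by (auto simp: C_def)
      then have "infdist z C = 0" using in_closed_iff_infdist_zero[OF C] by blast
      then show ?thesis using False by (simp add: g_def)
    qed
    have "(\<lambda>k. LINT z|circle_measure. g k z * v z) \<longlonglongrightarrow> (LINT z|circle_measure. indicator U z * v z)"
    proof (rule integral_dominated_convergence[where w="\<lambda>z. \<bar>v z\<bar>"])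
      show "AE z in circle_measure. (\<lambda>k. g k z * v z) \<longlonglongrightarrow> indicator U z * v z"
        using AE_circle_sphere by eventually_elim (intro tendsto_intros glim)
      show "AE z in circle_measure. norm (g k z * v z) \<le> \<bar>v z\<bar>" for k
        using g0 g1 by (auto simp: abs_mult intro!: AE_I2 mult_left_le_one_le)
      show "integrable circle_measure (\<lambda>z. \<bar>v z\<bar>)" using v by simp
    qed measurable
    then have "0 \<le> (LINT z|circle_measure. indicator U z * v z)"
      by (rule LIMSEQ_le_const) (auto intro: test gc g0)
    moreover have int: "integrable circle_measure (\<lambda>z. indicator U z * v z)"
      by (rule Bochner_Integration.integrable_bound[OF v]) (auto split: split_indicator)
    ultimately have le: "enn2real (\<integral>\<^sup>+z. ennreal (- (indicator U z * v z)) \<partial>circle_measure)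
        \<le> enn2real (\<integral>\<^sup>+z. ennreal (indicator U z * v z) \<partial>circle_measure)"
      by (simp add: real_lebesgue_integral_def)
    have "(\<integral>\<^sup>+z. ennreal (- (indicator U z * v z)) \<partial>circle_measure) \<noteq> \<infinity>"
      "(\<integral>\<^sup>+z. ennreal (indicator U z * v z) \<partial>circle_measure) \<noteq> \<infinity>"
      using int by (auto simp: real_integrable_def)
    then have "(\<integral>\<^sup>+z. ennreal (- (indicator U z * v z)) \<partial>circle_measure)
        \<le> (\<integral>\<^sup>+z. ennreal (indicator U z * v z) \<partial>circle_measure)"
      using le by (metis enn2real_le_iff enn2real_nonneg ennreal_enn2real ennreal_leI infinity_ennreal_def less_top)
    moreover have "(\<integral>\<^sup>+z. ennreal (- (indicator U z * v z)) \<partial>circle_measure) = m (\<lambda>z. - v z) U"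
      by (subst m) (auto intro!: nn_integral_cong split: split_indicator)
    moreover have "(\<integral>\<^sup>+z. ennreal (indicator U z * v z) \<partial>circle_measure) = m v U"
      by (subst m) (auto intro!: nn_integral_cong split: split_indicator)
    ultimately show ?thesis by simp
  qed
  let ?N = "\<lambda>w. distr (density circle_measure (\<lambda>z. ennreal (w z))) borel (\<lambda>z::complex. z)"
  define E' where "E' = {z \<in> space circle_measure. v z < 0}"
  have E': "E' \<in> sets circle_measure" unfolding E'_def by measurable
  have E: "E' \<in> sets borel"
    using E' by (auto simp: sets_circle sets_restrict_space)
  have "m (\<lambda>z. - v z) E' \<le> m v U" if "E' \<subseteq> U" "open U" for U
  proof -
    have "m (\<lambda>z. - v z) E' \<le> m (\<lambda>z. - v z) U"
      unfolding m_def using that by (intro emeasure_mono) auto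
    then show ?thesis using open_le[OF that(2)] by (rule order_trans)
  qed
  moreover have "emeasure (?N v) E' = (INF U \<in> {U. E' \<subseteq> U \<and> open U}. emeasure (?N v) U)"
  proof (rule outer_regular[OF _ _ E])
    have "emeasure (?N v) (space (?N v)) = (\<integral>\<^sup>+z. ennreal (v z) \<partial>circle_measure)"
      using m[of v UNIV] by (simp add: m_def)
    then show "emeasure (?N v) (space (?N v)) \<noteq> \<infinity>"
      using v by (simp add: real_integrable_def)
  qed simp
  ultimately have "m (\<lambda>z. - v z) E' \<le> m v E'"
    unfolding m_def by (simp add: le_INF_iff)
  also have "m v E' = 0"
    by (subst m[OF _ E]) (auto simp: nn_integral_0_iff_AE E'_def ennreal_neg split: split_indicator)
  finally have "(\<integral>\<^sup>+z. ennreal (- v z) * indicator E' z \<partial>circle_measure) = 0"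
    by (subst (asm) m[OF _ E]) auto
  then have "AE z in circle_measure. ennreal (- v z) * indicator E' z = 0"
    using E' by (subst (asm) nn_integral_0_iff_AE) auto
  then show ?thesis
    using AE_space
  proof eventually_elim
    case (elim z)
    then show ?case
      by (cases "v z < 0") (auto simp: E'_def ennreal_eq_0_iff)
  qed
qed

text \<open>The duality between \<open>L\<^sup>1\<close> and \<open>L\<^sup>\<infinity>\<close>, tested on trigonometric polynomials only. Besides the
  boundedness of boundary values, the case \<open>M = 0\<close> gives the uniqueness of Fourier
  coefficients.\<close>

lemma AE_bounded_by_duality:
  fixes f :: "complex \<Rightarrow> 'h::fd_chilbert"
  assumes f: "integrable circle_measure f" and M: "0 \<le> M"
    and le: "\<And>p. trig_poly p \<Longrightarrow>
      norm (LINT z|circle_measure. p z *\<^sub>C f z) \<le> M * (LINT z|circle_measure. cmod (p z))"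
  shows "AE z in circle_measure. norm (f z) \<le> real DIM('h) * M"
proof -
  have "AE z in circle_measure. \<bar>inner (f z) b\<bar> \<le> M" if b: "b \<in> Basis" for b
  proof -
    define u where "u z = inner (f z) b" for z
    have u: "integrable circle_measure u" unfolding u_def using f by simp
    have "\<bar>LINT z|circle_measure. p z * u z\<bar> \<le> M * (LINT z|circle_measure. \<bar>p z\<bar>)"
      if p: "real_polynomial_function p" for p
    proof -
      have pint: "integrable circle_measure (\<lambda>z. p z *\<^sub>R f z)"
      proof -
        have "bounded (p ` sphere 0 1)"
          using real_polynomial_continuous[OF p]
          by (intro compact_imp_bounded compact_continuous_image) auto
        then obtain B where B: "\<forall>z\<in>sphere 0 1. norm (p z) \<le> B" by (auto simp: bounded_iff)
        have [measurable]: "p \<in> borel_measurable circle_measure" "f \<in> borel_measurable circle_measure"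
          using f measurable_circle_continuous[OF real_polynomial_continuous[OF p]] by auto
        show ?thesis
        proof (rule Bochner_Integration.integrable_bound)
          show "integrable circle_measure (\<lambda>z. B * norm (f z))" using f by simp
          show "AE z in circle_measure. norm (p z *\<^sub>R f z) \<le> norm (B * norm (f z))"
            using B by (intro AE_I2) (force simp: abs_mult intro!: mult_right_mono)
        qed measurable
      qed
      have "(LINT z|circle_measure. p z * u z) = inner (LINT z|circle_measure. p z *\<^sub>R f z) b"
        unfolding integral_inner_left[OF pint, symmetric] by (simp add: u_def)
      also have "\<bar>\<dots>\<bar> \<le> norm (LINT z|circle_measure. p z *\<^sub>R f z)"
        using Cauchy_Schwarz_ineq2[of _ b] b by simp
      also have "\<dots> \<le> M * (LINT z|circle_measure. \<bar>p z\<bar>)"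
        using le[OF trig_poly_real_polynomial[OF p]] by (simp flip: scaleR_scaleC)
      finally show ?thesis .
    qed
    then have bound: "\<bar>LINT z|circle_measure. g z * u z\<bar> \<le> M * (LINT z|circle_measure. \<bar>g z\<bar>)"
      if "continuous_on (sphere 0 1) g" for g
      using duality_bound_continuous[OF u M _ that] by blast
    have "AE z in circle_measure. 0 \<le> M - s * u z" if "\<bar>s\<bar> = 1" for s
    proof (rule AE_nonneg_if_continuous_tests_nonneg)
      show "integrable circle_measure (\<lambda>z. M - s * u z)" using u by simp
      fix g :: "complex \<Rightarrow> real" assume g: "continuous_on (sphere 0 1) g" and g0: "\<And>z. 0 \<le> g z"
      have int: "integrable circle_measure g" "integrable circle_measure (\<lambda>z. g z * u z)"
        using g u by (auto intro: integrable_circle_continuous circle_mult_integrable)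
      have "(LINT z|circle_measure. g z * (M - s * u z))
          = (LINT z|circle_measure. M * g z - s * (g z * u z))"
        by (simp add: algebra_simps)
      also have "\<dots> = M * (LINT z|circle_measure. g z) - s * (LINT z|circle_measure. g z * u z)"
        using int by simp
      finally have eq: "(LINT z|circle_measure. g z * (M - s * u z))
          = M * (LINT z|circle_measure. g z) - s * (LINT z|circle_measure. g z * u z)" .
      have "s * (LINT z|circle_measure. g z * u z) \<le> \<bar>LINT z|circle_measure. g z * u z\<bar>"
        using that by (auto simp: abs_if split: if_splits)
      also have "\<dots> \<le> M * (LINT z|circle_measure. g z)"
        using bound[OF g] g0 by simp
      finally show "0 \<le> (LINT z|circle_measure. g z * (M - s * u z))" by (simp add: eq)
    qed
    from this[of 1] this[of "-1"] show ?thesis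
      by (auto simp: u_def elim: eventually_elim2)
  qed
  then have "AE z in circle_measure. \<forall>b\<in>Basis. \<bar>inner (f z) b\<bar> \<le> M"
    by (intro AE_finite_allI) auto
  then show ?thesis
  proof eventually_elim
    case (elim z)
    have "norm (f z) \<le> (\<Sum>b\<in>Basis. \<bar>inner (f z) b\<bar>)" by (rule norm_le_l1)
    also have "\<dots> \<le> (\<Sum>b\<in>(Basis::'h set). M)" using elim by (intro sum_mono) auto
    finally show ?case by simp
  qed
qed

section \<open>The Hardy space\<close>

lemma circle_powi_L2: "(\<lambda>z. (z powi n) *\<^sub>C x) \<in> L2"
proof (rule L2_bounded[where B="norm x"])
  have [measurable]: "(\<lambda>z::complex. z powi n) \<in> borel_measurable circle_measure"
    by (rule measurable_circle_continuous[OF continuous_on_circle_powi])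
  show "(\<lambda>z. (z powi n) *\<^sub>C x) \<in> borel_measurable circle_measure" by measurable
  show "AE z in circle_measure. norm ((z powi n) *\<^sub>C x) \<le> norm x"
    by (rule AE_I2) simp
qed

lemma integrable_scaleC_bounded:
  fixes f :: "complex \<Rightarrow> 'h::fd_chilbert"
  assumes f: "integrable circle_measure f" and g: "g \<in> borel_measurable circle_measure"
    and B: "\<And>z. z \<in> sphere 0 1 \<Longrightarrow> cmod (g z) \<le> B"
  shows "integrable circle_measure (\<lambda>z. g z *\<^sub>C f z)"
proof (rule Bochner_Integration.integrable_bound)
  have [measurable]: "f \<in> borel_measurable circle_measure" using f by simp
  show "(\<lambda>z. g z *\<^sub>C f z) \<in> borel_measurable circle_measure" using g by measurable
  show "integrable circle_measure (\<lambda>z. B * norm (f z))" using f by simp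
  show "AE z in circle_measure. norm (g z *\<^sub>C f z) \<le> norm (B * norm (f z))"
    using B by (intro AE_I2) (force simp: abs_mult intro!: mult_right_mono)
qed

lemma integrable_continuous_scaleC:
  fixes f :: "complex \<Rightarrow> 'h::fd_chilbert"
  assumes f: "integrable circle_measure f" and g: "continuous_on (sphere 0 1) g"
  shows "integrable circle_measure (\<lambda>z. g z *\<^sub>C f z)"
proof -
  have "bounded (g ` sphere 0 1)"
    using g by (intro compact_imp_bounded compact_continuous_image) auto
  then obtain B where "\<forall>z\<in>sphere 0 1. norm (g z) \<le> B" by (auto simp: bounded_iff)
  then show ?thesis
    by (intro integrable_scaleC_bounded[OF f, where B=B] measurable_circle_continuous g) auto
qed

lemma L2_inner_powi:
  assumes f: "f \<in> L2"
  shows "L2_inner f (\<lambda>z. (z powi n) *\<^sub>C x) = cinner (fourier_coeff f n) x"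
proof -
  have "L2_inner f (\<lambda>z. (z powi n) *\<^sub>C x) = (LINT z|circle_measure. cinner ((z powi (- n)) *\<^sub>C f z) x)"
    unfolding L2_inner_def
  proof (rule Bochner_Integration.integral_cong)
    fix z assume "z \<in> space circle_measure"
    then show "cinner (f z) ((z powi n) *\<^sub>C x) = cinner ((z powi (- n)) *\<^sub>C f z) x"
      using cnj_circle_powi[of z n] by (simp add: cinner_scaleC_left cinner_scaleC_right)
  qed simp
  also have "\<dots> = cinner (fourier_coeff f n) x"
    unfolding fourier_coeff_def
    by (intro integral_bounded_linear bounded_linear_cinner_left integrable_continuous_scaleC
        L2_integrable f continuous_on_circle_powi)
  finally show ?thesis .
qed

lemma fourier_coeff_eq_0_iff:
  "f \<in> L2 \<Longrightarrow> fourier_coeff f n = 0 \<longleftrightarrow> (\<forall>x. L2_inner f (\<lambda>z. (z powi n) *\<^sub>C x) = 0)"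
  using cinner_self[of "fourier_coeff f n"] by (auto simp: L2_inner_powi)

definition negative_monomials :: "(complex \<Rightarrow> 'h::fd_chilbert) set" where
  "negative_monomials = {\<lambda>z. (z powi n) *\<^sub>C x |n x. n < 0}"

lemma negative_monomials_L2: "negative_monomials \<subseteq> L2"
  by (auto simp: negative_monomials_def circle_powi_L2)

lemma H2_eq_perp: "H2 = L2_perp negative_monomials"
  unfolding H2_def L2_perp_def negative_monomials_def
  by (intro Collect_cong) (auto simp: fourier_coeff_eq_0_iff, blast)

lemma H2_L2: "f \<in> H2 \<Longrightarrow> f \<in> L2"
  by (simp add: H2_def)

lemma H2_fourier: "f \<in> H2 \<Longrightarrow> n < 0 \<Longrightarrow> fourier_coeff f n = 0"
  by (simp add: H2_def)

lemma fourier_coeff_monomial: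
  "fourier_coeff (\<lambda>z. (z powi m) *\<^sub>C x) n = (if m = n then x else 0)"
proof -
  have "fourier_coeff (\<lambda>z. (z powi m) *\<^sub>C x) n = (LINT z|circle_measure. (z powi (m - n)) *\<^sub>C x)"
    unfolding fourier_coeff_def
    by (rule Bochner_Integration.integral_cong)
       (simp_all add: scaleC_scaleC flip: circle_powi_add del: mem_sphere_0)
  also have "\<dots> = (LINT z|circle_measure. z powi (m - n)) *\<^sub>C x"
    by (intro integral_bounded_linear[OF bounded_linear_scaleC_left] integrable_circle_continuous
        continuous_on_circle_powi)
  finally show ?thesis by (simp add: integral_circle_powi)
qed

lemma circle_powi_H2: "0 \<le> n \<Longrightarrow> (\<lambda>z. (z powi n) *\<^sub>C x) \<in> H2"
  by (auto simp: H2_def circle_powi_L2 fourier_coeff_monomial)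

lemma fourier_coeff_unique:
  fixes f :: "complex \<Rightarrow> 'h::fd_chilbert"
  assumes f: "f \<in> L2" and zero: "\<And>n. fourier_coeff f n = 0"
  shows "AE z in circle_measure. f z = 0"
proof -
  note fi = L2_integrable[OF f]
  have "(LINT z|circle_measure. p z *\<^sub>C f z) = 0" if "trig_poly p" for p
    using that
  proof (induction rule: trig_poly.induct)
    case (monomial c n)
    have "(LINT z|circle_measure. (c * z powi n) *\<^sub>C f z)
        = (LINT z|circle_measure. c *\<^sub>C ((z powi n) *\<^sub>C f z))"
      by (simp add: scaleC_scaleC)
    also have "\<dots> = c *\<^sub>C fourier_coeff f (- n)"
      unfolding fourier_coeff_def
      using integral_bounded_linear[OF bounded_linear_scaleC
          integrable_continuous_scaleC[OF fi continuous_on_circle_powi]] by simp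
    finally show ?case by (simp add: zero)
  next
    case (add p q)
    have "integrable circle_measure (\<lambda>z. p z *\<^sub>C f z)" "integrable circle_measure (\<lambda>z. q z *\<^sub>C f z)"
      using add.hyps by (auto intro!: integrable_continuous_scaleC fi trig_poly_continuous)
    then show ?case using add.IH by (simp add: scaleC_add_left)
  next
    case (cong p q)
    have "(LINT z|circle_measure. q z *\<^sub>C f z) = (LINT z|circle_measure. p z *\<^sub>C f z)"
      by (rule Bochner_Integration.integral_cong) (simp_all add: cong.hyps)
    then show ?case using cong.IH by simp
  qed
  then have "AE z in circle_measure. norm (f z) \<le> real DIM('h) * 0"
    by (intro AE_bounded_by_duality[OF fi]) auto
  then show ?thesis by simp
qed

text \<open>In place of Parseval's identity, \<open>g\<close> is projected onto the Hardy space. The projection has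
  no negative Fourier coefficients, and its other ones are those of \<open>g\<close>. So it vanishes, which
  says that \<open>g\<close> is orthogonal to the Hardy space.\<close>

lemma H2_orthogonal:
  assumes f: "f \<in> H2" and g: "g \<in> L2" and g0: "\<And>n. 0 \<le> n \<Longrightarrow> fourier_coeff g n = 0"
  shows "L2_inner g f = 0"
proof -
  let ?p = "P_plus g"
  note sub = negative_monomials_L2
  have p: "?p \<in> H2" unfolding H2_eq_perp by (rule orth_proj_in[OF sub g])
  then have pL2: "?p \<in> L2" by (rule H2_L2)
  have orth: "L2_inner (\<lambda>z. g z - ?p z) h = 0" if "h \<in> H2" for h
    using orth_proj_orthogonal[OF sub g] that unfolding H2_eq_perp .
  have "fourier_coeff ?p n = 0" for n
  proof (cases "n < 0")
    case False
    then have "n \<ge> 0" by simp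
    have "L2_inner ?p (\<lambda>z. (z powi n) *\<^sub>C x) = 0" for x
    proof -
      have "L2_inner g (\<lambda>z. (z powi n) *\<^sub>C x) = 0"
        using g0[OF \<open>n \<ge> 0\<close>] fourier_coeff_eq_0_iff[OF g] by blast
      then show ?thesis
        using orth[OF circle_powi_H2[OF \<open>n \<ge> 0\<close>], of x]
          L2_inner_diff_left[OF g pL2 circle_powi_L2] by simp
    qed
    then show ?thesis using fourier_coeff_eq_0_iff[OF pL2] by blast
  qed (use H2_fourier[OF p] in simp)
  then have "AE z in circle_measure. ?p z = 0"
    by (intro fourier_coeff_unique pL2)
  then have "L2_inner ?p f = L2_inner (\<lambda>z. 0) f"
    by (intro L2_inner_cong_AE L2_measurable pL2 H2_L2[OF f]) auto
  then show ?thesis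
    using orth[OF f] L2_inner_diff_left[OF g pL2 H2_L2[OF f]] by (simp add: L2_inner_def)
qed

lemma norm_fourier_coeff_le:
  assumes f: "f \<in> L2"
  shows "norm (fourier_coeff f n) \<le> (LINT z|circle_measure. norm (f z))"
proof -
  have "norm (fourier_coeff f n) \<le> (LINT z|circle_measure. norm ((z powi (- n)) *\<^sub>C f z))"
    unfolding fourier_coeff_def by (rule integral_norm_bound)
  also have "\<dots> = (LINT z|circle_measure. norm (f z))"
    by (rule Bochner_Integration.integral_cong) auto
  finally show ?thesis .
qed

lemma summable_fourier_power:
  assumes f: "f \<in> L2" and r: "0 \<le> r" "r < 1"
  shows "summable (\<lambda>n. r ^ n * norm (fourier_coeff f (g n)))"
proof (rule summable_comparison_test')
  show "summable (\<lambda>n. r ^ n * (LINT z|circle_measure. norm (f z)))"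
    using r by (intro summable_mult2 summable_geometric) auto
  show "norm (r ^ n * norm (fourier_coeff f (g n))) \<le> r ^ n * (LINT z|circle_measure. norm (f z))" for n
    using r norm_fourier_coeff_le[OF f, of "g n"] by (auto intro!: mult_left_mono simp: abs_mult)
qed

section \<open>Bounded analytic functions have bounded boundary values\<close>

lemma integral_power_series_circle:
  fixes c :: "nat \<Rightarrow> 'h::fd_chilbert"
  assumes c: "summable (\<lambda>n. norm (c n))"
  shows "integrable circle_measure (\<lambda>z. (z powi k) *\<^sub>C (\<Sum>n. z ^ n *\<^sub>C c n))"
    and "(LINT z|circle_measure. (z powi k) *\<^sub>C (\<Sum>n. z ^ n *\<^sub>C c n))
      = (if k \<le> 0 then c (nat (- k)) else 0)"
proof -
  let ?t = "\<lambda>n z. (z powi (k + int n)) *\<^sub>C c n"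
  have t_int: "integrable circle_measure (?t n)" for n
    by (intro L2_integrable circle_powi_L2)
  have t_norm: "norm (?t n z) = norm (c n)" if "z \<in> sphere 0 1" for n z
    using that by simp
  have AE_sum: "AE z in circle_measure. summable (\<lambda>n. norm (?t n z))"
    using AE_circle_sphere by eventually_elim (simp only: t_norm c)
  have "(LINT z|circle_measure. norm (?t n z)) = norm (c n)" for n
    by (subst Bochner_Integration.integral_cong[OF refl t_norm]) auto
  then have sum_int: "summable (\<lambda>n. LINT z|circle_measure. norm (?t n z))"
    by (simp only: c)
  have eq: "(z powi k) *\<^sub>C (\<Sum>n. z ^ n *\<^sub>C c n) = (\<Sum>n. ?t n z)" if z: "z \<in> sphere 0 1" for z
  proof -
    have "summable (\<lambda>n. z ^ n *\<^sub>C c n)"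
      by (rule summable_norm_cancel) (use z c in \<open>simp add: norm_power\<close>)
    then have "(z powi k) *\<^sub>C (\<Sum>n. z ^ n *\<^sub>C c n) = (\<Sum>n. (z powi k) *\<^sub>C (z ^ n *\<^sub>C c n))"
      by (rule bounded_linear.suminf[OF bounded_linear_scaleC])
    then show ?thesis
      by (simp add: scaleC_scaleC circle_powi_add[OF z])
  qed
  have "integrable circle_measure (\<lambda>z. \<Sum>n. ?t n z)"
    by (rule integrable_suminf[OF t_int AE_sum sum_int])
  then show "integrable circle_measure (\<lambda>z. (z powi k) *\<^sub>C (\<Sum>n. z ^ n *\<^sub>C c n))"
    by (subst Bochner_Integration.integrable_cong[OF refl eq]) auto
  have "(LINT z|circle_measure. (z powi k) *\<^sub>C (\<Sum>n. z ^ n *\<^sub>C c n))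
      = (LINT z|circle_measure. (\<Sum>n. ?t n z))"
    by (rule Bochner_Integration.integral_cong) (auto simp: eq)
  also have "\<dots> = (\<Sum>n. LINT z|circle_measure. ?t n z)"
    by (rule integral_suminf[OF t_int AE_sum sum_int])
  also have "(\<lambda>n. LINT z|circle_measure. ?t n z) = (\<lambda>n. if k + int n = 0 then c n else 0)"
    using fourier_coeff_monomial[of "k + int n" "c n" 0 for n]
    by (simp add: fourier_coeff_def fun_eq_iff)
  also have "(\<Sum>n. if k + int n = 0 then c n else 0) = (if k \<le> 0 then c (nat (- k)) else 0)"
  proof (cases "k \<le> 0")
    case True
    then have "(\<lambda>n. if k + int n = 0 then c n else 0) = (\<lambda>n. if n = nat (- k) then c n else 0)"
      by (auto simp: fun_eq_iff)
    then show ?thesis using True sums_single[of "nat (- k)" c] by (simp add: sums_iff)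
  next
    case False
    then have "(\<lambda>n. if k + int n = 0 then c n else 0) = (\<lambda>n. 0)" by (auto simp: fun_eq_iff)
    then show ?thesis using False by simp
  qed
  finally show "(LINT z|circle_measure. (z powi k) *\<^sub>C (\<Sum>n. z ^ n *\<^sub>C c n))
      = (if k \<le> 0 then c (nat (- k)) else 0)" .
qed

text \<open>The radial dilates \<open>\<lambda>z. disc_ext f (r * z)\<close> are bounded by \<open>M\<close>, and their integrals against a
  trigonometric polynomial converge to those of \<open>f\<close> as \<open>r\<close> increases to one, because only
  finitely many Fourier coefficients are involved. So \<open>f\<close> inherits the bound by duality.\<close>

lemma H2_bounded_if_disc_ext_bounded:
  fixes f :: "complex \<Rightarrow> 'h::fd_chilbert"
  assumes f: "f \<in> H2" and M: "\<And>w. cmod w < 1 \<Longrightarrow> norm (disc_ext f w) \<le> M"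
  shows "AE z in circle_measure. norm (f z) \<le> real DIM('h) * M"
proof -
  note fL2 = H2_L2[OF f]
  note fi = L2_integrable[OF fL2]
  have "M \<ge> 0" by (rule order_trans[OF norm_ge_zero M[of 0]]) simp
  define r where "r j = 1 - 1 / real (j + 2)" for j
  have r: "0 \<le> r j" "r j < 1" for j by (auto simp: r_def field_simps)
  have rlim: "r \<longlonglongrightarrow> 1"
  proof -
    have "(\<lambda>j. 1 / real (j + 2)) \<longlonglongrightarrow> 0"
      using LIMSEQ_ignore_initial_segment[OF lim_1_over_n, of 2] by simp
    from tendsto_diff[OF tendsto_const[of 1] this] show ?thesis by (simp add: r_def[abs_def])
  qed
  define c where "c j n = complex_of_real (r j ^ n) *\<^sub>C fourier_coeff f (int n)" for j n
  have csum: "summable (\<lambda>n. norm (c j n))" for j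
    using summable_fourier_power[OF fL2 r, of j int] r by (simp add: c_def norm_power)
  define F where "F j z = (\<Sum>n. z ^ n *\<^sub>C c j n)" for j z
  have F_disc: "F j z = disc_ext f (complex_of_real (r j) * z)" for j z
    by (simp add: F_def disc_ext_def c_def scaleC_scaleC power_mult_distrib mult.commute)
  have F_le: "norm (F j z) \<le> M" if "z \<in> sphere 0 1" for j z
    unfolding F_disc using that r by (intro M) (simp add: norm_mult)
  have F_int: "integrable circle_measure (F j)" for j
    using integral_power_series_circle(1)[OF csum, of 0 j] by (simp add: F_def[abs_def])
  have lim: "(\<lambda>j. LINT z|circle_measure. p z *\<^sub>C F j z) \<longlonglongrightarrow> (LINT z|circle_measure. p z *\<^sub>C f z)"
    if "trig_poly p" for p
    using that
  proof (induction rule: trig_poly.induct)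
    case (monomial d k)
    have split: "(LINT z|circle_measure. (d * z powi k) *\<^sub>C h z)
        = d *\<^sub>C (LINT z|circle_measure. (z powi k) *\<^sub>C h z)"
      if "integrable circle_measure h" for h :: "complex \<Rightarrow> 'h"
      using integral_bounded_linear[OF bounded_linear_scaleC
          integrable_continuous_scaleC[OF that continuous_on_circle_powi], of d k]
      by (simp add: scaleC_scaleC)
    have "(\<lambda>j. LINT z|circle_measure. (z powi k) *\<^sub>C F j z)
        \<longlonglongrightarrow> (LINT z|circle_measure. (z powi k) *\<^sub>C f z)"
    proof (cases "k \<le> 0")
      case True
      have "(\<lambda>j. c j (nat (- k))) \<longlonglongrightarrow> complex_of_real (1 ^ nat (- k)) *\<^sub>C fourier_coeff f (int (nat (- k)))"
        unfolding c_def
        by (intro bounded_linear.tendsto[OF bounded_linear_scaleC_left] tendsto_of_real tendsto_power rlim)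
      then show ?thesis
        using True unfolding F_def integral_power_series_circle(2)[OF csum]
        by (simp add: fourier_coeff_def)
    next
      case False
      have "fourier_coeff f (- k) = 0" using False by (intro H2_fourier[OF f]) simp
      then show ?thesis
        using False unfolding F_def integral_power_series_circle(2)[OF csum]
        by (simp add: fourier_coeff_def)
    qed
    then show ?case
      unfolding split[OF F_int] split[OF fi]
      by (rule bounded_linear.tendsto[OF bounded_linear_scaleC])
  next
    case (add p q)
    have split: "(LINT z|circle_measure. (p z + q z) *\<^sub>C h z)
        = (LINT z|circle_measure. p z *\<^sub>C h z) + (LINT z|circle_measure. q z *\<^sub>C h z)"
      if "integrable circle_measure h" for h :: "complex \<Rightarrow> 'h"
      unfolding scaleC_add_left using add.hyps
      by (intro Bochner_Integration.integral_add integrable_continuous_scaleC that trig_poly_continuous)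
    show ?case
      unfolding split[OF F_int] split[OF fi] by (intro tendsto_add add.IH)
  next
    case (cong p q)
    have "(LINT z|circle_measure. q z *\<^sub>C h z) = (LINT z|circle_measure. p z *\<^sub>C h z)"
      for h :: "complex \<Rightarrow> 'h"
      by (rule Bochner_Integration.integral_cong) (simp_all add: cong.hyps)
    then show ?case using cong.IH by simp
  qed
  show ?thesis
  proof (rule AE_bounded_by_duality[OF fi \<open>M \<ge> 0\<close>])
    fix p assume p: "trig_poly p"
    have "norm (LINT z|circle_measure. p z *\<^sub>C F j z) \<le> M * (LINT z|circle_measure. cmod (p z))" for j
    proof -
      have "norm (LINT z|circle_measure. p z *\<^sub>C F j z) \<le> (LINT z|circle_measure. norm (p z *\<^sub>C F j z))"
        by (rule integral_norm_bound)
      also have "\<dots> \<le> (LINT z|circle_measure. M * cmod (p z))"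
      proof (rule integral_mono)
        show "integrable circle_measure (\<lambda>z. norm (p z *\<^sub>C F j z))"
          by (intro integrable_norm integrable_continuous_scaleC F_int trig_poly_continuous p)
        show "integrable circle_measure (\<lambda>z. M * cmod (p z))"
          by (intro integrable_mult_right integrable_norm integrable_circle_continuous
              trig_poly_continuous p)
        show "norm (p z *\<^sub>C F j z) \<le> M * cmod (p z)" if "z \<in> space circle_measure" for z
          using F_le[of z j] that by (simp add: mult.commute[of M] mult_left_mono)
      qed
      finally show ?thesis by simp
    qed
    then show "norm (LINT z|circle_measure. p z *\<^sub>C f z) \<le> M * (LINT z|circle_measure. cmod (p z))"
      by (intro LIMSEQ_le_const2[OF tendsto_norm[OF lim[OF p]]]) auto
  qed
qed

section \<open>The Poisson kernel\<close>

definition poisson_kernel :: "complex \<Rightarrow> complex \<Rightarrow> real" where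
  "poisson_kernel w z = Re ((1 + w * cnj z) / (1 - w * cnj z))"

lemma poisson_kernel_nonneg:
  assumes "cmod w < 1" "z \<in> sphere 0 1"
  shows "0 \<le> poisson_kernel w z"
proof -
  define x where "x = w * cnj z"
  have "cmod x < 1" using assms by (simp add: x_def norm_mult)
  have "(1 + x) / (1 - x) = (1 + x) * cnj (1 - x) / complex_of_real ((cmod (1 - x))\<^sup>2)"
    by (rule complex_div_cnj)
  then have "Re ((1 + x) / (1 - x)) = Re ((1 + x) * cnj (1 - x)) / (cmod (1 - x))\<^sup>2"
    by (simp only: Re_divide_of_real)
  also have "Re ((1 + x) * cnj (1 - x)) = 1 - (cmod x)\<^sup>2"
    unfolding cmod_power2 by (simp add: power2_eq_square algebra_simps)
  also have "(1 - (cmod x)\<^sup>2) / (cmod (1 - x))\<^sup>2 \<ge> 0"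
    using \<open>cmod x < 1\<close> by (intro divide_nonneg_nonneg) (auto simp: abs_square_le_1 power_le_one)
  finally show ?thesis by (simp add: poisson_kernel_def x_def)
qed

text \<open>For \<open>s = 1\<close> this is the Cauchy kernel, which reproduces \<open>disc_ext f\<close>; for \<open>s = - 1\<close> the kernel picks
  up the coefficients with nonpositive index. The Poisson kernel combines the two.\<close>

lemma integral_geometric_kernel:
  fixes f :: "complex \<Rightarrow> 'h::fd_chilbert"
  assumes f: "f \<in> L2" and w: "cmod w < 1" and s: "s = 1 \<or> s = - 1"
  shows "(\<lambda>n. w ^ n *\<^sub>C fourier_coeff f (s * int n)) sums
    (LINT z|circle_measure. (1 / (1 - w * z powi (- s))) *\<^sub>C f z)"
proof -
  let ?t = "\<lambda>n z. (w ^ n * z powi (- (s * int n))) *\<^sub>C f z"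
  note fi = L2_integrable[OF f]
  have t_int: "integrable circle_measure (?t n)" for n
    by (intro integrable_continuous_scaleC fi continuous_intros continuous_on_circle_powi)
  have t_norm: "norm (?t n z) = cmod w ^ n * norm (f z)" if "z \<in> sphere 0 1" for n z
    using that by (simp add: norm_mult norm_power)
  have AE_sum: "AE z in circle_measure. summable (\<lambda>n. norm (?t n z))"
    using AE_circle_sphere
    by eventually_elim (simp only: t_norm, use w in \<open>intro summable_mult2 summable_geometric, simp\<close>)
  have "(LINT z|circle_measure. norm (?t n z)) = cmod w ^ n * (LINT z|circle_measure. norm (f z))" for n
    by (subst Bochner_Integration.integral_cong[OF refl t_norm]) auto
  then have sum_int: "summable (\<lambda>n. LINT z|circle_measure. norm (?t n z))"
    using w by (simp add: summable_mult2)
  have t_fc: "(LINT z|circle_measure. ?t n z) = w ^ n *\<^sub>C fourier_coeff f (s * int n)" for n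
    using integral_bounded_linear[OF bounded_linear_scaleC
        integrable_continuous_scaleC[OF fi continuous_on_circle_powi], of "w ^ n" "- (s * int n)"]
    by (simp add: fourier_coeff_def scaleC_scaleC)
  have eq: "(\<Sum>n. ?t n z) = (1 / (1 - w * z powi (- s))) *\<^sub>C f z" if z: "z \<in> sphere 0 1" for z
  proof -
    have le: "cmod (w * z powi (- s)) < 1" using w z by (simp add: norm_mult)
    have "(w * z powi (- s)) ^ n = w ^ n * z powi (- (s * int n))" for n
      using power_int_mult[of z "- s" "int n"] by (simp add: power_mult_distrib)
    then have "(\<lambda>n. w ^ n * z powi (- (s * int n))) sums (1 / (1 - w * z powi (- s)))"
      using geometric_sums[OF le] by simp
    then have "(\<lambda>n. ?t n z) sums ((1 / (1 - w * z powi (- s))) *\<^sub>C f z)"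
      by (rule bounded_linear.sums[OF bounded_linear_scaleC_left])
    then show ?thesis by (rule sums_unique[symmetric])
  qed
  have "(\<lambda>n. LINT z|circle_measure. ?t n z) sums (LINT z|circle_measure. (\<Sum>n. ?t n z))"
    by (rule sums_integral[OF t_int AE_sum sum_int])
  also have "(LINT z|circle_measure. (\<Sum>n. ?t n z))
      = (LINT z|circle_measure. (1 / (1 - w * z powi (- s))) *\<^sub>C f z)"
    by (rule Bochner_Integration.integral_cong) (auto simp: eq)
  finally show ?thesis by (simp only: t_fc)
qed

text \<open>The Poisson kernel is \<open>1 / (1 - w z\<inverse>) + 1 / (1 - cnj w z) - 1\<close> on the circle. The first summand
  gives \<open>disc_ext f w\<close>; the negative Fourier coefficients of \<open>f\<close> being zero, the other two both
  contribute the constant term and cancel.\<close>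

lemma poisson_formula:
  fixes f :: "complex \<Rightarrow> 'h::fd_chilbert"
  assumes f: "f \<in> H2" and w: "cmod w < 1"
  shows "(LINT z|circle_measure. poisson_kernel w z *\<^sub>R f z) = disc_ext f w"
    and "integrable circle_measure (\<lambda>z. poisson_kernel w z *\<^sub>R f z)"
proof -
  note fL2 = H2_L2[OF f]
  note fi = L2_integrable[OF fL2]
  let ?k1 = "\<lambda>z. 1 / (1 - w * z powi (- 1))" and ?k2 = "\<lambda>z. 1 / (1 - cnj w * z powi (- (- 1)))"
  have nz: "1 - v * z powi n \<noteq> 0" if "cmod v < 1" "z \<in> sphere 0 1" for v z n
  proof
    assume "1 - v * z powi n = 0"
    then have "cmod (v * z powi n) = 1" by (metis eq_iff_diff_eq_0 norm_one)
    then show False using that by (simp add: norm_mult)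
  qed
  have w': "cmod (cnj w) < 1" using w by simp
  have int1: "integrable circle_measure (\<lambda>z. ?k1 z *\<^sub>C f z)"
    using nz[OF w] by (intro integrable_continuous_scaleC fi continuous_intros continuous_on_circle_powi) blast
  have int2: "integrable circle_measure (\<lambda>z. ?k2 z *\<^sub>C f z)"
    using nz[OF w'] by (intro integrable_continuous_scaleC fi continuous_intros continuous_on_circle_powi) blast
  have kernel: "poisson_kernel w z *\<^sub>R f z = ?k1 z *\<^sub>C f z + ?k2 z *\<^sub>C f z - f z"
    if z: "z \<in> sphere 0 1" for z
  proof -
    define x where "x = w * cnj z"
    have "z powi (- 1) = cnj z" using cnj_circle_powi[OF z, of 1] by simp
    then have k1: "?k1 z = 1 / (1 - x)" and k2: "?k2 z = cnj (1 / (1 - x))"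
      unfolding x_def by (simp_all only:) (simp_all)
    have "1 - x \<noteq> 0" using nz[OF w z, of "-1"] \<open>z powi (- 1) = cnj z\<close> by (simp only: x_def) simp
    then have "(1 + x) / (1 - x) = 2 * (1 / (1 - x)) - 1" by (simp add: field_simps)
    then have "Re ((1 + x) / (1 - x)) = Re (complex_of_real 2 * (1 / (1 - x)) - 1)" by simp
    then have "Re ((1 + x) / (1 - x)) = 2 * Re (1 / (1 - x)) - 1"
      by (simp only: minus_complex.sel Re_complex_of_real times_complex.sel Im_complex_of_real one_complex.sel)
    moreover have "complex_of_real (2 * Re a - 1) = a + cnj a - 1" for a
      by (simp add: complex_add_cnj)
    ultimately have pk: "complex_of_real (poisson_kernel w z) = ?k1 z + ?k2 z - 1"
      unfolding k1 k2 poisson_kernel_def x_def[symmetric] by (simp only:)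
    have "?k1 z *\<^sub>C f z + ?k2 z *\<^sub>C f z - f z = (?k1 z + ?k2 z + (- 1)) *\<^sub>C f z"
      by (simp only: scaleC_add_left flip: minus_conv_scaleC) simp
    then show ?thesis by (simp only: scaleR_scaleC pk) simp
  qed
  show "integrable circle_measure (\<lambda>z. poisson_kernel w z *\<^sub>R f z)"
    by (subst Bochner_Integration.integrable_cong[OF refl kernel]) (use int1 int2 fi in auto)
  have "(LINT z|circle_measure. poisson_kernel w z *\<^sub>R f z)
      = (LINT z|circle_measure. ?k1 z *\<^sub>C f z + ?k2 z *\<^sub>C f z - f z)"
    by (rule Bochner_Integration.integral_cong) (auto simp: kernel)
  also have "\<dots> = (LINT z|circle_measure. ?k1 z *\<^sub>C f z) + (LINT z|circle_measure. ?k2 z *\<^sub>C f z)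
      - fourier_coeff f 0"
    using int1 int2 fi by (simp add: fourier_coeff_def)
  also have "(LINT z|circle_measure. ?k1 z *\<^sub>C f z) = disc_ext f w"
    using integral_geometric_kernel[OF fL2 w, of 1] by (simp add: disc_ext_def sums_iff)
  also have "(LINT z|circle_measure. ?k2 z *\<^sub>C f z) = fourier_coeff f 0"
  proof -
    have "(\<lambda>n. cnj w ^ n *\<^sub>C fourier_coeff f (- 1 * int n)) = (\<lambda>n. if n = 0 then fourier_coeff f 0 else 0)"
      using H2_fourier[OF f] by (auto simp: fun_eq_iff)
    with integral_geometric_kernel[OF fL2 w' disjI2[OF refl]]
    have "(\<lambda>n. if n = 0 then fourier_coeff f 0 else 0) sums (LINT z|circle_measure. ?k2 z *\<^sub>C f z)"
      by (simp only:)
    from sums_unique2[OF this sums_single[of 0 "\<lambda>_. fourier_coeff f 0"]] show ?thesis .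
  qed
  finally show "(LINT z|circle_measure. poisson_kernel w z *\<^sub>R f z) = disc_ext f w" by simp
qed

lemma disc_ext_bounded_if_H2_bounded:
  fixes f :: "complex \<Rightarrow> 'h::fd_chilbert"
  assumes f: "f \<in> H2" and M: "AE z in circle_measure. norm (f z) \<le> M" and w: "cmod w < 1"
  shows "norm (disc_ext f w) \<le> M"
proof -
  \<comment> \<open>The formula for the constant function one says that the kernel has integral one.\<close>
  have one: "(\<lambda>z. 1::complex) \<in> H2"
    using circle_powi_H2[of 0 "1::complex"] by simp
  have disc_one: "disc_ext (\<lambda>z. 1::complex) w = 1"
  proof -
    have "fourier_coeff (\<lambda>z. 1::complex) n = (if n = 0 then 1 else 0)" for n
      using fourier_coeff_monomial[of 0 "1::complex" n] by simp
    then have "(\<lambda>n. w ^ n *\<^sub>C fourier_coeff (\<lambda>z. 1::complex) (int n)) = (\<lambda>n. if n = 0 then 1 else 0)"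
      by (auto simp: fun_eq_iff)
    then show ?thesis
      using sums_single[of 0 "\<lambda>_. 1::complex"] by (simp add: disc_ext_def sums_iff)
  qed
  have pint: "integrable circle_measure (poisson_kernel w)"
    using integrable_Re[OF poisson_formula(2)[OF one w]] by simp
  have "complex_of_real (LINT z|circle_measure. poisson_kernel w z) = 1"
    using poisson_formula(1)[OF one w] disc_one
    by (simp add: scaleR_conv_of_real)
  then have p1: "(LINT z|circle_measure. poisson_kernel w z) = 1" by simp
  have "norm (disc_ext f w) \<le> (LINT z|circle_measure. norm (poisson_kernel w z *\<^sub>R f z))"
    unfolding poisson_formula(1)[OF f w, symmetric] by (rule integral_norm_bound)
  also have "\<dots> \<le> (LINT z|circle_measure. M * poisson_kernel w z)"
  proof (rule integral_mono_AE)
    show "integrable circle_measure (\<lambda>z. norm (poisson_kernel w z *\<^sub>R f z))"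
      by (intro integrable_norm poisson_formula(2) f w)
    show "integrable circle_measure (\<lambda>z. M * poisson_kernel w z)" using pint by simp
    show "AE z in circle_measure. norm (poisson_kernel w z *\<^sub>R f z) \<le> M * poisson_kernel w z"
      using M AE_circle_sphere
    proof eventually_elim
      case (elim z)
      then show ?case
        using poisson_kernel_nonneg[OF w elim(2)]
        by (simp add: mult.commute[of M] mult_left_mono)
    qed
  qed
  also have "\<dots> = M" using p1 by simp
  finally show ?thesis .
qed

text \<open>Boundedness is thereby expressed by boundary values, on which the conjugations act.\<close>

lemma Hinf_iff:
  "f \<in> Hinf \<longleftrightarrow> f \<in> H2 \<and> (\<exists>M. AE z in circle_measure. norm (f z) \<le> M)"
proof
  assume "f \<in> Hinf"
  then have f: "f \<in> H2" and "bounded (disc_ext f ` ball 0 1)" by (auto simp: Hinf_def)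
  then obtain M where "\<forall>w\<in>ball 0 1. norm (disc_ext f w) \<le> M" by (auto simp: bounded_iff)
  then show "f \<in> H2 \<and> (\<exists>M. AE z in circle_measure. norm (f z) \<le> M)"
    using H2_bounded_if_disc_ext_bounded[OF f, of M] f by auto
next
  assume "f \<in> H2 \<and> (\<exists>M. AE z in circle_measure. norm (f z) \<le> M)"
  then show "f \<in> Hinf"
    using disc_ext_bounded_if_H2_bounded[of f] by (fastforce simp: Hinf_def bounded_iff)
qed

section \<open>Operator valued symbols\<close>

text \<open>This class of symbols, unlike \<open>Hinf_op\<close>, is stable under pointwise adjoints and under conjugating
  the argument separately.\<close>

definition measurable_symbol :: "(complex \<Rightarrow> 'h::fd_chilbert \<Rightarrow> 'h) \<Rightarrow> bool" where
  "measurable_symbol \<Phi> \<longleftrightarrow> (\<forall>z\<in>sphere 0 1. clinear (\<Phi> z)) \<and>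
     (\<forall>x. (\<lambda>z. \<Phi> z x) \<in> borel_measurable circle_measure)"

definition unitary_symbol :: "(complex \<Rightarrow> 'h::fd_chilbert \<Rightarrow> 'h) \<Rightarrow> bool" where
  "unitary_symbol \<Theta> \<longleftrightarrow> measurable_symbol \<Theta> \<and> (AE z in circle_measure. unitary_op (\<Theta> z))"

lemma measurable_symbol_clinear: "measurable_symbol \<Phi> \<Longrightarrow> z \<in> sphere 0 1 \<Longrightarrow> clinear (\<Phi> z)"
  by (simp add: measurable_symbol_def)

lemma unitary_symbol_measurable: "unitary_symbol \<Theta> \<Longrightarrow> measurable_symbol \<Theta>"
  and unitary_symbol_AE: "unitary_symbol \<Theta> \<Longrightarrow> AE z in circle_measure. unitary_op (\<Theta> z)"
  by (auto simp: unitary_symbol_def)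

lemma L2_op_measurable_symbol: "\<Phi> \<in> L2_op \<Longrightarrow> measurable_symbol \<Phi>"
  by (simp add: L2_op_def measurable_symbol_def)

lemma pure_inner_unitary_symbol: "pure_inner \<Theta> \<Longrightarrow> unitary_symbol \<Theta>"
  by (simp add: pure_inner_def inner_fun_def Hinf_op_def unitary_symbol_def L2_op_measurable_symbol)

lemma measurable_symbol_apply:
  fixes \<Phi> :: "complex \<Rightarrow> 'h::fd_chilbert \<Rightarrow> 'h"
  assumes \<Phi>: "measurable_symbol \<Phi>" and [measurable]: "f \<in> borel_measurable circle_measure"
  shows "(\<lambda>z. \<Phi> z (f z)) \<in> borel_measurable circle_measure"
proof -
  have eq: "\<Phi> z (f z) = (\<Sum>b\<in>Basis. inner (f z) b *\<^sub>R \<Phi> z b)" if "z \<in> space circle_measure" for z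
  proof -
    have lin: "linear (\<Phi> z)"
      using that measurable_symbol_clinear[OF \<Phi>] by (intro clinear_linear) auto
    have "\<Phi> z (f z) = \<Phi> z (\<Sum>b\<in>Basis. inner (f z) b *\<^sub>R b)"
      by (simp add: euclidean_representation)
    also have "\<dots> = (\<Sum>b\<in>Basis. inner (f z) b *\<^sub>R \<Phi> z b)"
      by (simp add: linear_sum[OF lin] linear_scale[OF lin])
    finally show ?thesis .
  qed
  have "(\<lambda>z. \<Sum>b\<in>Basis. inner (f z) b *\<^sub>R \<Phi> z b) \<in> borel_measurable circle_measure"
  proof -
    have [measurable]: "(\<lambda>z. \<Phi> z b) \<in> borel_measurable circle_measure" for b
      using \<Phi> by (simp add: measurable_symbol_def)
    show ?thesis by measurable
  qed
  then show ?thesis by (subst measurable_cong[OF eq])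
qed

lemma measurable_symbol_cnj: "measurable_symbol \<Phi> \<Longrightarrow> measurable_symbol (\<lambda>z. \<Phi> (cnj z))"
  by (auto simp: measurable_symbol_def intro: measurable_circle_cnj)

lemma measurable_symbol_cadjoint:
  fixes \<Phi> :: "complex \<Rightarrow> 'h::fd_chilbert \<Rightarrow> 'h"
  assumes \<Phi>: "measurable_symbol \<Phi>"
  shows "measurable_symbol (\<lambda>z. cadjoint (\<Phi> z))"
  unfolding measurable_symbol_def
proof (intro conjI ballI allI)
  fix x
  have eq: "cadjoint (\<Phi> z) x = (\<Sum>b\<in>Basis. inner (\<Phi> z b) x *\<^sub>R b)" if "z \<in> space circle_measure" for z
  proof -
    have "clinear (\<Phi> z)" using that measurable_symbol_clinear[OF \<Phi>] by auto
    then have "inner (\<Phi> z b) x = inner (cadjoint (\<Phi> z) x) b" for b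
      by (simp add: inner_Re_cinner cinner_cadjoint) (metis cinner_commute complex_cnj(1) complex.sel(1) complex.collapse)
    then show ?thesis by (simp add: euclidean_representation)
  qed
  have "(\<lambda>z. \<Sum>b\<in>Basis. inner (\<Phi> z b) x *\<^sub>R b) \<in> borel_measurable circle_measure"
  proof -
    have [measurable]: "(\<lambda>z. \<Phi> z b) \<in> borel_measurable circle_measure" for b
      using \<Phi> by (simp add: measurable_symbol_def)
    show ?thesis by measurable
  qed
  then show "(\<lambda>z. cadjoint (\<Phi> z) x) \<in> borel_measurable circle_measure"
    by (subst measurable_cong[OF eq])
qed (use \<Phi> measurable_symbol_clinear clinear_cadjoint in blast)

lemma measurable_symbol_tilde: "measurable_symbol \<Phi> \<Longrightarrow> measurable_symbol (tilde \<Phi>)"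
  using measurable_symbol_cnj[OF measurable_symbol_cadjoint] by (simp add: tilde_def[abs_def])

lemma unitary_symbol_tilde:
  assumes "unitary_symbol \<Theta>"
  shows "unitary_symbol (tilde \<Theta>)"
proof -
  have "AE z in circle_measure. unitary_op (\<Theta> (cnj z))"
    by (rule AE_circle_cnj[OF unitary_symbol_AE[OF assms]])
  then have "AE z in circle_measure. unitary_op (tilde \<Theta> z)"
    by eventually_elim (simp add: tilde_def unitary_op_cadjoint)
  then show ?thesis
    using assms by (simp add: unitary_symbol_def measurable_symbol_tilde)
qed

lemma L2_norm_eq:
  assumes "f \<in> L2" "g \<in> borel_measurable circle_measure"
    and "AE z in circle_measure. norm (g z) = norm (f z)"
  shows "g \<in> L2"
proof (rule L2_dominated[OF assms(2) L2_integrable_sq[OF assms(1)]])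
  show "AE z in circle_measure. (norm (g z))\<^sup>2 \<le> (norm (f z))\<^sup>2"
    using assms(3) by eventually_elim simp
qed

lemma unitary_symbol_L2:
  assumes \<Theta>: "unitary_symbol \<Theta>" and f: "f \<in> L2"
  shows "(\<lambda>z. \<Theta> z (f z)) \<in> L2"
proof (rule L2_norm_eq[OF f])
  show "(\<lambda>z. \<Theta> z (f z)) \<in> borel_measurable circle_measure"
    by (rule measurable_symbol_apply[OF unitary_symbol_measurable[OF \<Theta>] L2_measurable[OF f]])
  show "AE z in circle_measure. norm (\<Theta> z (f z)) = norm (f z)"
    using unitary_symbol_AE[OF \<Theta>] by eventually_elim (rule unitary_op_norm)
qed

text \<open>The factor two undoes the halving in \<open>hs_norm\<close>, whose sum runs over a real basis.\<close>

lemma norm_apply_le_hs_norm: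
  assumes A: "clinear A"
  shows "(norm (A x))\<^sup>2 \<le> (norm x)\<^sup>2 * (2 * (hs_norm A)\<^sup>2)"
proof -
  have lin: "linear A" using A by (rule clinear_linear)
  have "A x = A (\<Sum>b\<in>Basis. inner x b *\<^sub>R b)" by (simp add: euclidean_representation)
  also have "\<dots> = (\<Sum>b\<in>Basis. inner x b *\<^sub>R A b)"
    by (simp add: linear_sum[OF lin] linear_scale[OF lin])
  finally have "norm (A x) \<le> (\<Sum>b\<in>Basis. \<bar>inner x b\<bar> * norm (A b))"
    by (simp only:) (rule order_trans[OF norm_sum], simp)
  then have "(norm (A x))\<^sup>2 \<le> (\<Sum>b\<in>Basis. \<bar>inner x b\<bar> * norm (A b))\<^sup>2"
    by (rule power_mono) simp
  also have "\<dots> \<le> (\<Sum>b\<in>Basis. \<bar>inner x b\<bar>\<^sup>2) * (\<Sum>b\<in>Basis. (norm (A b))\<^sup>2)"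
    by (rule Cauchy_Schwarz_ineq_sum)
  also have "(\<Sum>b\<in>Basis. \<bar>inner x b\<bar>\<^sup>2) = (norm x)\<^sup>2"
    unfolding power2_norm_eq_inner by (subst euclidean_inner) (simp add: power2_eq_square)
  also have "(\<Sum>b\<in>Basis. (norm (A b))\<^sup>2) = 2 * (hs_norm A)\<^sup>2"
    by (simp add: hs_norm_def sum_nonneg)
  finally show ?thesis .
qed

lemma L2_op_apply_L2:
  assumes \<Phi>: "\<Phi> \<in> L2_op" and f: "f \<in> borel_measurable circle_measure"
    and M: "AE z in circle_measure. norm (f z) \<le> M"
  shows "(\<lambda>z. \<Phi> z (f z)) \<in> L2"
proof (rule L2_dominated)
  show "(\<lambda>z. \<Phi> z (f z)) \<in> borel_measurable circle_measure"
    by (rule measurable_symbol_apply[OF L2_op_measurable_symbol[OF \<Phi>] f])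
  show "integrable circle_measure (\<lambda>z. M\<^sup>2 * (2 * (hs_norm (\<Phi> z))\<^sup>2))"
    using \<Phi> by (simp add: L2_op_def)
  show "AE z in circle_measure. (norm (\<Phi> z (f z)))\<^sup>2 \<le> M\<^sup>2 * (2 * (hs_norm (\<Phi> z))\<^sup>2)"
    using M AE_circle_sphere
  proof eventually_elim
    case (elim z)
    have "(norm (\<Phi> z (f z)))\<^sup>2 \<le> (norm (f z))\<^sup>2 * (2 * (hs_norm (\<Phi> z))\<^sup>2)"
      using \<Phi> elim(2) by (intro norm_apply_le_hs_norm) (simp add: L2_op_def)
    also have "\<dots> \<le> M\<^sup>2 * (2 * (hs_norm (\<Phi> z))\<^sup>2)"
      using elim(1) by (intro mult_right_mono power_mono) auto
    finally show ?case .
  qed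
qed

lemma L2_cnj:
  assumes "f \<in> L2"
  shows "(\<lambda>z. f (cnj z)) \<in> L2"
  using assms integrable_circle_cnj[OF L2_integrable_sq[OF assms]]
  by (simp add: L2_def measurable_circle_cnj)

lemma L2_conjugation:
  assumes "conjugation J" "f \<in> L2"
  shows "(\<lambda>z. J (f z)) \<in> L2"
  by (rule L2_norm_eq[OF assms(2) conjugation_measurable[OF assms(1) L2_measurable[OF assms(2)]]])
     (simp add: conjugation_norm[OF assms(1)])

lemma L2_cnj_scaleC:
  assumes "f \<in> L2"
  shows "(\<lambda>z. cnj z *\<^sub>C f z) \<in> L2"
proof (rule L2_norm_eq[OF assms])
  have [measurable]: "f \<in> borel_measurable circle_measure" "cnj \<in> borel_measurable circle_measure"
    using L2_measurable[OF assms] by (auto intro!: measurable_circle_continuous continuous_intros)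
  show "(\<lambda>z. cnj z *\<^sub>C f z) \<in> borel_measurable circle_measure" by measurable
qed (auto intro!: AE_I2)

lemma L2_flip: "f \<in> L2 \<Longrightarrow> flip f \<in> L2"
  unfolding flip_def by (rule L2_cnj_scaleC[OF L2_cnj])

lemma flip_flip: "z \<in> sphere 0 1 \<Longrightarrow> flip (flip f) z = f z"
  using complex_norm_square[of z] by (simp add: flip_def scaleC_scaleC mult.commute)

text \<open>This antilinear map reflects the spectrum about \<open>- 1/2\<close>, and so exchanges the Hardy space with its
  orthogonal complement; the flip does the same linearly.\<close>

lemma fourier_coeff_conjugation:
  assumes J: "conjugation J" and h: "h \<in> L2"
  shows "fourier_coeff (\<lambda>z. cnj z *\<^sub>C J (h z)) n = J (fourier_coeff h (- n - 1))"
proof -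
  have "fourier_coeff (\<lambda>z. cnj z *\<^sub>C J (h z)) n = (LINT z|circle_measure. J ((z powi (n + 1)) *\<^sub>C h z))"
    unfolding fourier_coeff_def
  proof (rule Bochner_Integration.integral_cong)
    fix z assume "z \<in> space circle_measure"
    then have z: "z \<in> sphere 0 1" by simp
    have "cnj (z powi (n + 1)) = z powi (- n + - 1)"
      unfolding cnj_circle_powi[OF z] by simp
    also have "\<dots> = z powi (- n) * cnj z"
      using cnj_circle_powi[OF z, of 1] circle_powi_add[OF z, of "- n" "- 1"] by simp
    finally show "(z powi (- n)) *\<^sub>C cnj z *\<^sub>C J (h z) = J ((z powi (n + 1)) *\<^sub>C h z)"
      by (simp only: conjugation_scaleC[OF J] scaleC_scaleC)
  qed simp
  also have "\<dots> = J (LINT z|circle_measure. (z powi (n + 1)) *\<^sub>C h z)"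
    by (intro integral_bounded_linear conjugation_bounded_linear J integrable_continuous_scaleC
        L2_integrable h continuous_on_circle_powi)
  finally show ?thesis by (simp add: fourier_coeff_def add.commute)
qed

lemma fourier_coeff_flip:
  assumes h: "h \<in> L2"
  shows "fourier_coeff (flip h) n = fourier_coeff h (- n - 1)"
proof -
  have "fourier_coeff (flip h) n = (LINT z|circle_measure. (\<lambda>z. (z powi (n + 1)) *\<^sub>C h z) (cnj z))"
    unfolding fourier_coeff_def flip_def
  proof (rule Bochner_Integration.integral_cong)
    fix z assume "z \<in> space circle_measure"
    then have z: "z \<in> sphere 0 1" by simp
    have "cnj z powi (n + 1) = z powi (- n + - 1)"
      using cnj_circle_powi[OF z, of "n + 1"] by simp
    also have "\<dots> = z powi (- n) * cnj z"
      using cnj_circle_powi[OF z, of 1] circle_powi_add[OF z, of "- n" "- 1"] by simp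
    finally show "(z powi (- n)) *\<^sub>C cnj z *\<^sub>C h (cnj z) = (cnj z powi (n + 1)) *\<^sub>C h (cnj z)"
      by (simp only: scaleC_scaleC)
  qed simp
  also have "\<dots> = (LINT z|circle_measure. (z powi (n + 1)) *\<^sub>C h z)"
    by (rule integral_circle_cnj)
       (intro borel_measurable_integrable integrable_continuous_scaleC L2_integrable h continuous_on_circle_powi)
  finally show ?thesis by (simp add: fourier_coeff_def add.commute)
qed

section \<open>Model spaces as annihilators\<close>

text \<open>Adding the condition of membership in the Hardy space to orthogonality turns the model space into a
  plain annihilator in \<open>L2\<close>.\<close>

definition model_annihilated :: "(complex \<Rightarrow> 'h::fd_chilbert \<Rightarrow> 'h) \<Rightarrow> (complex \<Rightarrow> 'h) set" where
  "model_annihilated \<Theta> = negative_monomials \<union> (\<lambda>h z. \<Theta> z (h z)) ` H2"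

lemma model_space_eq_perp: "model_space \<Theta> = L2_perp (model_annihilated \<Theta>)"
  unfolding model_space_def H2_eq_perp[of] model_annihilated_def
  by (auto simp: L2_perp_def H2_eq_perp)

lemma model_annihilated_L2: "unitary_symbol \<Theta> \<Longrightarrow> model_annihilated \<Theta> \<subseteq> L2"
  using negative_monomials_L2 by (auto simp: model_annihilated_def unitary_symbol_L2 H2_L2)

lemma model_space_H2: "f \<in> model_space \<Theta> \<Longrightarrow> f \<in> H2"
  by (simp add: model_space_def)

lemma P_model_in:
  "unitary_symbol \<Theta> \<Longrightarrow> f \<in> L2 \<Longrightarrow> P_model \<Theta> f \<in> model_space \<Theta>"
  unfolding model_space_eq_perp by (intro orth_proj_in model_annihilated_L2)

lemma P_model_L2: "unitary_symbol \<Theta> \<Longrightarrow> f \<in> L2 \<Longrightarrow> P_model \<Theta> f \<in> L2"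
  by (rule H2_L2[OF model_space_H2[OF P_model_in]])

lemma P_model_orthogonal:
  "unitary_symbol \<Theta> \<Longrightarrow> f \<in> L2 \<Longrightarrow> h \<in> model_space \<Theta> \<Longrightarrow> L2_inner (\<lambda>z. f z - P_model \<Theta> f z) h = 0"
  unfolding model_space_eq_perp by (intro orth_proj_orthogonal model_annihilated_L2)

lemma P_model_unique:
  assumes "unitary_symbol \<Theta>" "f \<in> L2" "g \<in> model_space \<Theta>"
    and "\<And>h. h \<in> model_space \<Theta> \<Longrightarrow> L2_inner (\<lambda>z. f z - g z) h = 0"
  shows "AE z in circle_measure. P_model \<Theta> f z = g z"
  using assms unfolding model_space_eq_perp by (intro orth_proj_unique model_annihilated_L2)

lemma P_model_cong_AE:
  assumes "f \<in> borel_measurable circle_measure" "f' \<in> borel_measurable circle_measure"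
    and "AE z in circle_measure. f z = f' z"
  shows "P_model \<Theta> f = P_model \<Theta> f'"
  by (rule orth_proj_cong_AE[OF _ assms]) (auto simp: model_space_def H2_def)

text \<open>Since \<open>T\<close> reverses inner products, it carries the orthogonality of \<open>f - P f\<close> to one model
  space into that of \<open>T f - T (P f)\<close> to its image, which is the other model space.\<close>

lemma P_model_antiunitary:
  assumes \<Theta>: "unitary_symbol \<Theta>" and \<Theta>': "unitary_symbol \<Theta>'"
    and TL2: "\<And>f. f \<in> L2 \<Longrightarrow> T f \<in> L2"
    and T: "\<And>f g. f \<in> L2 \<Longrightarrow> g \<in> L2 \<Longrightarrow> L2_inner (T f) (T g) = L2_inner g f"
    and into: "\<And>f. f \<in> model_space \<Theta> \<Longrightarrow> T f \<in> model_space \<Theta>'"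
    and onto: "\<And>h. h \<in> model_space \<Theta>' \<Longrightarrow>
      \<exists>k\<in>model_space \<Theta>. AE z in circle_measure. T k z = h z"
    and f: "f \<in> L2"
  shows "AE z in circle_measure. P_model \<Theta>' (T f) z = T (P_model \<Theta> f) z"
proof (rule P_model_unique[OF \<Theta>' TL2[OF f] into[OF P_model_in[OF \<Theta> f]]])
  let ?p = "P_model \<Theta> f"
  have pL2: "?p \<in> L2" using \<Theta> f by (rule P_model_L2)
  fix h assume h: "h \<in> model_space \<Theta>'"
  then have hL2: "h \<in> L2" by (intro H2_L2 model_space_H2)
  obtain k where k: "k \<in> model_space \<Theta>" and kh: "AE z in circle_measure. T k z = h z"
    using onto[OF h] by blast
  have kL2: "k \<in> L2" using k by (intro H2_L2 model_space_H2)
  have "L2_inner (T g) h = L2_inner k g" if "g \<in> L2" for g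
  proof -
    have "L2_inner (T g) h = L2_inner (T g) (T k)"
      using kh by (intro L2_inner_cong_AE L2_measurable TL2 that kL2 hL2) auto
    then show ?thesis using T[OF that kL2] by simp
  qed
  then have "L2_inner (\<lambda>z. T f z - T ?p z) h = L2_inner k f - L2_inner k ?p"
    using L2_inner_diff_left[OF TL2[OF f] TL2[OF pL2] hL2] f pL2 by simp
  also have "\<dots> = cnj (L2_inner (\<lambda>z. f z - ?p z) k)"
    using L2_inner_diff_left[OF f pL2 kL2] L2_inner_commute[of k] by simp
  also have "\<dots> = 0" using P_model_orthogonal[OF \<Theta> f k] by simp
  finally show "L2_inner (\<lambda>z. T f z - T ?p z) h = 0" .
qed

section \<open>The two conjugations\<close>

lemma J_star_L2: "conjugation J \<Longrightarrow> f \<in> L2 \<Longrightarrow> J_star J f \<in> L2"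
  unfolding J_star_def by (rule L2_conjugation[OF _ L2_cnj])

lemma J_star_J_star: "conjugation J \<Longrightarrow> J_star J (J_star J f) = f"
  by (simp add: J_star_def conjugation_invol)

lemma L2_inner_J_star:
  assumes J: "conjugation J" and f: "f \<in> L2" and g: "g \<in> L2"
  shows "L2_inner (J_star J f) (J_star J g) = L2_inner g f"
  using integral_circle_cnj[OF borel_measurable_integrable[OF integrable_cinner[OF g f]]]
  by (simp add: L2_inner_def J_star_def conjugation_cinner_both[OF J])

lemma fourier_coeff_J_star:
  assumes J: "conjugation J" and f: "f \<in> L2"
  shows "fourier_coeff (J_star J f) n = J (fourier_coeff f n)"
proof -
  have "flip (\<lambda>z. cnj z *\<^sub>C J (f z)) z = J_star J f z" if "z \<in> sphere 0 1" for z
    using that complex_norm_square[of z] by (simp add: flip_def J_star_def scaleC_scaleC mult.commute)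
  then have "fourier_coeff (J_star J f) n = fourier_coeff (flip (\<lambda>z. cnj z *\<^sub>C J (f z))) n"
    unfolding fourier_coeff_def by (intro Bochner_Integration.integral_cong) auto
  also have "\<dots> = J (fourier_coeff f n)"
    by (simp add: fourier_coeff_flip L2_cnj_scaleC L2_conjugation fourier_coeff_conjugation J f)
  finally show ?thesis .
qed

lemma conjugation_zero: "conjugation J \<Longrightarrow> J 0 = 0"
  using conjugation_norm[of J 0] by simp

text \<open>The hypothesis says that \<open>J_star J\<close> maps the functions \<open>B h\<close> to functions \<open>A k\<close>; it also
  preserves the Hardy space, as it acts on Fourier coefficients by \<open>J\<close>. Two symbols occur because the
  lemma is used in both directions between \<open>\<Theta>\<close> and \<open>tilde \<Theta>\<close>.\<close>

lemma J_star_model_space: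
  assumes A: "unitary_symbol A" and B: "unitary_symbol B" and J: "conjugation J"
    and AB: "AE z in circle_measure. \<forall>x. J (B (cnj z) x) = A z (J x)"
    and f: "f \<in> model_space A"
  shows "J_star J f \<in> model_space B"
proof -
  have fH2: "f \<in> H2" using f by (rule model_space_H2)
  note fL2 = H2_L2[OF fH2]
  have H2: "J_star J h \<in> H2" if "h \<in> H2" for h
    using that J by (simp add: H2_def J_star_L2 fourier_coeff_J_star conjugation_zero)
  have "L2_inner (J_star J f) (\<lambda>z. B z (h z)) = 0" if h: "h \<in> H2" for h
  proof -
    let ?g = "\<lambda>z. B z (h z)"
    have gL2: "?g \<in> L2" by (rule unitary_symbol_L2[OF B H2_L2[OF h]])
    have "L2_inner (J_star J f) ?g = L2_inner (J_star J f) (J_star J (J_star J ?g))"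
      by (simp add: J_star_J_star J)
    also have "\<dots> = L2_inner (J_star J ?g) f"
      by (intro L2_inner_J_star J fL2 J_star_L2 gL2)
    also have "\<dots> = L2_inner (\<lambda>z. A z (J_star J h z)) f"
    proof (rule L2_inner_cong_AE)
      show "AE z in circle_measure. J_star J ?g z = A z (J_star J h z)"
        using AB by eventually_elim (simp add: J_star_def)
      show "(\<lambda>z. A z (J_star J h z)) \<in> borel_measurable circle_measure"
        by (rule L2_measurable[OF unitary_symbol_L2[OF A H2_L2[OF H2[OF h]]]])
    qed (auto intro: L2_measurable J_star_L2 J gL2 fL2)
    also have "\<dots> = cnj (L2_inner f (\<lambda>z. A z (J_star J h z)))" by (rule L2_inner_commute)
    also have "\<dots> = 0" using f H2[OF h] by (simp add: model_space_def)
    finally show ?thesis .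
  qed
  then show ?thesis using H2[OF fH2] by (simp add: model_space_def)
qed

lemma J_symmetric_cadjoint:
  assumes "J_symmetric J \<Theta>" "conjugation J"
  shows "AE z in circle_measure. \<forall>x. J (cadjoint (\<Theta> z) x) = \<Theta> z (J x)"
  using assms(1) unfolding J_symmetric_def
proof eventually_elim
  case (elim z)
  then show ?case
    by (metis assms(2) comp_apply conjugation_invol)
qed

lemma J_symmetric_apply:
  assumes "J_symmetric J \<Theta>" "conjugation J"
  shows "AE z in circle_measure. \<forall>x. J (\<Theta> z x) = cadjoint (\<Theta> z) (J x)"
  using J_symmetric_cadjoint[OF assms]
proof eventually_elim
  case (elim z)
  then show ?case by (metis assms(2) conjugation_invol)
qed

lemma J_star_model_space_tilde:
  assumes \<Theta>: "unitary_symbol \<Theta>" and J: "conjugation J" and sym: "J_symmetric J \<Theta>"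
  shows "f \<in> model_space \<Theta> \<Longrightarrow> J_star J f \<in> model_space (tilde \<Theta>)"
    and "f \<in> model_space (tilde \<Theta>) \<Longrightarrow> J_star J f \<in> model_space \<Theta>"
proof -
  show "J_star J f \<in> model_space (tilde \<Theta>)" if "f \<in> model_space \<Theta>"
    by (rule J_star_model_space[OF \<Theta> unitary_symbol_tilde[OF \<Theta>] J _ that])
       (use J_symmetric_cadjoint[OF sym J] in \<open>simp add: tilde_def\<close>)
  show "J_star J f \<in> model_space \<Theta>" if "f \<in> model_space (tilde \<Theta>)"
    by (rule J_star_model_space[OF unitary_symbol_tilde[OF \<Theta>] \<Theta> J _ that])
       (use AE_circle_cnj[OF J_symmetric_apply[OF sym J]] in \<open>simp add: tilde_def\<close>)
qed

lemma J_star_P_model: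
  assumes \<Theta>: "unitary_symbol \<Theta>" and J: "conjugation J" and sym: "J_symmetric J \<Theta>"
    and f: "f \<in> L2"
  shows "AE z in circle_measure. J_star J (P_model \<Theta> f) z = P_model (tilde \<Theta>) (J_star J f) z"
proof -
  have "AE z in circle_measure. P_model (tilde \<Theta>) (J_star J f) z = J_star J (P_model \<Theta> f) z"
  proof (rule P_model_antiunitary[OF \<Theta> unitary_symbol_tilde[OF \<Theta>] _ _ _ _ f])
    fix h assume "h \<in> model_space (tilde \<Theta>)"
    then show "\<exists>k\<in>model_space \<Theta>. AE z in circle_measure. J_star J k z = h z"
      using J_star_model_space_tilde(2)[OF \<Theta> J sym]
      by (intro bexI[of _ "J_star J h"]) (auto simp: J_star_J_star J)
  qed (auto intro: J_star_L2 L2_inner_J_star J J_star_model_space_tilde(1)[OF \<Theta> J sym])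
  then show ?thesis by eventually_elim simp
qed

lemma C_conj_L2: "unitary_symbol \<Theta> \<Longrightarrow> conjugation J \<Longrightarrow> f \<in> L2 \<Longrightarrow> C_conj \<Theta> J f \<in> L2"
  unfolding C_conj_def by (rule unitary_symbol_L2[OF _ L2_cnj_scaleC[OF L2_conjugation]])

lemma L2_inner_C_conj:
  assumes \<Theta>: "unitary_symbol \<Theta>" and J: "conjugation J" and f: "f \<in> L2" and g: "g \<in> L2"
  shows "L2_inner (C_conj \<Theta> J f) (C_conj \<Theta> J g) = L2_inner g f"
  unfolding L2_inner_def
proof (rule integral_cong_AE)
  show "(\<lambda>z. cinner (C_conj \<Theta> J f z) (C_conj \<Theta> J g z)) \<in> borel_measurable circle_measure"
    "(\<lambda>z. cinner (g z) (f z)) \<in> borel_measurable circle_measure"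
    by (intro borel_measurable_integrable integrable_cinner C_conj_L2 \<Theta> J f g)+
  show "AE z in circle_measure. cinner (C_conj \<Theta> J f z) (C_conj \<Theta> J g z) = cinner (g z) (f z)"
    using unitary_symbol_AE[OF \<Theta>] AE_circle_sphere
  proof eventually_elim
    case (elim z)
    then have "z * cnj z = 1" using complex_norm_square[of z] by simp
    then show ?case
      by (simp add: C_conj_def unitary_op_cinner[OF elim(1)] cinner_scaleC_left
          cinner_scaleC_right conjugation_cinner_both[OF J] mult.assoc[symmetric])
  qed
qed

lemma scaleC_cnj_cancel:
  assumes "z \<in> sphere 0 1"
  shows "z *\<^sub>C cnj z *\<^sub>C x = x" "cnj z *\<^sub>C z *\<^sub>C x = x"
  using assms complex_norm_square[of z] by (simp_all add: scaleC_scaleC mult.commute)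

lemma C_conj_C_conj:
  assumes \<Theta>: "unitary_symbol \<Theta>" and J: "conjugation J" and sym: "J_symmetric J \<Theta>"
  shows "AE z in circle_measure. C_conj \<Theta> J (C_conj \<Theta> J f) z = f z"
  using unitary_symbol_AE[OF \<Theta>] AE_circle_sphere J_symmetric_apply[OF sym J]
proof eventually_elim
  case (elim z)
  have lin: "clinear (\<Theta> z)" "clinear (cadjoint (\<Theta> z))"
    using elim(1) by (auto intro: unitary_op_clinear unitary_op_cadjoint)
  have "\<Theta> z (cadjoint (\<Theta> z) x) = x" for x
    using elim(1) by (simp add: unitary_op_def fun_eq_iff)
  then show ?case
    using elim(2,3)
    by (simp add: C_conj_def conjugation_scaleC[OF J] conjugation_invol[OF J]
        clinear_scaleC[OF lin(1)] clinear_scaleC[OF lin(2)] scaleC_cnj_cancel del: mem_sphere_0)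
qed

text \<open>By \<open>J\<close>-symmetry the antiunitary map is an involution, and hence symmetric.\<close>

lemma L2_inner_C_conj_swap:
  assumes \<Theta>: "unitary_symbol \<Theta>" and J: "conjugation J" and sym: "J_symmetric J \<Theta>"
    and f: "f \<in> L2" and g: "g \<in> L2"
  shows "L2_inner (C_conj \<Theta> J f) g = L2_inner (C_conj \<Theta> J g) f"
proof -
  have "L2_inner (C_conj \<Theta> J f) g = L2_inner (C_conj \<Theta> J f) (C_conj \<Theta> J (C_conj \<Theta> J g))"
    using C_conj_C_conj[OF \<Theta> J sym, of g]
    by (intro L2_inner_cong_AE L2_measurable C_conj_L2 \<Theta> J f g) auto
  also have "\<dots> = L2_inner (C_conj \<Theta> J g) f"
    by (intro L2_inner_C_conj \<Theta> J f C_conj_L2 g)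
  finally show ?thesis .
qed

text \<open>The map \<open>C_conj \<Theta> J\<close> sends negative monomials into \<open>\<Theta> H2\<close>, and \<open>\<Theta> H2\<close> into the orthogonal
  complement of \<open>H2\<close>. The model space is orthogonal to both targets, so by symmetry of the map
  its image is orthogonal to negative monomials and to \<open>\<Theta> H2\<close>.\<close>

lemma C_conj_model_space:
  assumes \<Theta>: "unitary_symbol \<Theta>" and J: "conjugation J" and sym: "J_symmetric J \<Theta>"
    and f: "f \<in> model_space \<Theta>"
  shows "C_conj \<Theta> J f \<in> model_space \<Theta>"
proof -
  have fH2: "f \<in> H2" using f by (rule model_space_H2)
  note fL2 = H2_L2[OF fH2]
  have meas: "h \<in> H2 \<Longrightarrow> (\<lambda>z. \<Theta> z (h z)) \<in> borel_measurable circle_measure" for h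
    by (rule L2_measurable[OF unitary_symbol_L2[OF \<Theta> H2_L2]])
  have "L2_inner (C_conj \<Theta> J f) (\<lambda>z. (z powi n) *\<^sub>C x) = 0" if n: "n < 0" for n x
  proof -
    have hH2: "(\<lambda>z. (z powi (- n - 1)) *\<^sub>C J x) \<in> H2"
      using n by (intro circle_powi_H2) simp
    have "L2_inner (C_conj \<Theta> J f) (\<lambda>z. (z powi n) *\<^sub>C x)
        = L2_inner (C_conj \<Theta> J (\<lambda>z. (z powi n) *\<^sub>C x)) f"
      by (intro L2_inner_C_conj_swap \<Theta> J sym fL2 circle_powi_L2)
    also have "\<dots> = L2_inner (\<lambda>z. \<Theta> z ((z powi (- n - 1)) *\<^sub>C J x)) f"
    proof (rule L2_inner_cong_AE)
      show "AE z in circle_measure. C_conj \<Theta> J (\<lambda>z. (z powi n) *\<^sub>C x) z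
          = \<Theta> z ((z powi (- n - 1)) *\<^sub>C J x)"
        using AE_circle_sphere
      proof eventually_elim
        case (elim z)
        have "cnj z * cnj (z powi n) = z powi (- 1 + - n)"
          using cnj_circle_powi[OF elim, of 1] cnj_circle_powi[OF elim, of n]
            circle_powi_add[OF elim, of "- 1" "- n"] by simp
        also have "- 1 + - n = - n - 1" by simp
        finally show ?case
          unfolding C_conj_def conjugation_scaleC[OF J] scaleC_scaleC by (simp only:)
      qed
    qed (auto intro: L2_measurable C_conj_L2 \<Theta> J circle_powi_L2 fL2 meas[OF hH2])
    also have "\<dots> = cnj (L2_inner f (\<lambda>z. \<Theta> z ((z powi (- n - 1)) *\<^sub>C J x)))"
      by (rule L2_inner_commute)
    also have "\<dots> = 0" using f hH2 by (simp add: model_space_def)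
    finally show ?thesis .
  qed
  then have H2: "C_conj \<Theta> J f \<in> H2"
    using C_conj_L2[OF \<Theta> J fL2] by (simp add: H2_def fourier_coeff_eq_0_iff)
  have "L2_inner (C_conj \<Theta> J f) (\<lambda>z. \<Theta> z (h z)) = 0" if h: "h \<in> H2" for h
  proof -
    note hL2 = H2_L2[OF h]
    have gL2: "(\<lambda>z. cnj z *\<^sub>C J (h z)) \<in> L2"
      by (rule L2_cnj_scaleC[OF L2_conjugation[OF J hL2]])
    have \<Theta>hL2: "(\<lambda>z. \<Theta> z (h z)) \<in> L2"
      by (rule unitary_symbol_L2[OF \<Theta> hL2])
    have "L2_inner (C_conj \<Theta> J f) (\<lambda>z. \<Theta> z (h z)) = L2_inner (C_conj \<Theta> J (\<lambda>z. \<Theta> z (h z))) f"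
      by (rule L2_inner_C_conj_swap[OF \<Theta> J sym fL2 \<Theta>hL2])
    also have "\<dots> = L2_inner (\<lambda>z. cnj z *\<^sub>C J (h z)) f"
    proof (rule L2_inner_cong_AE)
      show "AE z in circle_measure. C_conj \<Theta> J (\<lambda>z. \<Theta> z (h z)) z = cnj z *\<^sub>C J (h z)"
        using unitary_symbol_AE[OF \<Theta>] J_symmetric_apply[OF sym J]
      proof eventually_elim
        case (elim z)
        have "\<Theta> z (cadjoint (\<Theta> z) x) = x" for x
          using elim(1) by (simp add: unitary_op_def fun_eq_iff)
        then show ?case
          using elim(2) by (simp add: C_conj_def clinear_scaleC[OF unitary_op_clinear[OF elim(1)]])
      qed
    qed (auto intro: L2_measurable C_conj_L2 \<Theta> J \<Theta>hL2 fL2 gL2)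
    also have "\<dots> = 0"
      using H2_fourier[OF h]
      by (intro H2_orthogonal[OF fH2 gL2])
         (simp add: fourier_coeff_conjugation[OF J hL2] conjugation_zero[OF J])
    finally show ?thesis .
  qed
  then show ?thesis using H2 by (simp add: model_space_def)
qed

lemma C_conj_P_model:
  assumes \<Theta>: "unitary_symbol \<Theta>" and J: "conjugation J" and sym: "J_symmetric J \<Theta>"
    and f: "f \<in> L2"
  shows "AE z in circle_measure. C_conj \<Theta> J (P_model \<Theta> f) z = P_model \<Theta> (C_conj \<Theta> J f) z"
proof -
  have "AE z in circle_measure. P_model \<Theta> (C_conj \<Theta> J f) z = C_conj \<Theta> J (P_model \<Theta> f) z"
  proof (rule P_model_antiunitary[OF \<Theta> \<Theta> _ _ _ _ f])
    fix h assume "h \<in> model_space \<Theta>"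
    then show "\<exists>k\<in>model_space \<Theta>. AE z in circle_measure. C_conj \<Theta> J k z = h z"
      using C_conj_C_conj[OF \<Theta> J sym]
      by (intro bexI[of _ "C_conj \<Theta> J h"] C_conj_model_space[OF \<Theta> J sym])
  qed (auto intro: C_conj_L2 L2_inner_C_conj C_conj_model_space \<Theta> J sym)
  then show ?thesis by eventually_elim simp
qed

lemma model_space_inf_iff:
  "f \<in> model_space_inf \<Theta> \<longleftrightarrow> f \<in> model_space \<Theta> \<and> (\<exists>M. AE z in circle_measure. norm (f z) \<le> M)"
  by (auto simp: model_space_inf_def Hinf_iff model_space_H2)

lemma C_conj_model_space_inf:
  assumes \<Theta>: "unitary_symbol \<Theta>" and J: "conjugation J" and sym: "J_symmetric J \<Theta>"
    and f: "f \<in> model_space_inf \<Theta>"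
  shows "C_conj \<Theta> J f \<in> model_space_inf \<Theta>"
proof -
  obtain M where M: "AE z in circle_measure. norm (f z) \<le> M"
    using f by (auto simp: model_space_inf_iff)
  have "AE z in circle_measure. norm (C_conj \<Theta> J f z) \<le> M"
    using M unitary_symbol_AE[OF \<Theta>] AE_circle_sphere
    by eventually_elim (simp add: C_conj_def unitary_op_norm conjugation_norm[OF J])
  then show ?thesis
    using f C_conj_model_space[OF \<Theta> J sym] by (auto simp: model_space_inf_iff)
qed

lemma J_star_model_space_inf:
  assumes \<Theta>: "unitary_symbol \<Theta>" and J: "conjugation J" and sym: "J_symmetric J \<Theta>"
    and f: "f \<in> model_space_inf (tilde \<Theta>)"
  shows "J_star J f \<in> model_space_inf \<Theta>"
proof -
  obtain M where "AE z in circle_measure. norm (f z) \<le> M"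
    using f by (auto simp: model_space_inf_iff)
  then have "AE z in circle_measure. norm (J_star J f z) \<le> M"
    using AE_circle_cnj[of "\<lambda>z. norm (f z) \<le> M"] by (simp add: J_star_def conjugation_norm[OF J])
  then show ?thesis
    using f J_star_model_space_tilde(2)[OF \<Theta> J sym] by (auto simp: model_space_inf_iff)
qed

section \<open>Truncated Toeplitz and Hankel operators under conjugation\<close>

lemma toeplitz_op_eq:
  assumes f: "f \<in> model_space_inf \<Theta>1"
    and meas: "(\<lambda>z. \<Psi> z (f z)) \<in> borel_measurable circle_measure" and R: "R \<in> L2"
    and eq: "AE z in circle_measure. \<Psi> z (f z) = R z"
  shows "toeplitz_op \<Theta>1 \<Theta>2 \<Psi> f = P_model \<Theta>2 R"
  using f P_model_cong_AE[OF meas L2_measurable[OF R] eq] by (simp add: toeplitz_op_def)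

text \<open>The flip moves the Hardy space, and with it the range of \<open>P\<^sub>+\<close>, into the orthogonal complement
  of the Hardy space, hence of the model space.\<close>

lemma P_model_flip_minus_P_plus:
  assumes \<Theta>: "unitary_symbol \<Theta>" and h: "h \<in> L2"
  shows "AE z in circle_measure. P_model \<Theta> (flip (\<lambda>z. h z - P_plus h z)) z = P_model \<Theta> (flip h) z"
proof -
  have p: "P_plus h \<in> H2"
    unfolding H2_eq_perp by (rule orth_proj_in[OF negative_monomials_L2 h])
  note pL2 = H2_L2[OF p]
  note fh = L2_flip[OF h] and fp = L2_flip[OF pL2]
  let ?g = "P_model \<Theta> (flip h)"
  have gL2: "?g \<in> L2" by (rule P_model_L2[OF \<Theta> fh])
  show ?thesis
  proof (rule P_model_unique[OF \<Theta> L2_flip[OF L2_diff[OF h pL2]] P_model_in[OF \<Theta> fh]])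
    fix k assume k: "k \<in> model_space \<Theta>"
    have kH2: "k \<in> H2" using k by (rule model_space_H2)
    note kL2 = H2_L2[OF kH2]
    have "flip (\<lambda>z. h z - P_plus h z) z - ?g z = (flip h z - ?g z) - flip (P_plus h) z" for z
      by (simp add: flip_def scaleC_diff_right)
    then have "L2_inner (\<lambda>z. flip (\<lambda>z. h z - P_plus h z) z - ?g z) k
        = L2_inner (\<lambda>z. flip h z - ?g z) k - L2_inner (flip (P_plus h)) k"
      by (simp only: L2_inner_diff_left[OF L2_diff[OF fh gL2] fp kL2])
    also have "L2_inner (\<lambda>z. flip h z - ?g z) k = 0"
      by (rule P_model_orthogonal[OF \<Theta> fh k])
    also have "L2_inner (flip (P_plus h)) k = 0"
      by (rule H2_orthogonal[OF kH2 fp]) (simp add: fourier_coeff_flip[OF pL2] H2_fourier[OF p])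
    finally show "L2_inner (\<lambda>z. flip (\<lambda>z. h z - P_plus h z) z - ?g z) k = 0" by simp
  qed
qed

text \<open>Here \<open>\<Psi> f\<close> is recognized as a flip, so that its square integrability follows from that of \<open>R\<close> and
  the double flip disappears.\<close>

lemma hankel_op_eq:
  assumes f: "f \<in> model_space_inf \<Theta>1" and \<Theta>2: "unitary_symbol \<Theta>2"
    and meas: "(\<lambda>z. \<Psi> z (f z)) \<in> borel_measurable circle_measure" and R: "R \<in> L2"
    and eq: "AE z in circle_measure. \<Psi> z (f z) = flip R z"
  shows "AE z in circle_measure. hankel_op \<Theta>1 \<Theta>2 \<Psi> f z = P_model \<Theta>2 R z"
proof -
  let ?h = "\<lambda>z. \<Psi> z (f z)"
  have h: "?h \<in> L2"
    by (rule L2_norm_eq[OF L2_flip[OF R] meas]) (use eq in eventually_elim, simp)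
  have "AE z in circle_measure. flip ?h z = R z"
    using AE_circle_cnj[OF eq] AE_circle_sphere
  proof eventually_elim
    case (elim z)
    have "flip ?h z = flip (flip R) z" unfolding flip_def[of ?h] flip_def[of "flip R"] elim(1) ..
    then show ?case using flip_flip[OF elim(2)] by simp
  qed
  then have "P_model \<Theta>2 (flip ?h) = P_model \<Theta>2 R"
    by (rule P_model_cong_AE[OF L2_measurable[OF L2_flip[OF h]] L2_measurable[OF R]])
  then show ?thesis
    using P_model_flip_minus_P_plus[OF \<Theta>2 h] f by (simp add: hankel_op_def)
qed

lemma hankel_op_eq_flip:
  assumes f: "f \<in> model_space_inf \<Theta>1" and \<Theta>2: "unitary_symbol \<Theta>2" and h: "(\<lambda>z. \<Psi> z (f z)) \<in> L2"
  shows "AE z in circle_measure. hankel_op \<Theta>1 \<Theta>2 \<Psi> f z = P_model \<Theta>2 (flip (\<lambda>z. \<Psi> z (f z))) z"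
  using P_model_flip_minus_P_plus[OF \<Theta>2 h] f by (simp add: hankel_op_def)

theorem proposition6p1:
  fixes \<Theta>1 \<Theta>2 \<Phi> :: "complex \<Rightarrow> 'h::fd_chilbert \<Rightarrow> 'h"
    and J1 J2 :: "'h \<Rightarrow> 'h"
  assumes "pure_inner \<Theta>1" and "pure_inner \<Theta>2"
    and "conjugation J1" and "conjugation J2"
    and "J_symmetric J1 \<Theta>1" and "J_symmetric J2 \<Theta>2"
    and "\<Phi> \<in> L2_op"
  shows
   "(op_eq_on (model_space_inf \<Theta>1)
       (C_conj \<Theta>2 J2 \<circ> toeplitz_op \<Theta>1 \<Theta>2 \<Phi> \<circ> C_conj \<Theta>1 J1)
       (toeplitz_op \<Theta>1 \<Theta>2 (\<lambda>z. J2 \<circ> cadjoint (\<Theta>2 z) \<circ> \<Phi> z \<circ> \<Theta>1 z \<circ> J1))) \<and>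
    (op_eq_on (model_space_inf \<Theta>1)
       (C_conj \<Theta>2 J2 \<circ> hankel_op \<Theta>1 \<Theta>2 \<Phi> \<circ> C_conj \<Theta>1 J1)
       (hankel_op \<Theta>1 \<Theta>2 (\<lambda>z. J2 \<circ> tilde \<Theta>2 z \<circ> \<Phi> z \<circ> \<Theta>1 z \<circ> J1))) \<and>
    (op_eq_on (model_space_inf (tilde \<Theta>1))
       (J_star J2 \<circ> toeplitz_op \<Theta>1 \<Theta>2 \<Phi> \<circ> J_star J1)
       (toeplitz_op (tilde \<Theta>1) (tilde \<Theta>2) (\<lambda>z. J2 \<circ> \<Phi> (cnj z) \<circ> J1))) \<and>
    (op_eq_on (model_space_inf (tilde \<Theta>1))
       (J_star J2 \<circ> hankel_op \<Theta>1 \<Theta>2 \<Phi> \<circ> J_star J1)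
       (hankel_op (tilde \<Theta>1) (tilde \<Theta>2) (\<lambda>z. J2 \<circ> \<Phi> (cnj z) \<circ> J1))) \<and>
    (op_eq_on (model_space_inf (tilde \<Theta>1))
       (C_conj \<Theta>2 J2 \<circ> toeplitz_op \<Theta>1 \<Theta>2 \<Phi> \<circ> J_star J1)
       (hankel_op (tilde \<Theta>1) \<Theta>2 (\<lambda>z. J2 \<circ> cadjoint (\<Theta>2 (cnj z)) \<circ> \<Phi> (cnj z) \<circ> J1))) \<and>
    (op_eq_on (model_space_inf \<Theta>1)
       (J_star J2 \<circ> hankel_op \<Theta>1 \<Theta>2 \<Phi> \<circ> C_conj \<Theta>1 J1)
       (toeplitz_op \<Theta>1 (tilde \<Theta>2) (\<lambda>z. J2 \<circ> \<Phi> z \<circ> \<Theta>1 z \<circ> J1)))"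
proof -
  have \<Theta>1: "unitary_symbol \<Theta>1" and \<Theta>2: "unitary_symbol \<Theta>2"
    using assms(1,2) by (auto intro: pure_inner_unitary_symbol)
  note J1 = assms(3) and J2 = assms(4) and sym1 = assms(5) and sym2 = assms(6) and \<Phi> = assms(7)
  note \<Theta>2t = unitary_symbol_tilde[OF \<Theta>2]
  note m\<Theta>1 = unitary_symbol_measurable[OF \<Theta>1] and m\<Theta>2 = unitary_symbol_measurable[OF \<Theta>2]
    and m\<Phi> = L2_op_measurable_symbol[OF \<Phi>]
  have meas_f: "f \<in> borel_measurable circle_measure" if "f \<in> model_space_inf \<Theta>" for f and \<Theta> :: "complex \<Rightarrow> 'h \<Rightarrow> 'h"
    using that by (auto simp: model_space_inf_iff intro: L2_measurable H2_L2 model_space_H2)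
  have \<Phi>L2: "(\<lambda>z. \<Phi> z (f z)) \<in> L2" if "f \<in> model_space_inf \<Theta>1" for f
    using that L2_op_apply_L2[OF \<Phi> meas_f[OF that]] by (auto simp: model_space_inf_iff)
  note \<Phi>cl = measurable_symbol_clinear[OF m\<Phi>] and \<Theta>1cl = measurable_symbol_clinear[OF m\<Theta>1]
    and \<Theta>2cl = measurable_symbol_clinear[OF m\<Theta>2]
  have cnj_sphere: "cnj z \<in> sphere 0 1" if "z \<in> sphere 0 1" for z :: complex
    using that by simp
  note Jsym2 = J_symmetric_cadjoint[OF sym2 J2] and Jsym2_cnj = AE_circle_cnj[OF J_symmetric_cadjoint[OF sym2 J2]]
  note C1_inf = C_conj_model_space_inf[OF \<Theta>1 J1 sym1]
    and J1_inf = J_star_model_space_inf[OF \<Theta>1 J1 sym1]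
  \<comment> \<open>The factor \<open>cnj z\<close> in the first conjugation passes through \<open>\<Theta>1\<close> and \<open>\<Phi>\<close>.\<close>
  have \<Phi>C1: "\<Phi> z (C_conj \<Theta>1 J1 f z) = cnj z *\<^sub>C \<Phi> z (\<Theta>1 z (J1 (f z)))" if "z \<in> sphere 0 1" for f z
    by (simp only: C_conj_def clinear_scaleC[OF \<Theta>1cl[OF that]] clinear_scaleC[OF \<Phi>cl[OF that]])
  have meas1: "(\<lambda>z. \<Phi> z (\<Theta>1 z (J1 (f z)))) \<in> borel_measurable circle_measure"
    if "f \<in> model_space_inf \<Theta>1" for f
    by (rule measurable_symbol_apply[OF m\<Phi> measurable_symbol_apply[OF m\<Theta>1
          conjugation_measurable[OF J1 meas_f[OF that]]]])
  have meas2: "(\<lambda>z. \<Phi> (cnj z) (J1 (f z))) \<in> borel_measurable circle_measure"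
    if "f \<in> model_space_inf (tilde \<Theta>1)" for f
    by (rule measurable_symbol_apply[OF measurable_symbol_cnj[OF m\<Phi>]
          conjugation_measurable[OF J1 meas_f[OF that]]])

  have "AE z in circle_measure. C_conj \<Theta>2 J2 (toeplitz_op \<Theta>1 \<Theta>2 \<Phi> (C_conj \<Theta>1 J1 f)) z
      = toeplitz_op \<Theta>1 \<Theta>2 (\<lambda>z. J2 \<circ> cadjoint (\<Theta>2 z) \<circ> \<Phi> z \<circ> \<Theta>1 z \<circ> J1) f z"
    if f: "f \<in> model_space_inf \<Theta>1" for f
  proof -
    let ?G = "\<lambda>z. \<Phi> z (C_conj \<Theta>1 J1 f z)"
    have G: "?G \<in> L2" by (rule \<Phi>L2[OF C1_inf[OF f]])
    have "toeplitz_op \<Theta>1 \<Theta>2 (\<lambda>z. J2 \<circ> cadjoint (\<Theta>2 z) \<circ> \<Phi> z \<circ> \<Theta>1 z \<circ> J1) f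
        = P_model \<Theta>2 (C_conj \<Theta>2 J2 ?G)"
    proof (rule toeplitz_op_eq[OF f _ C_conj_L2[OF \<Theta>2 J2 G]])
      show "(\<lambda>z. (J2 \<circ> cadjoint (\<Theta>2 z) \<circ> \<Phi> z \<circ> \<Theta>1 z \<circ> J1) (f z)) \<in> borel_measurable circle_measure"
        using conjugation_measurable[OF J2
            measurable_symbol_apply[OF measurable_symbol_cadjoint[OF m\<Theta>2] meas1[OF f]]] by simp
      show "AE z in circle_measure. (J2 \<circ> cadjoint (\<Theta>2 z) \<circ> \<Phi> z \<circ> \<Theta>1 z \<circ> J1) (f z)
          = C_conj \<Theta>2 J2 ?G z"
        using AE_circle_sphere Jsym2
        by eventually_elim
          (simp only: comp_apply C_conj_def[of \<Theta>2] \<Phi>C1 conjugation_scaleC[OF J2]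
            complex_cnj_cnj scaleC_cnj_cancel)
    qed
    moreover have "toeplitz_op \<Theta>1 \<Theta>2 \<Phi> (C_conj \<Theta>1 J1 f) = P_model \<Theta>2 ?G"
      by (simp add: toeplitz_op_def C1_inf[OF f])
    ultimately show ?thesis using C_conj_P_model[OF \<Theta>2 J2 sym2 G] by simp
  qed
  moreover
  have "AE z in circle_measure. C_conj \<Theta>2 J2 (hankel_op \<Theta>1 \<Theta>2 \<Phi> (C_conj \<Theta>1 J1 f)) z
      = hankel_op \<Theta>1 \<Theta>2 (\<lambda>z. J2 \<circ> tilde \<Theta>2 z \<circ> \<Phi> z \<circ> \<Theta>1 z \<circ> J1) f z"
    if f: "f \<in> model_space_inf \<Theta>1" for f
  proof -
    let ?G = "\<lambda>z. \<Phi> z (C_conj \<Theta>1 J1 f z)"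
    have G: "?G \<in> L2" by (rule \<Phi>L2[OF C1_inf[OF f]])
    have "AE z in circle_measure. hankel_op \<Theta>1 \<Theta>2 (\<lambda>z. J2 \<circ> tilde \<Theta>2 z \<circ> \<Phi> z \<circ> \<Theta>1 z \<circ> J1) f z
        = P_model \<Theta>2 (C_conj \<Theta>2 J2 (flip ?G)) z"
    proof (rule hankel_op_eq[OF f \<Theta>2 _ C_conj_L2[OF \<Theta>2 J2 L2_flip[OF G]]])
      show "(\<lambda>z. (J2 \<circ> tilde \<Theta>2 z \<circ> \<Phi> z \<circ> \<Theta>1 z \<circ> J1) (f z)) \<in> borel_measurable circle_measure"
        using conjugation_measurable[OF J2
            measurable_symbol_apply[OF measurable_symbol_tilde[OF m\<Theta>2] meas1[OF f]]] by simp
      show "AE z in circle_measure. (J2 \<circ> tilde \<Theta>2 z \<circ> \<Phi> z \<circ> \<Theta>1 z \<circ> J1) (f z)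
          = flip (C_conj \<Theta>2 J2 (flip ?G)) z"
        using AE_circle_sphere Jsym2_cnj
        by eventually_elim
          (simp only: comp_apply C_conj_def[of \<Theta>2] flip_def tilde_def \<Phi>C1 conjugation_scaleC[OF J2]
            complex_cnj_cnj scaleC_cnj_cancel clinear_scaleC[OF \<Theta>2cl[OF cnj_sphere]])
    qed
    then show ?thesis
      using hankel_op_eq_flip[where \<Psi> = \<Phi>, OF C1_inf[OF f] \<Theta>2 G] C_conj_P_model[OF \<Theta>2 J2 sym2 L2_flip[OF G]]
      by eventually_elim (simp add: C_conj_def[of \<Theta>2])
  qed
  moreover
  have "AE z in circle_measure. J_star J2 (toeplitz_op \<Theta>1 \<Theta>2 \<Phi> (J_star J1 f)) z
      = toeplitz_op (tilde \<Theta>1) (tilde \<Theta>2) (\<lambda>z. J2 \<circ> \<Phi> (cnj z) \<circ> J1) f z"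
    if f: "f \<in> model_space_inf (tilde \<Theta>1)" for f
  proof -
    let ?G = "\<lambda>z. \<Phi> z (J_star J1 f z)"
    have G: "?G \<in> L2" by (rule \<Phi>L2[OF J1_inf[OF f]])
    have "toeplitz_op (tilde \<Theta>1) (tilde \<Theta>2) (\<lambda>z. J2 \<circ> \<Phi> (cnj z) \<circ> J1) f
        = P_model (tilde \<Theta>2) (J_star J2 ?G)"
      by (rule toeplitz_op_eq[OF f _ J_star_L2[OF J2 G]])
         (use conjugation_measurable[OF J2 meas2[OF f]] in \<open>simp_all add: J_star_def\<close>)
    moreover have "toeplitz_op \<Theta>1 \<Theta>2 \<Phi> (J_star J1 f) = P_model \<Theta>2 ?G"
      by (simp add: toeplitz_op_def J1_inf[OF f])
    ultimately show ?thesis using J_star_P_model[OF \<Theta>2 J2 sym2 G] by simp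
  qed
  moreover
  have "AE z in circle_measure. J_star J2 (hankel_op \<Theta>1 \<Theta>2 \<Phi> (J_star J1 f)) z
      = hankel_op (tilde \<Theta>1) (tilde \<Theta>2) (\<lambda>z. J2 \<circ> \<Phi> (cnj z) \<circ> J1) f z"
    if f: "f \<in> model_space_inf (tilde \<Theta>1)" for f
  proof -
    let ?G = "\<lambda>z. \<Phi> z (J_star J1 f z)"
    have G: "?G \<in> L2" by (rule \<Phi>L2[OF J1_inf[OF f]])
    have "AE z in circle_measure. hankel_op (tilde \<Theta>1) (tilde \<Theta>2) (\<lambda>z. J2 \<circ> \<Phi> (cnj z) \<circ> J1) f z
        = P_model (tilde \<Theta>2) (J_star J2 (flip ?G)) z"
    proof (rule hankel_op_eq[OF f \<Theta>2t _ J_star_L2[OF J2 L2_flip[OF G]]])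
      show "(\<lambda>z. (J2 \<circ> \<Phi> (cnj z) \<circ> J1) (f z)) \<in> borel_measurable circle_measure"
        using conjugation_measurable[OF J2 meas2[OF f]] by simp
      show "AE z in circle_measure. (J2 \<circ> \<Phi> (cnj z) \<circ> J1) (f z) = flip (J_star J2 (flip ?G)) z"
        using AE_circle_sphere
        by eventually_elim
          (simp only: comp_apply J_star_def flip_def conjugation_scaleC[OF J2]
            complex_cnj_cnj scaleC_cnj_cancel)
    qed
    then show ?thesis
      using AE_circle_cnj[OF hankel_op_eq_flip[where \<Psi> = \<Phi>, OF J1_inf[OF f] \<Theta>2 G]]
        J_star_P_model[OF \<Theta>2 J2 sym2 L2_flip[OF G]]
      by eventually_elim (simp add: J_star_def[of J2])
  qed
  moreover
  have "AE z in circle_measure. C_conj \<Theta>2 J2 (toeplitz_op \<Theta>1 \<Theta>2 \<Phi> (J_star J1 f)) z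
      = hankel_op (tilde \<Theta>1) \<Theta>2 (\<lambda>z. J2 \<circ> cadjoint (\<Theta>2 (cnj z)) \<circ> \<Phi> (cnj z) \<circ> J1) f z"
    if f: "f \<in> model_space_inf (tilde \<Theta>1)" for f
  proof -
    let ?G = "\<lambda>z. \<Phi> z (J_star J1 f z)"
    have G: "?G \<in> L2" by (rule \<Phi>L2[OF J1_inf[OF f]])
    have hankel: "AE z in circle_measure.
        hankel_op (tilde \<Theta>1) \<Theta>2 (\<lambda>z. J2 \<circ> cadjoint (\<Theta>2 (cnj z)) \<circ> \<Phi> (cnj z) \<circ> J1) f z
        = P_model \<Theta>2 (C_conj \<Theta>2 J2 ?G) z"
    proof (rule hankel_op_eq[OF f \<Theta>2 _ C_conj_L2[OF \<Theta>2 J2 G]])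
      show "(\<lambda>z. (J2 \<circ> cadjoint (\<Theta>2 (cnj z)) \<circ> \<Phi> (cnj z) \<circ> J1) (f z)) \<in> borel_measurable circle_measure"
        using conjugation_measurable[OF J2
            measurable_symbol_apply[OF measurable_symbol_tilde[OF m\<Theta>2] meas2[OF f]]]
        by (simp add: tilde_def)
      show "AE z in circle_measure. (J2 \<circ> cadjoint (\<Theta>2 (cnj z)) \<circ> \<Phi> (cnj z) \<circ> J1) (f z)
          = flip (C_conj \<Theta>2 J2 ?G) z"
        using AE_circle_sphere Jsym2_cnj
        by eventually_elim
          (simp only: comp_apply C_conj_def J_star_def flip_def
            complex_cnj_cnj scaleC_cnj_cancel clinear_scaleC[OF \<Theta>2cl[OF cnj_sphere]])
    qed
    have toeplitz: "toeplitz_op \<Theta>1 \<Theta>2 \<Phi> (J_star J1 f) = P_model \<Theta>2 ?G"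
      by (simp add: toeplitz_op_def J1_inf[OF f])
    show ?thesis
      unfolding toeplitz using C_conj_P_model[OF \<Theta>2 J2 sym2 G] hankel by eventually_elim simp
  qed
  moreover
  have "AE z in circle_measure. J_star J2 (hankel_op \<Theta>1 \<Theta>2 \<Phi> (C_conj \<Theta>1 J1 f)) z
      = toeplitz_op \<Theta>1 (tilde \<Theta>2) (\<lambda>z. J2 \<circ> \<Phi> z \<circ> \<Theta>1 z \<circ> J1) f z"
    if f: "f \<in> model_space_inf \<Theta>1" for f
  proof -
    let ?G = "\<lambda>z. \<Phi> z (C_conj \<Theta>1 J1 f z)"
    have G: "?G \<in> L2" by (rule \<Phi>L2[OF C1_inf[OF f]])
    have toeplitz: "toeplitz_op \<Theta>1 (tilde \<Theta>2) (\<lambda>z. J2 \<circ> \<Phi> z \<circ> \<Theta>1 z \<circ> J1) f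
        = P_model (tilde \<Theta>2) (J_star J2 (flip ?G))"
    proof (rule toeplitz_op_eq[OF f _ J_star_L2[OF J2 L2_flip[OF G]]])
      show "(\<lambda>z. (J2 \<circ> \<Phi> z \<circ> \<Theta>1 z \<circ> J1) (f z)) \<in> borel_measurable circle_measure"
        using conjugation_measurable[OF J2 meas1[OF f]] by simp
      show "AE z in circle_measure. (J2 \<circ> \<Phi> z \<circ> \<Theta>1 z \<circ> J1) (f z) = J_star J2 (flip ?G) z"
        using AE_circle_sphere
        by eventually_elim
          (simp only: comp_apply J_star_def flip_def \<Phi>C1 complex_cnj_cnj scaleC_cnj_cancel)
    qed
    show ?thesis
      unfolding toeplitz
      using AE_circle_cnj[OF hankel_op_eq_flip[where \<Psi> = \<Phi>, OF C1_inf[OF f] \<Theta>2 G]]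
        J_star_P_model[OF \<Theta>2 J2 sym2 L2_flip[OF G]]
      by eventually_elim (simp add: J_star_def[of J2])
  qed
  ultimately show ?thesis
    unfolding op_eq_on_def comp_apply by blast
qed

end
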